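(* Let $K$ be a field complete with respect to a discrete valuation, of characteristic $p>0$, with perfect residue field $\kappa$. Let $L/K$ be a totally and weakly ramified Galois extension of degree $p^n$ with group $G$. For $h\in\mathbb{Z}$ let $\mathfrak{A}=\{\alpha\in K[G]:\alpha\cdot\mathfrak{P}_L^h\subseteq\mathfrak{P}_L^h\}$ be the associated order of $\mathfrak{P}_L^h$. (i) If $h\equiv1\pmod{p^n}$, then $\mathfrak{P}_L^h$ is free over $\mathfrak{A}$, and $\mathfrak{A}$ has embedding dimension $n+1$. (ii) If $h\not\equiv1\pmod{p^n}$, let $h'\equiv h\pmod{p^n}$ with $2\le h'\le p^n$, and write $m=h'-1$ and $k=\max(m,p^n-m)$. Then (a) $\mathfrak{P}_L^h$ is free over $\mathfrak{A}$ if and only if $h'\ge1+\tfrac12p^n$; (b) if $\mathfrak{P}_L^h$ is not free, the minimal number of generators of $\mathfrak{P}_L^h$ as an $\mathfrak{A}$-module is $2+\alpha(m)-\beta(m)$; (c) the embedding dimension of $\mathfrak{A}$ is $n+2+\alpha(k)-\gamma(k)$.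
   Context: $\mathfrak{O}_L$, $\mathfrak{P}_L$ are the valuation ring and maximal ideal of $L$; $K[G]$ acts on $L$ in the usual way. $L/K$ is weakly ramified if its second ramification group $G_2=\{\sigma\in G:(\sigma-1)\mathfrak{O}_L\subseteq\mathfrak{P}_L^{3}\}$ is trivial. The associated order $\mathfrak{A}$ is a local ring with maximal ideal $\mathfrak{M}$; its embedding dimension is $\dim_\kappa(\mathfrak{M}/\mathfrak{M}^2)$. For $s=\sum_{j=0}^{n-1}s_{(j)}p^j\in\{1,\dots,p^n-1\}$ with digits $s_{(j)}\in\{0,\dots,p-1\}$, and $v_p$ the $p$-adic valuation: $\alpha(s)=|\{j:1\le j\le n-1,\ j>v_p(s),\ s_{(j)}\ne p-1\}|$; $\beta(s)=\max\{c:0\le c<n-v_p(s),\ s_{(n-1)}=\dots=s_{(n-c)}=(p-1)/2\}$ (with $c=0$ always allowed); $\gamma(s)=1$ if $p=2$ and $s=2^{n-1}$, and $\gamma(s)=0$ otherwise. *)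

theory Defs
  imports "HOL-Computational_Algebra.Primes" "HOL-Number_Theory.Cong"
begin

text \<open>Setting: the top field L is the whole type 'a (a field), K is a subset of it,
  and v is the normalized discrete valuation of L (values on nonzero elements only).\<close>

definition is_subfield :: "'a::field set \<Rightarrow> bool" where
  "is_subfield K \<longleftrightarrow> 0 \<in> K \<and> 1 \<in> K \<and>
     (\<forall>x\<in>K. \<forall>y\<in>K. x + y \<in> K \<and> x - y \<in> K \<and> x * y \<in> K) \<and>
     (\<forall>x\<in>K. x \<noteq> 0 \<longrightarrow> inverse x \<in> K)"

text \<open>Normalized (surjective onto the integers) discrete valuation on the field 'a;
  the value at 0 (= infinity) is not used.\<close>
definition normalized_dval :: "('a::field \<Rightarrow> int) \<Rightarrow> bool" where
  "normalized_dval v \<longleftrightarrow>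
     (\<forall>x y. x \<noteq> 0 \<longrightarrow> y \<noteq> 0 \<longrightarrow> v (x * y) = v x + v y) \<and>
     (\<forall>x y. x \<noteq> 0 \<longrightarrow> y \<noteq> 0 \<longrightarrow> x + y \<noteq> 0 \<longrightarrow> v (x + y) \<ge> min (v x) (v y)) \<and>
     (\<forall>z. \<exists>x. x \<noteq> 0 \<and> v x = z)"

definition ideal_pow :: "('a::field \<Rightarrow> int) \<Rightarrow> int \<Rightarrow> 'a set" where
  "ideal_pow v h = {x. x = 0 \<or> v x \<ge> h}"

definition complete_wrt_dval :: "('a::field \<Rightarrow> int) \<Rightarrow> 'a set \<Rightarrow> bool" where
  "complete_wrt_dval v K \<longleftrightarrow>
     (\<forall>f::nat \<Rightarrow> 'a. (\<forall>i. f i \<in> K) \<longrightarrow>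
        (\<forall>N. \<exists>M. \<forall>i j. M \<le> i \<longrightarrow> M \<le> j \<longrightarrow> f i - f j \<in> ideal_pow v N) \<longrightarrow>
        (\<exists>l\<in>K. \<forall>N. \<exists>M. \<forall>i. M \<le> i \<longrightarrow> f i - l \<in> ideal_pow v N))"

text \<open>The residue field O_K/P_K of K is perfect (of characteristic p): Frobenius is onto.\<close>
definition perfect_residue_field :: "('a::field \<Rightarrow> int) \<Rightarrow> 'a set \<Rightarrow> nat \<Rightarrow> bool" where
  "perfect_residue_field v K p \<longleftrightarrow>
     (\<forall>x\<in>K \<inter> ideal_pow v 0. \<exists>y\<in>K \<inter> ideal_pow v 0. y ^ p - x \<in> ideal_pow v 1)"

definition ext_degree_is :: "'a::field set \<Rightarrow> nat \<Rightarrow> bool" where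
  "ext_degree_is K d \<longleftrightarrow>
     (\<exists>bs. length bs = d \<and>
        (\<forall>x. \<exists>!cs. length cs = d \<and> set cs \<subseteq> K \<and> x = (\<Sum>i<d. cs ! i * bs ! i)))"

definition field_aut :: "('a::field \<Rightarrow> 'a) \<Rightarrow> bool" where
  "field_aut \<sigma> \<longleftrightarrow> bij \<sigma> \<and> (\<forall>x y. \<sigma> (x + y) = \<sigma> x + \<sigma> y) \<and>
     (\<forall>x y. \<sigma> (x * y) = \<sigma> x * \<sigma> y) \<and> \<sigma> 1 = 1"

definition galois_group :: "'a::field set \<Rightarrow> ('a \<Rightarrow> 'a) set" where
  "galois_group K = {\<sigma>. field_aut \<sigma> \<and> (\<forall>x\<in>K. \<sigma> x = x)}"

definition galois_of_degree :: "'a::field set \<Rightarrow> nat \<Rightarrow> bool" where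
  "galois_of_degree K d \<longleftrightarrow> ext_degree_is K d \<and> finite (galois_group K) \<and>
     card (galois_group K) = d"

text \<open>Totally ramified of degree d: ramification index e = d, i.e. v(K^*) = d Z.\<close>
definition totally_ramified :: "('a::field \<Rightarrow> int) \<Rightarrow> 'a set \<Rightarrow> nat \<Rightarrow> bool" where
  "totally_ramified v K d \<longleftrightarrow> v ` (K - {0}) = {int d * z | z. True}"

definition ram_group2 :: "('a::field \<Rightarrow> int) \<Rightarrow> 'a set \<Rightarrow> ('a \<Rightarrow> 'a) set" where
  "ram_group2 v K = {\<sigma>\<in>galois_group K. \<forall>x\<in>ideal_pow v 0. \<sigma> x - x \<in> ideal_pow v 3}"

definition weakly_ramified :: "('a::field \<Rightarrow> int) \<Rightarrow> 'a set \<Rightarrow> bool" where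
  "weakly_ramified v K \<longleftrightarrow> ram_group2 v K = {id}"

definition group_alg :: "'a::field set \<Rightarrow> ('a \<Rightarrow> 'a) set \<Rightarrow> (('a \<Rightarrow> 'a) \<Rightarrow> 'a) set" where
  "group_alg K G = {\<alpha>. (\<forall>\<sigma>. \<sigma> \<notin> G \<longrightarrow> \<alpha> \<sigma> = 0) \<and> (\<forall>\<sigma>\<in>G. \<alpha> \<sigma> \<in> K)}"

definition ga_mult :: "('a \<Rightarrow> 'a) set \<Rightarrow> (('a \<Rightarrow> 'a) \<Rightarrow> 'a::field) \<Rightarrow> (('a \<Rightarrow> 'a) \<Rightarrow> 'a) \<Rightarrow> (('a \<Rightarrow> 'a) \<Rightarrow> 'a)" where
  "ga_mult G \<alpha> \<beta> = (\<lambda>\<tau>. \<Sum>\<sigma>\<in>G. \<Sum>\<rho>\<in>G. if \<sigma> \<circ> \<rho> = \<tau> then \<alpha> \<sigma> * \<beta> \<rho> else 0)"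

definition ga_one :: "('a \<Rightarrow> 'a) \<Rightarrow> 'a::field" where
  "ga_one = (\<lambda>\<sigma>. if \<sigma> = id then 1 else 0)"

definition ga_act :: "('a \<Rightarrow> 'a) set \<Rightarrow> (('a \<Rightarrow> 'a) \<Rightarrow> 'a::field) \<Rightarrow> 'a \<Rightarrow> 'a" where
  "ga_act G \<alpha> x = (\<Sum>\<sigma>\<in>G. \<alpha> \<sigma> * \<sigma> x)"

definition assoc_order :: "('a::field \<Rightarrow> int) \<Rightarrow> 'a set \<Rightarrow> int \<Rightarrow> (('a \<Rightarrow> 'a) \<Rightarrow> 'a) set" where
  "assoc_order v K h = {\<alpha>\<in>group_alg K (galois_group K).
      \<forall>x\<in>ideal_pow v h. ga_act (galois_group K) \<alpha> x \<in> ideal_pow v h}"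

definition is_free_over :: "('a \<Rightarrow> 'a) set \<Rightarrow> (('a \<Rightarrow> 'a) \<Rightarrow> 'a::field) set \<Rightarrow> 'a set \<Rightarrow> bool" where
  "is_free_over G A M \<longleftrightarrow>
     (\<exists>xs. set xs \<subseteq> M \<and>
        (\<forall>y\<in>M. \<exists>!as. length as = length xs \<and> set as \<subseteq> A \<and>
            y = (\<Sum>i<length xs. ga_act G (as ! i) (xs ! i))))"

definition generates_over :: "('a \<Rightarrow> 'a) set \<Rightarrow> (('a \<Rightarrow> 'a) \<Rightarrow> 'a::field) set \<Rightarrow> 'a set \<Rightarrow> 'a list \<Rightarrow> bool" where
  "generates_over G A M xs \<longleftrightarrow> set xs \<subseteq> M \<and>
     (\<forall>y\<in>M. \<exists>as. length as = length xs \<and> set as \<subseteq> A \<and>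
            y = (\<Sum>i<length xs. ga_act G (as ! i) (xs ! i)))"

definition min_num_gens :: "('a \<Rightarrow> 'a) set \<Rightarrow> (('a \<Rightarrow> 'a) \<Rightarrow> 'a::field) set \<Rightarrow> 'a set \<Rightarrow> nat" where
  "min_num_gens G A M = (LEAST r. \<exists>xs. length xs = r \<and> generates_over G A M xs)"

text \<open>Maximal ideal of the local ring A (= its set of non-units), and its square.\<close>
definition loc_max_ideal :: "('a \<Rightarrow> 'a) set \<Rightarrow> (('a \<Rightarrow> 'a) \<Rightarrow> 'a::field) set \<Rightarrow> (('a \<Rightarrow> 'a) \<Rightarrow> 'a) set" where
  "loc_max_ideal G A = {a\<in>A. \<not> (\<exists>b\<in>A. ga_mult G a b = ga_one)}"

definition ideal_square :: "('a \<Rightarrow> 'a) set \<Rightarrow> (('a \<Rightarrow> 'a) \<Rightarrow> 'a::field) set \<Rightarrow> (('a \<Rightarrow> 'a) \<Rightarrow> 'a) set" where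
  "ideal_square G I = {(\<lambda>\<tau>. \<Sum>i<length xs. ga_mult G (xs ! i) (ys ! i) \<tau>) | xs ys.
       length xs = length ys \<and> set xs \<subseteq> I \<and> set ys \<subseteq> I}"

text \<open>Embedding dimension dim_{A/M}(M/M^2): the largest size of a family in M that is
  linearly independent over A/M modulo M^2.\<close>
definition embedding_dim :: "('a \<Rightarrow> 'a) set \<Rightarrow> (('a \<Rightarrow> 'a) \<Rightarrow> 'a::field) set \<Rightarrow> nat" where
  "embedding_dim G A = (let M = loc_max_ideal G A in
     GREATEST r. \<exists>xs. length xs = r \<and> set xs \<subseteq> M \<and>
       (\<forall>as. length as = r \<longrightarrow> set as \<subseteq> A \<longrightarrow>
          (\<lambda>\<tau>. \<Sum>i<r. ga_mult G (as ! i) (xs ! i) \<tau>) \<in> ideal_square G M \<longrightarrow> set as \<subseteq> M))"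

definition pdigit :: "nat \<Rightarrow> nat \<Rightarrow> nat \<Rightarrow> nat" where
  "pdigit p s j = s div p ^ j mod p"

definition alpha_fn :: "nat \<Rightarrow> nat \<Rightarrow> nat \<Rightarrow> nat" where
  "alpha_fn p n s = card {j. 1 \<le> j \<and> j \<le> n - 1 \<and> j > multiplicity p s \<and> pdigit p s j \<noteq> p - 1}"

text \<open>beta: (p-1)/2 is compared as 2 * digit = p - 1 (never satisfied for p = 2).\<close>
definition beta_fn :: "nat \<Rightarrow> nat \<Rightarrow> nat \<Rightarrow> nat" where
  "beta_fn p n s = Max {c. c = 0 \<or> (c < n - multiplicity p s \<and>
       (\<forall>i<c. 2 * pdigit p s (n - 1 - i) = p - 1))}"

definition gamma_fn :: "nat \<Rightarrow> nat \<Rightarrow> nat \<Rightarrow> nat" where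
  "gamma_fn p n s = (if p = 2 \<and> s = 2 ^ (n - 1) then 1 else 0)"

end

theory Submission
  imports Defs "HOL-Computational_Algebra.Polynomial" "HOL-Library.FuncSet"
begin

text \<open>
  Everything rests on an element \<open>Y\<close> of valuation \<open>-1\<close> such that \<open>\<sigma> Y - Y\<close> lies in \<open>K\<close> for all
  \<open>\<sigma>\<close>. Write \<open>q = p ^ n\<close> and \<open>u \<sigma> = \<sigma> Y - Y\<close>. The powers \<open>Y ^ a\<close> with \<open>a < q\<close> have pairwise
  incongruent valuations modulo \<open>q\<close>, so valuations of \<open>K\<close>-combinations of them can be read off
  termwise. As \<open>\<sigma> Y ^ a = (Y + u \<sigma>) ^ a\<close> and the \<open>u \<sigma>\<close> are distinct, \<open>K[G]\<close> has a basis
  \<open>D k\<close> (\<open>k < q\<close>) acting as the divided derivatives \<open>D k (Y ^ a) = (a choose k) Y ^ (a - k)\<close>, with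
  \<open>D i D j = (i + j choose i) D (i + j)\<close>. The ideal, its associated order, the maximal ideal and
  its square are therefore all spanned by multiples of monomials, and generators and embedding
  dimension are counted by binomial coefficients modulo \<open>p\<close>.

  To find \<open>Y\<close>: weak ramification makes \<open>G\<close> elementary abelian, so additive Hilbert 90 gives
  \<open>x i\<close> with \<open>\<sigma> (x i) - x i\<close> the \<open>i\<close>-th coordinate of \<open>\<sigma>\<close>, and \<open>c i = x i ^ p - x i\<close> lies in \<open>K\<close>. After
  a change by an element of \<open>K\<close>, \<open>c i\<close> has a pole of order at most one. Perfectness of the residue
  field gives \<open>c i = g i ^ p ^ (n - 1) / t\<close> up to an integral error. If \<open>w\<close> is a primitive solution
  of \<open>\<Sum>i. w i * g i ^ p ^ j = 0\<close> for \<open>j < n - 1\<close>, then \<open>Y = \<Sum>i. w i * x i\<close> works.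
\<close>

section \<open>Binomial coefficients modulo a prime\<close>

text \<open>The constants of the theorem come from rounding. Valuations on \<open>K\<close> are
  multiples of \<open>q\<close>, so for \<open>h = 1 + m + q * z\<close> a term
  \<open>c * Y ^ a\<close> with \<open>c\<close> nonzero in \<open>K\<close> lies in the ideal
  exactly when \<open>v c\<close> is at least \<open>q * (z + 1)\<close>, or
  \<open>q * (z + 2)\<close> once \<open>a\<close> reaches \<open>q - m\<close>. There is a single
  jump. \<open>D j\<close> lowers exponents by \<open>j\<close>, and the smallest drop of level it
  meets is again a single jump, at \<open>max m (q - m)\<close>. Binomials prime to \<open>p\<close>
  have a smallest admissible index shift, which is a power of \<open>p\<close>; this leads to the
  first multiples of powers of \<open>p\<close> from a threshold on. \<open>alpha_fn\<close> counts
  these by digits, and \<open>beta_fn\<close> those that reach \<open>q - m\<close>. The obstacle in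
  finding \<open>Y\<close> is that each \<open>x i\<close> alone may have a pole of order
  \<open>p ^ (n - 1)\<close>. Taking the \<open>p ^ (n - 1)\<close>-th power of \<open>Y\<close>
  exposes \<open>n - 1\<close> families of larger poles, and there are \<open>n\<close> weights to
  cancel them.\<close>

lemma prime_power_dvd_lower_if_choose:
  fixes p :: nat
  assumes "prime p" "p ^ e dvd s" "\<not> p dvd (s choose j)" "0 < j"
  shows "p ^ e dvd j"
proof -
  have "p ^ e dvd j * (s choose j)"
    using assms(2,4) by (simp add: times_binomial_minus1_eq)
  moreover have "coprime (p ^ e) (s choose j)"
    using assms(1,3) by (simp add: prime_imp_coprime)
  ultimately show ?thesis
    by (simp add: coprime_dvd_mult_left_iff)
qed

text \<open>Absorption: \<open>k * ((b + k) choose k)\<close> equals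
  \<open>Suc b * ((b + k) choose (k - 1))\<close>, so a power of \<open>p\<close> dividing
  \<open>Suc b\<close> must divide \<open>k\<close> once the binomial is prime to
  \<open>p\<close>.\<close>

lemma prime_power_dvd_increment_if_choose:
  fixes p :: nat
  assumes "prime p" "p ^ e dvd Suc b" "\<not> p dvd ((b + k) choose k)" "0 < k"
  shows "p ^ e dvd k"
proof -
  obtain k' where k: "k = Suc k'" using assms(4) gr0_implies_Suc by blast
  have "k * ((b + k) choose k) = Suc b * ((b + k) choose k')"
  proof -
    have "(b + k choose k') * (b + k - k') = (b + k choose k) * k"
      using binomial_absorb_comp[of "b + k" k'] Suc_times_binomial_eq[of "b + k'" k']
      by (simp add: k mult.commute)
    thus ?thesis by (simp add: k mult.commute)
  qed
  hence "p ^ e dvd k * ((b + k) choose k)"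
    using assms(2) by (simp only: dvd_mult2)
  moreover have "coprime (p ^ e) ((b + k) choose k)"
    using assms(1,3) by (simp add: prime_imp_coprime)
  ultimately show ?thesis
    by (simp add: coprime_dvd_mult_left_iff)
qed

text \<open>Pascal's rule makes consecutive entries of row \<open>N\<close> opposite modulo
  \<open>p\<close>, because row \<open>Suc N\<close> vanishes modulo \<open>p\<close> strictly
  between \<open>0\<close> and \<open>p ^ e\<close>; the first entry is \<open>1\<close>.\<close>

lemma not_dvd_choose_pred_prime_power:
  fixes p :: nat
  assumes "prime p" "p ^ e dvd Suc N" "j < p ^ e"
  shows "\<not> p dvd (N choose j)"
  using assms(3)
proof (induction j)
  case 0
  show ?case using assms(1) by auto
next
  case (Suc j)
  have "p dvd (Suc N choose Suc j)"
    using prime_power_dvd_lower_if_choose[OF assms(1,2), of "Suc j"] Suc.prems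
    by (meson dvd_imp_le not_less zero_less_Suc)
  hence "p dvd (N choose j) + (N choose Suc j)" by simp
  thus ?case using Suc by (metis Suc_lessD dvd_add_left_iff)
qed

text \<open>The least admissible increment is attained. Every \<open>k > 0\<close> with
  \<open>(b + k) choose k\<close> prime to \<open>p\<close> is a multiple of
  \<open>P = p ^ multiplicity p (Suc b)\<close>; cancelling \<open>P\<close> from two absorption
  identities shows that \<open>P\<close> itself qualifies.\<close>

lemma not_dvd_choose_increment:
  fixes p :: nat
  assumes "prime p"
  shows "\<not> p dvd ((b + p ^ multiplicity p (Suc b)) choose b)"
proof -
  define P where "P = p ^ multiplicity p (Suc b)"
  have P0: "P > 0" using assms by (simp add: P_def prime_gt_0_nat)
  obtain d where d: "Suc b = P * d" "\<not> p dvd d"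
    using multiplicity_decompose'[of "Suc b" p] assms P_def not_prime_unit by blast
  obtain k where k: "P = Suc k" using P0 gr0_implies_Suc by blast
  have "P * (b + P choose P) = (b + P) * (b + k choose k)"
    using Suc_times_binomial_eq[of "b + k" k] by (simp add: k mult.commute)
  also have "\<dots> = (b + P - k) * (b + P choose k)"
    using binomial_absorb_comp[of "b + P" k] by (simp add: k)
  also have "b + P - k = P * d" using d(1) k by simp
  finally have "P * (b + P choose P) = P * (d * (b + P choose k))" by (simp only: mult.assoc)
  hence eq: "(b + P choose P) = d * (b + P choose k)" using P0 by (metis mult_left_cancel less_irrefl)
  have "P dvd Suc (b + P)" using d(1) by (metis add_Suc dvd_add_triv_right_iff dvd_triv_left)
  hence "\<not> p dvd (b + P choose k)"
    using not_dvd_choose_pred_prime_power[OF assms, of "multiplicity p (Suc b)"] k P_def by simp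
  hence "\<not> p dvd (b + P choose P)"
    using d(2) assms eq by (simp add: prime_dvd_mult_iff)
  thus ?thesis unfolding P_def[symmetric]
    using binomial_symmetric[of P "b + P"] by simp
qed

text \<open>Companion for lower indices: with \<open>s = P * d\<close>, cancelling \<open>P\<close>
  leaves \<open>d\<close> times \<open>(s - 1) choose (P - 1)\<close>, and both factors are prime to
  \<open>p\<close>.\<close>

lemma not_dvd_choose_multiplicity:
  fixes p :: nat
  assumes "prime p" "s > 0"
  shows "\<not> p dvd (s choose (p ^ multiplicity p s))"
proof -
  define P where "P = p ^ multiplicity p s"
  have P0: "P > 0" using assms by (simp add: P_def prime_gt_0_nat)
  obtain d where d: "s = P * d" "\<not> p dvd d"
    using multiplicity_decompose'[of s p] assms P_def not_prime_unit by (metis less_numeral_extra(3))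
  have "P * (s choose P) = P * (d * (s - 1 choose (P - 1)))"
    using times_binomial_minus1_eq[OF P0, of s] d(1) by (simp add: mult_ac)
  hence eq: "(s choose P) = d * (s - 1 choose (P - 1))" using P0 by simp
  have "P dvd Suc (s - 1)" using d(1) assms(2) by simp
  hence "\<not> p dvd (s - 1 choose (P - 1))"
    using not_dvd_choose_pred_prime_power[OF assms(1), of "multiplicity p s" "s - 1" "P - 1"] P0 P_def by simp
  thus ?thesis unfolding P_def[symmetric]
    using d(2) assms eq by (simp add: prime_dvd_mult_iff)
qed

section \<open>Thresholds and first multiples of prime powers\<close>

definition step_fn :: "nat \<Rightarrow> nat \<Rightarrow> int" where
  "step_fn t a = of_bool (t \<le> a)"

text \<open>The associated order has a basis \<open>e j\<close> (\<open>j < q\<close>), which is \<open>D j\<close> divided by the \<open>step_fn k j\<close>-th power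
  of a uniformizer of \<open>K\<close>. The indecomposables are the \<open>s > 0\<close> for which \<open>e s\<close> is not a unit times a
  product \<open>e i * e (s - i)\<close>. Similarly the ideal has a basis \<open>f a\<close>, a multiple of \<open>Y ^ a\<close>, and the
  unreachables are the \<open>b\<close> for which \<open>f b\<close> is not a unit times some \<open>e (a - b) * f a\<close> with \<open>a > b\<close>.\<close>
definition indecomposables :: "nat \<Rightarrow> nat \<Rightarrow> nat \<Rightarrow> nat set" where
  "indecomposables p q k = {s. 0 < s \<and> s < q \<and>
     (\<forall>i. 0 < i \<and> i < s \<and> \<not> p dvd (s choose i) \<longrightarrow> step_fn k i + step_fn k (s - i) \<noteq> step_fn k s)}"

definition unreachables :: "nat \<Rightarrow> nat \<Rightarrow> nat \<Rightarrow> nat \<Rightarrow> nat set" where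
  "unreachables p q t k = {b. b < q \<and>
     (\<forall>a. b < a \<and> a < q \<and> \<not> p dvd (a choose b) \<longrightarrow> step_fn t a - step_fn t b \<noteq> step_fn k (a - b))}"

text \<open>Such an \<open>s\<close> is the least multiple of its own exact power
  \<open>p ^ multiplicity p s\<close> that is at least \<open>k\<close>.\<close>

definition first_multiples :: "nat \<Rightarrow> nat \<Rightarrow> nat \<Rightarrow> nat set" where
  "first_multiples p q k = {s. k \<le> s \<and> s < q \<and> s < k + p ^ multiplicity p s}"

text \<open>If \<open>p ^ j\<close> divided \<open>k\<close> as well as \<open>s\<close>, it would
  divide \<open>s - k\<close>, which is positive and smaller than \<open>p ^ j\<close>. Thus
  \<open>k\<close> lies strictly inside the block of length \<open>p ^ j\<close> that ends at
  \<open>s\<close>.\<close>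

lemma first_multiples_decompose:
  assumes "prime p" "0 < k" "s \<in> first_multiples p q k" "s \<noteq> k"
  obtains d where "s = p ^ multiplicity p s * d" "\<not> p dvd d" "k div p ^ multiplicity p s = d - 1" "d > 0"
    "multiplicity p k < multiplicity p s"
proof -
  define j where "j = multiplicity p s"
  have s: "k < s" "s < k + p ^ j" using assms(3,4) by (auto simp: first_multiples_def j_def)
  obtain d where d: "s = p ^ j * d" "\<not> p dvd d"
    using multiplicity_decompose'[of s p] assms(1) s(1) j_def not_prime_unit by (metis not_less_zero)
  have d0: "d > 0" using d(2) by (cases d) auto
  have "k div p ^ j = d - 1"
  proof (rule div_nat_eqI)
    show "p ^ j * (d - 1) \<le> k" using s d d0 by (simp add: algebra_simps)
    show "k < p ^ j * Suc (d - 1)" using s d d0 by simp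
  qed
  moreover have "multiplicity p k < j"
  proof (rule ccontr)
    assume "\<not> ?thesis"
    hence "p ^ j dvd k" by (simp add: multiplicity_dvd')
    moreover have "p ^ j dvd s" using d by simp
    ultimately have "p ^ j dvd s - k" by (rule dvd_diff_nat[rotated])
    moreover have "0 < s - k" "s - k < p ^ j" using s by auto
    ultimately show False using dvd_imp_le by fastforce
  qed
  ultimately show ?thesis using that d d0 unfolding j_def by blast
qed

text \<open>Rounding \<open>k\<close> up to a multiple of \<open>p ^ j\<close> gives multiplicity
  exactly \<open>j\<close> when \<open>k div p ^ j + 1\<close> is prime to \<open>p\<close>, that
  is, when digit \<open>j\<close> of \<open>k\<close> is not \<open>p - 1\<close>. This is the
  source of the digit condition in \<open>alpha_fn\<close>.\<close>

lemma first_multiple_of_power: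
  assumes "prime p" "0 < k" "k < p ^ n" "j \<le> n - 1" "multiplicity p k < j" "pdigit p k j \<noteq> p - 1"
  shows "(k div p ^ j + 1) * p ^ j \<in> first_multiples p (p ^ n) k"
    and "multiplicity p ((k div p ^ j + 1) * p ^ j) = j"
proof -
  have p1: "p > 1" using assms(1) prime_gt_1_nat by blast
  have nd: "\<not> p dvd k div p ^ j + 1"
  proof
    assume "p dvd k div p ^ j + 1"
    hence "(k div p ^ j + 1) mod p = 0" by simp
    hence "(k div p ^ j) mod p = p - 1"
      using p1 by (metis Suc_eq_plus1 mod_Suc diff_Suc_1 nat.distinct(1))
    thus False using assms(6) by (simp add: pdigit_def)
  qed
  show m: "multiplicity p ((k div p ^ j + 1) * p ^ j) = j"
    using nd p1 assms(1)
    by (intro multiplicity_eqI) (simp_all add: mult.commute[of _ "p ^ j"] del: mult_Suc mult_Suc_right)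
  have r: "\<not> p ^ j dvd k"
    using assms(1,2,5) p1 power_dvd_iff_le_multiplicity[of k p j]
    by (simp add: )
  have 1: "k < (k div p ^ j + 1) * p ^ j"
    using p1 dividend_less_div_times[of "p ^ j" k] by (simp add: add.commute)
  have 2: "(k div p ^ j + 1) * p ^ j < k + p ^ j"
  proof -
    have "k mod p ^ j > 0" using r by (simp add: mod_greater_zero_iff_not_dvd)
    moreover have "(k div p ^ j) * p ^ j + k mod p ^ j = k" by (rule div_mult_mod_eq)
    ultimately show ?thesis unfolding add_mult_distrib by linarith
  qed
  have nj: "n - j > 0" using assms(4,5) by linarith
  hence pn: "p ^ n = p ^ (n - j) * p ^ j" by (simp flip: power_add)
  have "k div p ^ j < p ^ (n - j)"
    using assms(3) pn p1 by (simp add: less_mult_imp_div_less)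
  \<comment> \<open>Rounding up cannot reach \<open>p ^ n\<close>, since that would make the
    cofactor divisible by \<open>p\<close>.\<close>
  moreover have "k div p ^ j + 1 \<noteq> p ^ (n - j)"
    using nd nj by (metis dvd_power)
  ultimately have "k div p ^ j + 1 < p ^ (n - j)" by simp
  hence 3: "(k div p ^ j + 1) * p ^ j < p ^ n" using p1 unfolding pn by (intro mult_strict_right_mono) auto
  show "(k div p ^ j + 1) * p ^ j \<in> first_multiples p (p ^ n) k"
    unfolding first_multiples_def m mem_Collect_eq using 1 2 3 m by auto
qed

lemma inj_on_multiplicity_first_multiples:
  assumes "prime p" "0 < k"
  shows "inj_on (multiplicity p) (first_multiples p q k)"
proof -
  have "s' \<le> s" if "s \<in> first_multiples p q k" "s' \<in> first_multiples p q k"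
    "multiplicity p s = multiplicity p s'" for s s'
  proof (rule ccontr)
    assume "\<not> s' \<le> s"
    have "p ^ multiplicity p s dvd s' - s"
      using that(3) by (metis dvd_diff_nat multiplicity_dvd)
    moreover have "s' - s < p ^ multiplicity p s" "0 < s' - s"
      using that \<open>\<not> s' \<le> s\<close> by (auto simp: first_multiples_def)
    ultimately show False using dvd_imp_le by fastforce
  qed
  thus ?thesis by (intro inj_onI) (metis order_antisym)
qed

lemma multiplicity_image_first_multiples:
  assumes "prime p" "0 < k" "k < p ^ n"
  shows "multiplicity p ` first_multiples p (p ^ n) k =
    insert (multiplicity p k) {j. 1 \<le> j \<and> j \<le> n - 1 \<and> j > multiplicity p k \<and> pdigit p k j \<noteq> p - 1}"
    (is "?L = insert _ ?A")
proof
  have p1: "p > 1" using assms(1) prime_gt_1_nat by blast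
  show "?L \<subseteq> insert (multiplicity p k) ?A"
  proof
    fix j assume "j \<in> ?L"
    then obtain s where s: "s \<in> first_multiples p (p ^ n) k" "j = multiplicity p s" by blast
    show "j \<in> insert (multiplicity p k) ?A"
    proof (cases "s = k")
      case False
      obtain d where d: "s = p ^ j * d" "\<not> p dvd d" "k div p ^ j = d - 1" "d > 0" "multiplicity p k < j"
        using first_multiples_decompose[OF assms(1,2) s(1) False] s(2) by metis
      have "p ^ j \<le> s" using d by simp
      also have "s < p ^ n" using s(1) by (simp add: first_multiples_def)
      finally have "j < n" using p1 by simp
      moreover have "(d - 1) mod p \<noteq> p - 1"
        using d(2,4) p1 by (metis Suc_diff_1 dvd_eq_mod_eq_0 mod_Suc not_less_zero prime_gt_0_nat assms(1))
      ultimately show ?thesis using d by (simp add: pdigit_def)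
    qed (use s in simp)
  qed
  show "insert (multiplicity p k) ?A \<subseteq> ?L"
  proof
    fix j assume j: "j \<in> insert (multiplicity p k) ?A"
    show "j \<in> ?L"
    proof (cases "j = multiplicity p k")
      case True
      thus ?thesis using assms p1 by (auto simp: first_multiples_def)
    next
      case False
      thus ?thesis using first_multiple_of_power[OF assms, of j] j by (metis (mono_tags, lifting) image_eqI insertE mem_Collect_eq)
    qed
  qed
qed

text \<open>The summand \<open>1\<close> is \<open>k\<close> itself, whose multiplicity is excluded
  from the set counted by \<open>alpha_fn\<close>.\<close>

lemma card_first_multiples:
  assumes "prime p" "0 < k" "k < p ^ n"
  shows "card (first_multiples p (p ^ n) k) = 1 + alpha_fn p n k"
proof -
  let ?A = "{j. 1 \<le> j \<and> j \<le> n - 1 \<and> j > multiplicity p k \<and> pdigit p k j \<noteq> p - 1}"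
  have fin: "finite ?A" by (rule finite_subset[of _ "{..n}"]) auto
  have "card (first_multiples p (p ^ n) k) = card (multiplicity p ` first_multiples p (p ^ n) k)"
    using inj_on_multiplicity_first_multiples[OF assms(1,2)] by (simp add: card_image)
  also have "\<dots> = card (insert (multiplicity p k) ?A)"
    by (simp add: multiplicity_image_first_multiples[OF assms])
  also have "\<dots> = 1 + alpha_fn p n k"
    using fin by (subst card_insert_disjoint) (auto simp: alpha_fn_def)
  finally show ?thesis .
qed

section \<open>The count of indecomposables\<close>

lemma indecomposables_eq:
  assumes "prime p" "0 < k" "p ^ n \<le> 2 * k" "k \<le> p ^ n"
  shows "indecomposables p (p ^ n) k = (\<lambda>i. p ^ i) ` {i. i < n \<and> p ^ i < k} \<union> first_multiples p (p ^ n) k"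
    (is "?L = ?P \<union> ?F")
proof -
  have p1: "p > 1" using assms(1) prime_gt_1_nat by blast
  have "s \<in> ?L \<longleftrightarrow> s \<in> ?P \<union> ?F" for s
  proof (cases "0 < s \<and> s < p ^ n")
    case False
    have "s \<notin> ?P" using False p1 assms(4) by (auto simp: power_strict_increasing)
    moreover have "s \<notin> ?F" using False assms(2) by (auto simp: first_multiples_def)
    ultimately show ?thesis using False by (auto simp: indecomposables_def)
  next
    case True
    define P where "P = p ^ multiplicity p s"
    have P: "0 < P" "P dvd s" "P \<le> s" using True p1 by (auto simp: P_def multiplicity_dvd dvd_imp_le)
    have ndP: "\<not> p dvd (s choose P)" using not_dvd_choose_multiplicity[OF assms(1)] True P_def by simp
    have geP: "P \<le> i \<and> i \<le> s - P" if "0 < i" "i < s" "\<not> p dvd (s choose i)" for i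
    proof -
      have "P dvd i" using prime_power_dvd_lower_if_choose[OF assms(1) _ that(3,1)] P P_def by simp
      hence "P \<le> i" using that by (simp add: dvd_imp_le)
      moreover have "P dvd s - i" using \<open>P dvd i\<close> P by simp
      hence "P \<le> s - i" using that by (simp add: dvd_imp_le)
      ultimately show ?thesis using that by simp
    qed
    show ?thesis
    proof (cases "s < k")
      case sk: True
      \<comment> \<open>Below \<open>k\<close> all steps vanish, so only a condition on binomials
        remains, and it singles out the powers of \<open>p\<close>.\<close>
      have "s \<in> ?L \<longleftrightarrow> (\<forall>i. 0 < i \<and> i < s \<longrightarrow> p dvd (s choose i))"
        using True sk by (auto simp: indecomposables_def step_fn_def)
      also have "\<dots> \<longleftrightarrow> P = s"
        using ndP geP P by (metis diff_self_eq_0 leD nat_less_le)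
      also have "\<dots> \<longleftrightarrow> s \<in> ?P"
      proof
        assume "P = s"
        hence "multiplicity p s < n" using True p1 unfolding P_def by (metis power_less_imp_less_exp)
        thus "s \<in> ?P" using \<open>P = s\<close> sk unfolding P_def by (intro image_eqI[of _ _ "multiplicity p s"]) auto
      next
        assume "s \<in> ?P"
        then obtain i where "s = p ^ i" by blast
        thus "P = s" using assms(1) by (simp add: P_def not_prime_unit)
      qed
      also have "\<dots> \<longleftrightarrow> s \<in> ?P \<union> ?F" using sk by (auto simp: first_multiples_def)
      finally show ?thesis .
    next
      case sk: False
      have notP: "s \<notin> ?P" using sk by auto
      have F: "s \<in> ?F \<longleftrightarrow> s - P < k"
        using sk True P assms(2) by (auto simp: first_multiples_def P_def)
      \<comment> \<open>From \<open>k\<close> on, \<open>s\<close> decomposes as soon as one part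
        still reaches \<open>k\<close>; both parts cannot, because
        \<open>s < p ^ n \<le> 2 * k\<close>.\<close>
      have "s \<in> ?L \<longleftrightarrow> (\<forall>i. 0 < i \<and> i < s \<and> \<not> p dvd (s choose i) \<longrightarrow> i < k \<and> s - i < k)"
        using True sk assms(3) by (auto simp: indecomposables_def step_fn_def)
      \<comment> \<open>The most unbalanced splitting with a binomial prime to \<open>p\<close> is
        \<open>P + (s - P)\<close>, so it alone decides. For \<open>P = s\<close> there is no
        splitting and the inequality holds trivially.\<close>
      also have "\<dots> \<longleftrightarrow> s - P < k"
      proof
        assume *: "\<forall>i. 0 < i \<and> i < s \<and> \<not> p dvd (s choose i) \<longrightarrow> i < k \<and> s - i < k"
        show "s - P < k"
        proof (cases "P = s")
          case False
          thus ?thesis using *[rule_format, of P] P ndP by simp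
        qed (use assms in simp)
      next
        assume "s - P < k"
        thus "\<forall>i. 0 < i \<and> i < s \<and> \<not> p dvd (s choose i) \<longrightarrow> i < k \<and> s - i < k"
          using geP by (metis diff_le_mono2 le_less_trans)
      qed
      finally show ?thesis using F notP by blast
    qed
  qed
  thus ?thesis by blast
qed

lemma finite_indecomposables: "finite (indecomposables p q k)"
  by (rule finite_subset[of _ "{..<q}"]) (auto simp: indecomposables_def)

lemma finite_unreachables: "finite (unreachables p q t k)"
  by (rule finite_subset[of _ "{..<q}"]) (auto simp: unreachables_def)

lemma card_indecomposables_top:
  assumes "prime p"
  shows "card (indecomposables p (p ^ n) (p ^ n)) = n"
proof -
  have p1: "p > 1" using assms(1) prime_gt_1_nat by blast
  have "indecomposables p (p ^ n) (p ^ n) = (\<lambda>i. p ^ i) ` {..<n}"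
    using p1 by (subst indecomposables_eq[OF assms]) (auto simp: first_multiples_def power_strict_increasing)
  thus ?thesis using p1 by (simp add: card_image inj_on_def)
qed

text \<open>As \<open>p ^ n \<le> 2 * k\<close>, the power \<open>p ^ (n - 1)\<close> lies below
  \<open>k\<close> except for \<open>p = 2\<close> and \<open>k = 2 ^ (n - 1)\<close>, where it
  equals \<open>k\<close> and is already counted as a first multiple; \<open>gamma_fn\<close>
  corrects for this.\<close>

lemma card_indecomposables:
  assumes "prime p" "0 < k" "p ^ n \<le> 2 * k" "k < p ^ n"
  shows "card (indecomposables p (p ^ n) k) + gamma_fn p n k = n + 1 + alpha_fn p n k"
proof -
  have p1: "p > 1" using assms(1) prime_gt_1_nat by blast
  have n0: "n > 0" using assms(2,4) by (cases n) auto
  let ?I = "{i. i < n \<and> p ^ i < k}"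
  have fin: "finite ?I" "finite (first_multiples p (p ^ n) k)"
    by (auto intro: finite_subset[of _ "{..<p ^ n}"] simp: first_multiples_def)
  have pn: "p ^ n = p * p ^ (n - 1)" using n0 by (metis Suc_diff_1 power_Suc)
  have "card ?I + gamma_fn p n k = n"
  proof (cases "p = 2 \<and> k = 2 ^ (n - 1)")
    case True
    hence "?I = {..<n - 1}" by auto
    thus ?thesis using True n0 by (simp add: gamma_fn_def)
  next
    case False
    have "p ^ (n - 1) < k"
    proof (cases "p = 2")
      case True
      thus ?thesis using False assms(3) pn by simp
    next
      case False
      hence "3 * p ^ (n - 1) \<le> p * p ^ (n - 1)" using p1 by simp
      moreover have "p ^ (n - 1) > 0" using p1 by simp
      ultimately show ?thesis using assms(3) pn by linarith
    qed
    moreover have "p ^ i \<le> p ^ (n - 1)" if "i < n" for i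
      using that p1 by (intro power_increasing) auto
    ultimately have "?I = {..<n}" by (auto intro: le_less_trans)
    thus ?thesis using False by (auto simp: gamma_fn_def)
  qed
  moreover have "card (indecomposables p (p ^ n) k) = card ?I + card (first_multiples p (p ^ n) k)"
  proof -
    have "card ((\<lambda>i. p ^ i) ` ?I \<union> first_multiples p (p ^ n) k)
        = card ((\<lambda>i. p ^ i) ` ?I) + card (first_multiples p (p ^ n) k)"
      using fin by (intro card_Un_disjoint) (auto simp: first_multiples_def)
    moreover have "card ((\<lambda>i. p ^ i) ` ?I) = card ?I"
      using p1 by (intro card_image) (auto simp: inj_on_def)
    ultimately show ?thesis using indecomposables_eq[OF assms(1-3)] assms(4) by simp
  qed
  ultimately show ?thesis using card_first_multiples[OF assms(1,2,4)] by simp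
qed

section \<open>Middle digits and the count of unreachables\<close>

lemma half_digits_iff:
  assumes "m < p ^ n" "0 < p" "c \<le> n"
  shows "2 * (m div p ^ (n - c)) + 1 = p ^ c \<longleftrightarrow> (\<forall>i<c. 2 * pdigit p m (n - 1 - i) = p - 1)"
  using assms(3)
proof (induction c)
  case 0
  thus ?case using assms by simp
next
  case (Suc c)
  define A where "A = m div p ^ (n - c)"
  define d where "d = pdigit p m (n - Suc c)"
  have dp: "d < p" using assms by (simp add: d_def pdigit_def)
  have "n - c = Suc (n - Suc c)" using Suc.prems by simp
  hence "A = m div p ^ (n - Suc c) div p" by (simp only: A_def power_Suc2 div_mult2_eq)
  hence e: "m div p ^ (n - Suc c) = p * A + d" by (simp add: d_def pdigit_def)
  have IH: "2 * A + 1 = p ^ c \<longleftrightarrow> (\<forall>i<c. 2 * pdigit p m (n - 1 - i) = p - 1)"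
    using Suc A_def by simp
  \<comment> \<open>The number formed by the top \<open>c\<close> digits is
    \<open>(p ^ c - 1) / 2\<close> precisely when each of them is \<open>(p - 1) / 2\<close>.
    Appending a digit \<open>d\<close> forces \<open>p * (p ^ c - 2 * A) = 2 * d + 1\<close>, which
    lies strictly between \<open>0\<close> and \<open>2 * p\<close>.\<close>
  have "2 * (p * A + d) + 1 = p ^ Suc c \<longleftrightarrow> 2 * A + 1 = p ^ c \<and> 2 * d = p - 1"
  proof
    assume *: "2 * (p * A + d) + 1 = p ^ Suc c"
    hence "int (2 * (p * A + d) + 1) = int (p ^ Suc c)" by (rule arg_cong)
    hence "int p * (int (p ^ c) - 2 * int A) = 2 * int d + 1"
      by (simp add: algebra_simps)
    moreover have "2 * int d + 1 < int p * 2" "2 * int d + 1 > 0" using dp by auto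
    ultimately have "int p * (int (p ^ c) - 2 * int A) < int p * 2" "0 < int p * (int (p ^ c) - 2 * int A)" by auto
    hence "int (p ^ c) - 2 * int A < 2" "0 < int (p ^ c) - 2 * int A"
      using assms(2) by (simp_all add: zero_less_mult_iff)
    hence "int (p ^ c) - 2 * int A = 1" by simp
    moreover from this have "2 * int d + 1 = int p" using \<open>int p * (int (p ^ c) - 2 * int A) = 2 * int d + 1\<close> by simp
    ultimately show "2 * A + 1 = p ^ c \<and> 2 * d = p - 1" by linarith
  next
    assume *: "2 * A + 1 = p ^ c \<and> 2 * d = p - 1"
    hence "p ^ Suc c = p * (2 * A + 1)" "p = 2 * d + 1" using assms(2) by auto
    thus "2 * (p * A + d) + 1 = p ^ Suc c" by (simp add: algebra_simps)
  qed
  thus ?case unfolding e IH using d_def by (auto simp: less_Suc_eq)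
qed

text \<open>The multiple of \<open>p ^ j\<close> just above \<open>m\<close> reaches
  \<open>p ^ n - m\<close> only if \<open>m div p ^ j\<close> is as large as
  \<open>2 * m < p ^ n\<close> permits, that is \<open>2 * (m div p ^ j) + 1 = p ^ (n - j)\<close>.
  Then the top \<open>c = n - j\<close> digits are all \<open>(p - 1) / 2\<close>, and counting by
  \<open>c\<close> gives \<open>beta_fn\<close>.\<close>

lemma card_first_multiples_beyond:
  assumes "prime p" "0 < m" "2 * m < p ^ n"
  shows "card {s \<in> first_multiples p (p ^ n) m. p ^ n - m \<le> s} = beta_fn p n m"
proof -
  have p1: "p > 1" using assms(1) prime_gt_1_nat by blast
  have mn: "m < p ^ n" using assms by simp
  let ?v = "multiplicity p m"
  let ?S = "{s \<in> first_multiples p (p ^ n) m. p ^ n - m \<le> s}"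
  let ?C = "{c. 1 \<le> c \<and> c < n - ?v \<and> (\<forall>i<c. 2 * pdigit p m (n - 1 - i) = p - 1)}"
  have half: "p ^ n \<le> m + (m div p ^ j + 1) * p ^ j \<longleftrightarrow> 2 * (m div p ^ j) + 1 = p ^ (n - j)"
    if j: "j < n" "\<not> p ^ j dvd m" for j
  proof -
    define A r where "A = m div p ^ j" and "r = m mod p ^ j"
    have m: "m = A * p ^ j + r" unfolding A_def r_def by (rule div_mult_mod_eq[symmetric])
    have r: "0 < r" "r < p ^ j" using j p1 by (auto simp: r_def dvd_eq_mod_eq_0)
    have pn: "p ^ n = p ^ (n - j) * p ^ j" using j by (simp flip: power_add)
    have "2 * m < p ^ (n - j) * p ^ j" using assms(3) unfolding pn .
    hence "2 * A * p ^ j < p ^ (n - j) * p ^ j" using m by linarith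
    hence lt: "2 * A < p ^ (n - j)" using mult_less_cancel2 by blast
    show ?thesis unfolding A_def[symmetric]
    proof
      assume "p ^ n \<le> m + (A + 1) * p ^ j"
      hence "p ^ (n - j) * p ^ j < (2 * A + 2) * p ^ j" unfolding pn m using r by (simp add: algebra_simps)
      hence "p ^ (n - j) < 2 * A + 2" using mult_less_cancel2 by blast
      thus "2 * A + 1 = p ^ (n - j)" using lt by linarith
    next
      assume "2 * A + 1 = p ^ (n - j)"
      thus "p ^ n \<le> m + (A + 1) * p ^ j" unfolding pn by (subst m) (simp add: algebra_simps flip: \<open>2 * A + 1 = p ^ (n - j)\<close>)
    qed
  qed
  have img: "(\<lambda>s. n - multiplicity p s) ` ?S = ?C"
  proof (intro equalityI subsetI)
    fix c assume "c \<in> (\<lambda>s. n - multiplicity p s) ` ?S"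
    then obtain s where s: "s \<in> first_multiples p (p ^ n) m" "p ^ n - m \<le> s" "c = n - multiplicity p s" by blast
    define j where "j = multiplicity p s"
    have sm: "s \<noteq> m" using s(2) assms by simp
    obtain d where d: "s = p ^ j * d" "\<not> p dvd d" "m div p ^ j = d - 1" "d > 0" "?v < j"
      using first_multiples_decompose[OF assms(1,2) s(1) sm] j_def by metis
    have "p ^ j \<le> s" using d by simp
    also have "s < p ^ n" using s(1) by (simp add: first_multiples_def)
    finally have jn: "j < n" using p1 by simp
    have nd: "\<not> p ^ j dvd m" using d(5) assms(2) p1 by (simp add: power_dvd_iff_le_multiplicity)
    have "p ^ n \<le> m + (m div p ^ j + 1) * p ^ j" using s(2) d by (simp add: mult.commute)
    hence "2 * (m div p ^ j) + 1 = p ^ (n - j)" using half[OF jn nd] by simp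
    moreover have "n - (n - j) = j" using jn by simp
    ultimately have "\<forall>i<c. 2 * pdigit p m (n - 1 - i) = p - 1"
      using half_digits_iff[OF mn, of c] p1 s(3) j_def by auto
    thus "c \<in> ?C" using jn d(5) s(3) j_def by auto
  next
    fix c assume c: "c \<in> ?C"
    define j where "j = n - c"
    have j: "j < n" "?v < j" "n - j = c" using c by (auto simp: j_def)
    have nd: "\<not> p ^ j dvd m" using j(2) assms(2) p1 by (simp add: power_dvd_iff_le_multiplicity)
    have e: "2 * (m div p ^ j) + 1 = p ^ (n - j)"
      using half_digits_iff[OF mn, of c] c p1 j j_def by auto
    hence ge: "p ^ n \<le> m + (m div p ^ j + 1) * p ^ j" using half[OF j(1) nd] by simp
    \<comment> \<open>The digit is \<open>(p - 1) / 2\<close>, which differs from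
      \<open>p - 1\<close> as \<open>p > 1\<close>; the rounded-up multiple therefore has
      multiplicity exactly \<open>j\<close>.\<close>
    have "pdigit p m j \<noteq> p - 1"
    proof -
      have "2 * pdigit p m (n - 1 - (c - 1)) = p - 1"
        using c by (metis (mono_tags, lifting) diff_less less_le_trans mem_Collect_eq zero_less_one)
      moreover have "n - 1 - (c - 1) = j" using c j_def by auto
      ultimately show ?thesis using p1 by simp
    qed
    hence "(m div p ^ j + 1) * p ^ j \<in> first_multiples p (p ^ n) m"
      "multiplicity p ((m div p ^ j + 1) * p ^ j) = j"
      using first_multiple_of_power[OF assms(1,2) mn, of j] j by auto
    thus "c \<in> (\<lambda>s. n - multiplicity p s) ` ?S" using ge j by (intro image_eqI[of _ _ "(m div p ^ j + 1) * p ^ j"]) auto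
  qed
  have "inj_on (\<lambda>s. n - multiplicity p s) ?S"
  proof (rule inj_onI)
    fix s s' assume a: "s \<in> ?S" "s' \<in> ?S" "n - multiplicity p s = n - multiplicity p s'"
    have "multiplicity p s < n" if "s \<in> ?S" for s
    proof -
      have "p ^ multiplicity p s \<le> s" using that assms(2) by (intro dvd_imp_le) (auto simp: multiplicity_dvd first_multiples_def)
      also have "s < p ^ n" using that by (auto simp: first_multiples_def)
      finally show ?thesis using p1 by simp
    qed
    hence "multiplicity p s = multiplicity p s'" using a by (metis diff_diff_cancel less_imp_le)
    thus "s = s'" using inj_on_multiplicity_first_multiples[OF assms(1,2)] a(1,2) by (auto simp: inj_on_def)
  qed
  hence "card ?S = card ?C" unfolding img[symmetric] by (simp add: card_image)
  also have "\<dots> = beta_fn p n m"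
  proof -
    define B where "B = {c. c = 0 \<or> (c < n - ?v \<and> (\<forall>i<c. 2 * pdigit p m (n - 1 - i) = p - 1))}"
    have finB: "finite B" by (rule finite_subset[of _ "{..n}"]) (auto simp: B_def)
    define M where "M = Max B"
    have "M \<in> B" unfolding M_def using finB by (intro Max_in) (auto simp: B_def)
    \<comment> \<open>The condition on \<open>c\<close> is inherited by smaller values, so the
      admissible \<open>c > 0\<close> form an initial segment and their number equals their
      maximum.\<close>
    hence "{1..M} \<subseteq> ?C" by (auto simp: B_def)
    moreover have "?C \<subseteq> {1..M}"
    proof
      fix c assume c: "c \<in> ?C"
      hence "c \<in> B" by (simp add: B_def)
      hence "c \<le> M" unfolding M_def using Max_ge[OF finB] by blast
      thus "c \<in> {1..M}" using c by simp
    qed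
    ultimately have "?C = {1..M}" by blast
    thus ?thesis unfolding beta_fn_def B_def[symmetric] M_def by simp
  qed
  finally show ?thesis .
qed

text \<open>The top index \<open>p ^ n - 1\<close> reaches every other index: its binomials are all
  prime to \<open>p\<close>, and replacing \<open>b\<close> by \<open>p ^ n - 1 - b\<close>
  exchanges the thresholds \<open>p ^ n - m\<close> and \<open>m\<close>. For \<open>m = 0\<close>
  no index reaches a threshold.\<close>

lemma unreachables_free:
  assumes "prime p" "m < p ^ n" "m = 0 \<or> p ^ n \<le> 2 * m"
  shows "unreachables p (p ^ n) (p ^ n - m) (max m (p ^ n - m)) = {p ^ n - 1}"
proof -
  let ?q = "p ^ n"
  have q0: "?q > 0" using assms(1) by (simp add: prime_gt_0_nat)
  have nd: "\<not> p dvd (?q - 1 choose b)" if "b < ?q" for b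
    using not_dvd_choose_pred_prime_power[OF assms(1), of n "?q - 1" b] that q0 by simp
  have "b \<notin> unreachables p ?q (?q - m) (max m (?q - m))" if "b < ?q - 1" for b
  proof -
    have "step_fn (?q - m) (?q - 1) - step_fn (?q - m) b = step_fn (max m (?q - m)) (?q - 1 - b)"
      using that assms(2,3) by (auto simp: step_fn_def)
    thus ?thesis using that nd[of b] by (auto simp: unreachables_def)
  qed
  moreover have "?q - 1 \<in> unreachables p ?q (?q - m) (max m (?q - m))"
    using q0 by (auto simp: unreachables_def)
  moreover have "b \<le> ?q - 1" if "b \<in> unreachables p ?q (?q - m) (max m (?q - m))" for b
    using that by (auto simp: unreachables_def)
  ultimately show ?thesis
    by (intro equalityI subsetI) (use le_neq_implies_less in blast, blast)
qed

text \<open>One inequality suffices, since \<open>a\<close> and \<open>p ^ n - a\<close> play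
  symmetric roles.\<close>

lemma multiplicity_reflect:
  assumes "prime p" "0 < (a::nat)" "a < p ^ n"
  shows "multiplicity p (p ^ n - a) = multiplicity p a"
proof -
  have p1: "p > 1" using assms(1) prime_gt_1_nat by blast
  have *: "multiplicity p a \<le> multiplicity p (p ^ n - a)" if a: "0 < a" "a < p ^ n" for a :: nat
  proof (rule multiplicity_geI)
    have "p ^ multiplicity p a \<le> a" using a by (simp add: dvd_imp_le multiplicity_dvd)
    hence "p ^ multiplicity p a < p ^ n" using a by simp
    hence "multiplicity p a < n" using p1 by simp
    thus "p ^ multiplicity p a dvd p ^ n - a"
      by (intro dvd_diff_nat) (auto simp: multiplicity_dvd le_imp_power_dvd)
  qed (use a p1 in \<open>auto simp del: power_eq_0_iff\<close>)
  show ?thesis using *[of a] *[of "p ^ n - a"] assms by (simp add: order_antisym)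
qed

text \<open>Here both thresholds are \<open>t = p ^ n - m\<close>. Indices below \<open>m\<close>,
  and those from \<open>t\<close> on other than the top, are reached from the top. For
  \<open>m \<le> b < t\<close> only some \<open>a < t\<close> can help, and the least increment with
  binomial prime to \<open>p\<close> is \<open>p ^ multiplicity p (Suc b)\<close>; replacing
  \<open>b\<close> by \<open>p ^ n - 1 - b\<close> turns the resulting inequality into that of
  \<open>first_multiples\<close>.\<close>

lemma unreachables_nonfree:
  assumes "prime p" "0 < m" "2 * m < p ^ n"
  shows "unreachables p (p ^ n) (p ^ n - m) (max m (p ^ n - m))
     = insert (p ^ n - 1) ((\<lambda>s. p ^ n - 1 - s) ` {s \<in> first_multiples p (p ^ n) m. s < p ^ n - m})"
    (is "?U = insert _ ((\<lambda>s. _ - s) ` ?S)")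
proof -
  define q t where "q = p ^ n" and "t = q - m"
  have q: "2 * m < q" using assms by (simp add: q_def)
  hence mt: "max m t = t" and q0: "q > 0" by (auto simp: t_def)
  have nd: "\<not> p dvd (q - 1 choose b)" if "b < q" for b
    using not_dvd_choose_pred_prime_power[OF assms(1), of n "q - 1" b] that q0 q_def by simp
  have mid: "b \<in> unreachables p q t t \<longleftrightarrow> t \<le> b + p ^ multiplicity p (Suc b)" if b: "m \<le> b" "b < t" for b
  proof -
    let ?P = "p ^ multiplicity p (Suc b)"
    have P0: "?P > 0" using assms(1) by (simp add: prime_gt_0_nat)
    have "b \<in> unreachables p q t t \<longleftrightarrow> (\<forall>a. b < a \<and> a < t \<longrightarrow> p dvd (a choose b))"
      using b q assms(2) by (auto simp: unreachables_def step_fn_def t_def)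
    also have "\<dots> \<longleftrightarrow> t \<le> b + ?P"
    proof
      assume *: "\<forall>a. b < a \<and> a < t \<longrightarrow> p dvd (a choose b)"
      show "t \<le> b + ?P"
        using not_dvd_choose_increment[OF assms(1), of b] *[rule_format, of "b + ?P"] P0
        by (metis add.commute less_add_same_cancel2 not_less)
    next
      assume *: "t \<le> b + ?P"
      show "\<forall>a. b < a \<and> a < t \<longrightarrow> p dvd (a choose b)"
      proof (intro allI impI, rule ccontr)
        fix a assume a: "b < a \<and> a < t" "\<not> p dvd (a choose b)"
        hence "\<not> p dvd (b + (a - b) choose (a - b))" by (simp add: binomial_symmetric[of b a])
        hence "?P dvd a - b"
          using prime_power_dvd_increment_if_choose[OF assms(1), of _ b "a - b"] a by (simp add: multiplicity_dvd)
        hence "?P \<le> a - b" using a by (intro dvd_imp_le) auto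
        thus False using * a by linarith
      qed
    qed
    finally show ?thesis .
  qed
  have low: "b \<notin> unreachables p q t t" if b: "b < m" for b
  proof -
    have "step_fn t (q - 1) - step_fn t b = step_fn t (q - 1 - b)" "b < q - 1"
      using b q assms(2) by (auto simp: step_fn_def t_def)
    thus ?thesis using nd[of b] q0 by (auto simp: unreachables_def)
  qed
  have high: "b \<notin> unreachables p q t t" if b: "t \<le> b" "b < q - 1" for b
  proof -
    have "step_fn t (q - 1) - step_fn t b = step_fn t (q - 1 - b)"
      using b q assms(2) by (auto simp: step_fn_def t_def)
    thus ?thesis using nd[of b] b by (auto simp: unreachables_def)
  qed
  have top: "q - 1 \<in> unreachables p q t t" using q0 by (auto simp: unreachables_def)
  have "b \<in> unreachables p q t t \<longleftrightarrow> b \<in> insert (q - 1) ((\<lambda>s. q - 1 - s) ` {s \<in> first_multiples p q m. s < q - m})" for b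
  proof (cases "m \<le> b \<and> b < t")
    case True
    have b: "Suc b < q" using True assms(2) t_def by auto
    have m: "multiplicity p (q - 1 - b) = multiplicity p (Suc b)"
      using multiplicity_reflect[OF assms(1), of "Suc b" n] b q_def by simp
    have "b \<in> unreachables p q t t \<longleftrightarrow> q - 1 - b \<in> first_multiples p q m"
      unfolding mid[OF True[THEN conjunct1] True[THEN conjunct2]] first_multiples_def mem_Collect_eq m
      using True b t_def by auto
    also have "\<dots> \<longleftrightarrow> b \<in> (\<lambda>s. q - 1 - s) ` {s \<in> first_multiples p q m. s < q - m}"
    proof
      assume "q - 1 - b \<in> first_multiples p q m"
      thus "b \<in> (\<lambda>s. q - 1 - s) ` {s \<in> first_multiples p q m. s < q - m}"
        using True b assms(2) by (intro image_eqI[of _ _ "q - 1 - b"]) auto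
    qed (auto simp: first_multiples_def)
    finally show ?thesis using b by auto
  next
    case False
    have "b \<in> unreachables p q t t \<longleftrightarrow> b = q - 1"
      using False low[of b] high[of b] top by (cases "b < q - 1") (auto simp: unreachables_def)
    moreover have "b \<notin> (\<lambda>s. q - 1 - s) ` {s \<in> first_multiples p q m. s < q - m}"
      using False q assms(2) by (auto simp: first_multiples_def t_def)
    ultimately show ?thesis by blast
  qed
  thus ?thesis unfolding q_def[symmetric] t_def[symmetric] mt by blast
qed

text \<open>Of the \<open>1 + alpha_fn p n m\<close> first multiples, the
  \<open>beta_fn p n m\<close> at or beyond \<open>p ^ n - m\<close> drop out, and the top index is
  added. Since \<open>m\<close> itself survives, at least two indices remain.\<close>

lemma card_unreachables_nonfree:
  assumes "prime p" "0 < m" "2 * m < p ^ n"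
  shows "card (unreachables p (p ^ n) (p ^ n - m) (max m (p ^ n - m))) + beta_fn p n m = 2 + alpha_fn p n m"
    and "card (unreachables p (p ^ n) (p ^ n - m) (max m (p ^ n - m))) > 1"
proof -
  let ?F = "first_multiples p (p ^ n) m"
  let ?S = "{s \<in> ?F. s < p ^ n - m}"
  have fin: "finite ?F" by (rule finite_subset[of _ "{..<p ^ n}"]) (auto simp: first_multiples_def)
  have "inj_on (\<lambda>s. p ^ n - 1 - s) ?S" by (auto simp: inj_on_def first_multiples_def)
  hence "card ((\<lambda>s. p ^ n - 1 - s) ` ?S) = card ?S" by (rule card_image)
  moreover have "p ^ n - 1 \<notin> (\<lambda>s. p ^ n - 1 - s) ` ?S"
    using assms(2,3) by (auto simp: first_multiples_def)
  ultimately have c: "card (unreachables p (p ^ n) (p ^ n - m) (max m (p ^ n - m))) = 1 + card ?S"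
    unfolding unreachables_nonfree[OF assms] using fin by simp
  have "card (?S \<union> {s \<in> ?F. p ^ n - m \<le> s}) = card ?S + card {s \<in> ?F. p ^ n - m \<le> s}"
    using fin by (intro card_Un_disjoint) auto
  moreover have "?S \<union> {s \<in> ?F. p ^ n - m \<le> s} = ?F" by auto
  ultimately have "card ?F = card ?S + card {s \<in> ?F. p ^ n - m \<le> s}" by simp
  thus "card (unreachables p (p ^ n) (p ^ n - m) (max m (p ^ n - m))) + beta_fn p n m = 2 + alpha_fn p n m"
    using c card_first_multiples_beyond[OF assms] card_first_multiples[OF assms(1,2)] assms(3) by simp
  have "m \<in> ?S" using assms prime_gt_0_nat[OF assms(1)] by (auto simp: first_multiples_def)
  hence "card ?S > 0" using fin by (auto simp: card_gt_0_iff)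
  thus "card (unreachables p (p ^ n) (p ^ n - m) (max m (p ^ n - m))) > 1" using c by simp
qed

section \<open>Totally ramified extensions\<close>

locale valued_field =
  fixes v :: "'a::field \<Rightarrow> int"
  assumes dval: "normalized_dval v"
begin

abbreviation P :: "int \<Rightarrow> 'a set" where "P \<equiv> ideal_pow v"

lemma v_mult: "x \<noteq> 0 \<Longrightarrow> y \<noteq> 0 \<Longrightarrow> v (x * y) = v x + v y"
  using dval by (simp add: normalized_dval_def)

lemma v_one: "v 1 = 0"
  using v_mult[of 1 1] by simp

lemma v_power: "x \<noteq> 0 \<Longrightarrow> v (x ^ k) = int k * v x"
  by (induction k) (simp_all add: v_one v_mult algebra_simps)

lemma v_inverse: "x \<noteq> 0 \<Longrightarrow> v (inverse x) = - v x"
  using v_mult[of x "inverse x"] v_one by simp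

lemma v_divide: "x \<noteq> 0 \<Longrightarrow> y \<noteq> 0 \<Longrightarrow> v (x / y) = v x - v y"
  by (simp add: divide_inverse v_mult v_inverse)

lemma v_minus: "v (- x) = v x"
proof (cases "x = 0")
  case False
  have "v (-1) + v (-1) = 0" using v_mult[of "-1" "-1"] v_one by simp
  hence "v (-1) = 0" by simp
  thus ?thesis using v_mult[of "-1" x] False by simp
qed simp

lemma P_iff: "x \<noteq> 0 \<Longrightarrow> x \<in> P h \<longleftrightarrow> h \<le> v x"
  by (simp add: ideal_pow_def)

lemma P_zero [simp]: "0 \<in> P h"
  by (simp add: ideal_pow_def)

lemma P_mono: "h \<le> h' \<Longrightarrow> x \<in> P h' \<Longrightarrow> x \<in> P h"
  by (auto simp: ideal_pow_def)

lemma P_add: "x \<in> P h \<Longrightarrow> y \<in> P h \<Longrightarrow> x + y \<in> P h"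
proof (cases "x = 0 \<or> y = 0 \<or> x + y = 0")
  case False
  assume "x \<in> P h" "y \<in> P h"
  moreover have "min (v x) (v y) \<le> v (x + y)"
    using dval False by (auto simp: normalized_dval_def)
  ultimately show ?thesis using False by (simp add: P_iff)
qed auto

lemma P_minus: "x \<in> P h \<Longrightarrow> - x \<in> P h"
  by (auto simp: ideal_pow_def v_minus)

lemma P_diff: "x \<in> P h \<Longrightarrow> y \<in> P h \<Longrightarrow> x - y \<in> P h"
  using P_add[of x h "- y"] P_minus[of y h] by simp

lemma P_diff_commute: "x - y \<in> P h \<Longrightarrow> y - x \<in> P h"
  using P_minus by fastforce

lemma P_sum: "(\<And>i. i \<in> S \<Longrightarrow> f i \<in> P h) \<Longrightarrow> sum f S \<in> P h"
  by (induction S rule: infinite_finite_induct) (auto intro: P_add)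

lemma P_mult: "x \<in> P h \<Longrightarrow> y \<in> P h' \<Longrightarrow> x * y \<in> P (h + h')"
  by (cases "x = 0 \<or> y = 0") (auto simp: P_iff v_mult)

lemma P_mult_left: "x \<in> P 0 \<Longrightarrow> y \<in> P h \<Longrightarrow> x * y \<in> P h"
  using P_mult[of x 0 y h] by simp

lemma P_power: "x \<in> P h \<Longrightarrow> x ^ k \<in> P (int k * h)"
  by (cases "x = 0") (auto simp: P_iff v_power mult_left_mono power_0_left v_one)

lemma P_power_0: "x \<in> P 0 \<Longrightarrow> x ^ k \<in> P 0"
  using P_power[of x 0 k] by simp

lemma P_of_nat: "of_nat k \<in> P 0"
  by (induction k) (auto intro!: P_add simp: P_iff v_one)

lemma one_in_P: "1 \<in> P h \<longleftrightarrow> h \<le> 0"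
  by (simp add: P_iff v_one)

lemma P_power_iff: "k > 0 \<Longrightarrow> x ^ k \<in> P (int k * h) \<longleftrightarrow> x \<in> P h"
  by (cases "x = 0") (auto simp: P_iff v_power power_0_left)

lemma v_eqI: "x \<in> P h \<Longrightarrow> x \<notin> P (h + 1) \<Longrightarrow> x \<noteq> 0 \<and> v x = h"
  by (auto simp: ideal_pow_def)

lemma P_all_zero: "(\<And>h. x \<in> P h) \<Longrightarrow> x = 0"
  by (metis P_iff add_le_same_cancel1 not_one_le_zero)

lemma ex_uniformizer: obtains \<pi> where "\<pi> \<noteq> 0" "v \<pi> = 1"
  using dval unfolding normalized_dval_def by metis

lemma ex_min_valuation:
  fixes f :: "'i \<Rightarrow> 'a"
  assumes "finite T" "T \<noteq> {}"
  obtains k where "k \<in> T" "\<And>j. j \<in> T \<Longrightarrow> v (f k) \<le> v (f j)"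
proof -
  have "Min ((\<lambda>i. v (f i)) ` T) \<in> (\<lambda>i. v (f i)) ` T" using assms by (intro Min_in) auto
  then obtain k where "k \<in> T" "v (f k) = Min ((\<lambda>i. v (f i)) ` T)" by auto
  thus thesis using that assms(1) by simp
qed

text \<open>The nonzero term of least valuation is unique. If it were outside \<open>P h\<close>, it
  would be the difference of the sum and of terms that all have strictly larger valuation.\<close>

lemma sum_distinct_valuations:
  assumes "finite S" "\<And>i j. i \<in> S \<Longrightarrow> j \<in> S \<Longrightarrow> f i \<noteq> 0 \<Longrightarrow> f j \<noteq> 0 \<Longrightarrow> v (f i) = v (f j) \<Longrightarrow> i = j"
    and "sum f S \<in> P h" "i \<in> S"
  shows "f i \<in> P h"
proof (rule ccontr)
  assume ni: "f i \<notin> P h"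
  define T where "T = {i\<in>S. f i \<noteq> 0}"
  have "finite T" "T \<noteq> {}" using ni assms(1,4) by (auto simp: T_def)
  then obtain k where k: "k \<in> T" "\<And>j. j \<in> T \<Longrightarrow> v (f k) \<le> v (f j)"
    using ex_min_valuation[of T f] by blast
  have "i \<in> T" using ni assms(4) by (auto simp: T_def)
  hence lt: "v (f k) < h" using k(2)[of i] ni by (auto simp: ideal_pow_def)
  have "f j \<in> P (v (f k) + 1)" if "j \<in> S - {k}" for j
  proof (cases "f j = 0")
    case False
    hence "j \<in> T" using that by (auto simp: T_def)
    hence "v (f k) \<le> v (f j)" "v (f k) \<noteq> v (f j)"
      using k that assms(2)[of k j] by (auto simp: T_def)
    thus ?thesis using False by (simp add: P_iff)
  qed simp
  hence "sum f (S - {k}) \<in> P (v (f k) + 1)" by (rule P_sum)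
  moreover have "sum f S \<in> P (v (f k) + 1)" using assms(3) lt by (intro P_mono[OF _ assms(3)]) simp
  moreover have "f k = sum f S - sum f (S - {k})"
    using k(1) assms(1) by (simp add: T_def sum_diff1)
  ultimately have "f k \<in> P (v (f k) + 1)" by (metis P_diff)
  thus False using k(1) by (auto simp: T_def P_iff)
qed

end

section \<open>Linear algebra over \<open>K\<close> and expansions with distinct valuations\<close>

locale tot_ramified = valued_field v for v :: "'a::field \<Rightarrow> int" +
  fixes K :: "'a set" and q :: nat
  assumes subf: "is_subfield K" and deg: "ext_degree_is K q" and totram: "totally_ramified v K q"
    and q_pos: "q > 0"
begin

lemma K_0 [simp]: "0 \<in> K" and K_1 [simp]: "1 \<in> K"
  and K_add: "x \<in> K \<Longrightarrow> y \<in> K \<Longrightarrow> x + y \<in> K"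
  and K_diff: "x \<in> K \<Longrightarrow> y \<in> K \<Longrightarrow> x - y \<in> K"
  and K_mult: "x \<in> K \<Longrightarrow> y \<in> K \<Longrightarrow> x * y \<in> K"
  using subf by (auto simp: is_subfield_def)

lemma K_inverse: "x \<in> K \<Longrightarrow> inverse x \<in> K"
  using subf by (cases "x = 0") (auto simp: is_subfield_def)

lemma K_divide: "x \<in> K \<Longrightarrow> y \<in> K \<Longrightarrow> x / y \<in> K"
  by (simp add: divide_inverse K_mult K_inverse)

lemma K_minus: "x \<in> K \<Longrightarrow> - x \<in> K"
  using K_diff[of 0 x] by simp

lemma K_sum: "(\<And>i. i \<in> S \<Longrightarrow> f i \<in> K) \<Longrightarrow> sum f S \<in> K"
  by (induction S rule: infinite_finite_induct) (auto intro: K_add)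

lemma K_prod: "(\<And>i. i \<in> S \<Longrightarrow> f i \<in> K) \<Longrightarrow> prod f S \<in> K"
  by (induction S rule: infinite_finite_induct) (auto intro: K_mult)

lemma K_power: "x \<in> K \<Longrightarrow> x ^ k \<in> K"
  by (induction k) (auto intro: K_mult)

lemma K_of_nat: "of_nat k \<in> K"
  by (induction k) (auto intro: K_add)

text \<open>Gaussian elimination by induction on the equations. \<open>K\<close> is a set and not a
  type, so membership of all coefficients in \<open>K\<close> is carried along.\<close>

lemma homogeneous_system_nontrivial:
  fixes A :: "'i \<Rightarrow> 'j \<Rightarrow> 'a::field"
  assumes "finite J" "finite I" "card J < card I"
    and "\<And>i j. i \<in> I \<Longrightarrow> j \<in> J \<Longrightarrow> A i j \<in> K"
  obtains c where "\<And>i. c i \<in> K" "\<exists>i\<in>I. c i \<noteq> 0" "\<And>j. j \<in> J \<Longrightarrow> (\<Sum>i\<in>I. c i * A i j) = 0"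
proof -
  have "\<exists>c. (\<forall>i. c i \<in> K) \<and> (\<exists>i\<in>I. c i \<noteq> 0) \<and> (\<forall>j\<in>J. (\<Sum>i\<in>I. c i * A i j) = 0)"
    using assms
  proof (induction J arbitrary: I A rule: finite_induct)
    case empty
    then obtain i where "i \<in> I" by (metis card.empty less_numeral_extra(3) ex_in_conv)
    thus ?case by (intro exI[of _ "\<lambda>_. 1"]) auto
  next
    case (insert j J)
    show ?case
    proof (cases "\<forall>i\<in>I. A i j = 0")
      case True
      have "card J < card I" using insert by simp
      then obtain c where "\<forall>i. c i \<in> K" "\<exists>i\<in>I. c i \<noteq> 0" "\<forall>j\<in>J. (\<Sum>i\<in>I. c i * A i j) = 0"
        using insert.IH[of I A] insert.prems by auto
      thus ?thesis using True by (intro exI[of _ c]) auto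
    next
      case False
      then obtain i0 where i0: "i0 \<in> I" "A i0 j \<noteq> 0" by blast
      define I' where "I' = I - {i0}"
      define A' where "A' i k = A i k - A i j / A i0 j * A i0 k" for i k
      have I': "finite I'" "I = insert i0 I'" "i0 \<notin> I'" using insert.prems i0 by (auto simp: I'_def)
      have "card J < card I'" using insert.prems insert.hyps I' by simp
      moreover have "A' i k \<in> K" if "i \<in> I'" "k \<in> J" for i k
        using that insert.prems i0 unfolding A'_def I'_def by (intro K_diff K_mult K_divide) auto
      ultimately obtain c where c: "\<forall>i. c i \<in> K" "\<exists>i\<in>I'. c i \<noteq> 0" "\<forall>k\<in>J. (\<Sum>i\<in>I'. c i * A' i k) = 0"
        using insert.IH[of I' A'] I'(1) by auto
      \<comment> \<open>Coefficient of the pivot unknown, chosen so that equation \<open>j\<close>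
        holds.\<close>
      define e where "e = - (\<Sum>i\<in>I'. c i * (A i j / A i0 j))"
      define d where "d = c(i0 := e)"
      have "(\<Sum>i\<in>I'. c i * (A i j / A i0 j)) \<in> K"
        using c(1) insert.prems i0 I' by (intro K_sum K_mult K_divide) auto
      hence eK: "e \<in> K" unfolding e_def by (rule K_minus)
      have sum_d: "(\<Sum>i\<in>I. d i * A i k) = e * A i0 k + (\<Sum>i\<in>I'. c i * A i k)" for k
        using I' by (auto simp: d_def intro!: sum.cong)
      have "(\<Sum>i\<in>I. d i * A i k) = (\<Sum>i\<in>I'. c i * A' i k)" for k
        unfolding sum_d by (simp add: A'_def e_def sum_subtractf algebra_simps sum_distrib_left sum_distrib_right)
      moreover have "A' i j = 0" for i using i0 by (simp add: A'_def)
      ultimately have "\<forall>k\<in>insert j J. (\<Sum>i\<in>I. d i * A i k) = 0" using c(3) by simp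
      moreover have "\<exists>i\<in>I. d i \<noteq> 0" using c(2) I' by (auto simp: d_def)
      moreover have "\<forall>i. d i \<in> K" using c(1) eK by (simp add: d_def)
      ultimately show ?thesis by blast
    qed
  qed
  thus thesis using that by blast
qed

lemma v_K_dvd: "x \<in> K \<Longrightarrow> x \<noteq> 0 \<Longrightarrow> int q dvd v x"
  using totram by (auto simp: totally_ramified_def image_def set_eq_iff dvd_def)

lemma ex_K_valuation:
  assumes "int q dvd z"
  obtains x where "x \<in> K" "x \<noteq> 0" "v x = z"
proof -
  have "z \<in> v ` (K - {0})" using totram assms by (auto simp: totally_ramified_def)
  thus ?thesis using that by auto
qed

text \<open>Values on \<open>K\<close> are multiples of \<open>q\<close>, so a lower bound rounds up
  to the next multiple.\<close>

lemma K_P_ceiling: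
  assumes "x \<in> K" "x \<in> P h" "h > int q * (z - 1)"
  shows "x \<in> P (int q * z)"
proof (cases "x = 0")
  case False
  obtain y where y: "v x = int q * y" using v_K_dvd[OF assms(1) False] by blast
  have "int q * (z - 1) < int q * y" using assms False y by (simp add: P_iff)
  hence "z - 1 < y" using q_pos by simp
  hence "z \<le> y" by simp
  thus ?thesis using False y by (simp add: P_iff mult_left_mono)
qed simp

lemma dependent_if_card_gt_degree:
  fixes x :: "'i \<Rightarrow> 'a"
  assumes "finite I" "q < card I"
  obtains c where "\<And>i. c i \<in> K" "\<exists>i\<in>I. c i \<noteq> 0" "(\<Sum>i\<in>I. c i * x i) = 0"
proof -
  obtain bs where bs: "length bs = q" "\<And>x. \<exists>!cs. length cs = q \<and> set cs \<subseteq> K \<and> x = (\<Sum>i<q. cs ! i * bs ! i)"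
    using deg unfolding ext_degree_is_def by blast
  have "\<forall>y. \<exists>cs. length cs = q \<and> set cs \<subseteq> K \<and> y = (\<Sum>i<q. cs ! i * bs ! i)"
    using bs(2) by blast
  then obtain A where A: "\<And>y. length (A y) = q \<and> set (A y) \<subseteq> K \<and> y = (\<Sum>i<q. A y ! i * bs ! i)"
    by metis
  have AK: "A y ! j \<in> K" if "j < q" for y j using A[of y] that by (metis nth_mem subsetD)
  obtain c where c: "\<And>i. c i \<in> K" "\<exists>i\<in>I. c i \<noteq> 0" "\<And>j. j \<in> {..<q} \<Longrightarrow> (\<Sum>i\<in>I. c i * A (x i) ! j) = 0"
    using homogeneous_system_nontrivial[of "{..<q}" I "\<lambda>i j. A (x i) ! j"] assms AK by auto
  have "(\<Sum>i\<in>I. c i * x i) = (\<Sum>i\<in>I. \<Sum>j<q. c i * A (x i) ! j * bs ! j)"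
    using A by (intro sum.cong refl) (metis (no_types, lifting) sum.cong sum_distrib_left mult.assoc)
  also have "\<dots> = (\<Sum>j<q. (\<Sum>i\<in>I. c i * A (x i) ! j) * bs ! j)"
    by (subst sum.swap) (simp add: sum_distrib_right)
  also have "\<dots> = 0" using c(3) by simp
  finally show ?thesis using that c by blast
qed

lemma K_multiples_distinct:
  assumes "y \<noteq> 0" "y' \<noteq> 0" "\<not> int q dvd v y - v y'" "c \<in> K" "c' \<in> K" "c * y \<noteq> 0" "c' * y' \<noteq> 0"
  shows "v (c * y) \<noteq> v (c' * y')"
proof
  assume eq: "v (c * y) = v (c' * y')"
  have c: "c \<noteq> 0" "c' \<noteq> 0" using assms by auto
  have "v y - v y' = v c' - v c" using eq assms c by (simp add: v_mult)
  thus False using v_K_dvd[OF assms(4) c(1)] v_K_dvd[OF assms(5) c(2)] assms(3) by (simp add: dvd_diff)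
qed

text \<open>Factors from \<open>K\<close> change valuations by multiples of \<open>q\<close>, so
  nonzero terms keep distinct valuations.\<close>

lemma expansion_in_P:
  assumes "finite S" "\<And>a. a \<in> S \<Longrightarrow> y a \<noteq> 0"
    and "\<And>a b. a \<in> S \<Longrightarrow> b \<in> S \<Longrightarrow> a \<noteq> b \<Longrightarrow> \<not> int q dvd v (y a) - v (y b)"
    and "\<And>a. a \<in> S \<Longrightarrow> c a \<in> K" "(\<Sum>a\<in>S. c a * y a) \<in> P h" "a \<in> S"
  shows "c a * y a \<in> P h"
  using sum_distinct_valuations[of S "\<lambda>a. c a * y a", OF assms(1) _ assms(5,6)] K_multiples_distinct assms(2-4)
  by meson

lemma expansion_unique:
  assumes "finite S" "\<And>a. a \<in> S \<Longrightarrow> y a \<noteq> 0"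
    and "\<And>a b. a \<in> S \<Longrightarrow> b \<in> S \<Longrightarrow> a \<noteq> b \<Longrightarrow> \<not> int q dvd v (y a) - v (y b)"
    and "\<And>a. a \<in> S \<Longrightarrow> c a \<in> K" "(\<Sum>a\<in>S. c a * y a) = 0" "a \<in> S"
  shows "c a = 0"
proof -
  have "c a * y a = 0"
    by (rule P_all_zero, rule expansion_in_P[OF assms(1-4) _ assms(6)]) (use assms(5) in auto)
  thus ?thesis using assms(2,6) by simp
qed

text \<open>Adjoining \<open>x\<close>, indexed by \<open>None\<close>, gives \<open>q + 1\<close>
  elements and hence a relation over \<open>K\<close>; the coefficient of \<open>x\<close> is
  nonzero because the \<open>y a\<close> are independent.\<close>

lemma expansion_exists:
  assumes "finite S" "card S = q" "\<And>a. a \<in> S \<Longrightarrow> y a \<noteq> 0"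
    and "\<And>a b. a \<in> S \<Longrightarrow> b \<in> S \<Longrightarrow> a \<noteq> b \<Longrightarrow> \<not> int q dvd v (y a) - v (y b)"
  obtains c where "\<And>a. c a \<in> K" "x = (\<Sum>a\<in>S. c a * y a)"
proof -
  define z where "z = case_option x y"
  have "q < card (insert None (Some ` S))" using assms(1,2) by (simp add: card_image)
  then obtain d where d: "\<And>i. d i \<in> K" "\<exists>i\<in>insert None (Some ` S). d i \<noteq> 0"
    "(\<Sum>i\<in>insert None (Some ` S). d i * z i) = 0"
    using dependent_if_card_gt_degree[of "insert None (Some ` S)" z] assms(1) by blast
  have e: "d None * x + (\<Sum>a\<in>S. d (Some a) * y a) = 0"
    using d(3) assms(1) by (simp add: z_def sum.reindex)
  have "d None \<noteq> 0"
  proof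
    assume d0: "d None = 0"
    have "d (Some a) = 0" if "a \<in> S" for a
      by (rule expansion_unique[OF assms(1,3,4), where c = "\<lambda>a. d (Some a)"]) (use d e d0 that in auto)
    thus False using d(2) d0 by auto
  qed
  hence "x = (\<Sum>a\<in>S. (- d (Some a) / d None) * y a)"
    using e by (simp add: sum_negf field_simps eq_neg_iff_add_eq_0 flip: sum_divide_distrib)
  thus ?thesis using d(1) by (intro that[of "\<lambda>a. - d (Some a) / d None"]) (auto intro: K_divide K_minus)
qed

text \<open>Division by a coefficient of least valuation. This turns a relation over
  \<open>K\<close> into an integral one that stays nontrivial in the residue field.\<close>

lemma primitive_scaling:
  assumes "finite I" "\<And>i. i \<in> I \<Longrightarrow> c i \<in> K" "\<exists>i\<in>I. c i \<noteq> 0"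
  obtains d where "d \<in> K" "d \<noteq> 0" "\<And>i. i \<in> I \<Longrightarrow> d * c i \<in> P 0" "\<exists>i\<in>I. d * c i = 1"
proof -
  define T where "T = {i\<in>I. c i \<noteq> 0}"
  have "finite T" "T \<noteq> {}" using assms by (auto simp: T_def)
  then obtain k where k: "k \<in> T" "\<And>j. j \<in> T \<Longrightarrow> v (c k) \<le> v (c j)"
    using ex_min_valuation[of T c] by blast
  show ?thesis
  proof (rule that[of "inverse (c k)"])
    show "inverse (c k) * c i \<in> P 0" if "i \<in> I" for i
      using k that by (cases "c i = 0") (auto simp: T_def P_iff v_mult v_inverse)
    show "\<exists>i\<in>I. inverse (c k) * c i = 1"
      using k(1) by (intro bexI[of _ k]) (auto simp: T_def)
  qed (use k assms in \<open>auto simp: T_def intro: K_inverse\<close>)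
qed

end

section \<open>Weakly ramified Galois extensions\<close>

lemma polynomial_function_zero:
  fixes f :: "nat \<Rightarrow> 'a::field"
  assumes "finite S" "card S \<ge> q" "\<And>x. x \<in> S \<Longrightarrow> (\<Sum>j<q. f j * x ^ j) = 0" "j < q"
  shows "f j = 0"
proof (rule ccontr)
  assume nz: "f j \<noteq> 0"
  define F where "F = (\<Sum>j<q. monom (f j) j)"
  have cF: "coeff F j = f j" using assms(4) by (simp add: F_def coeff_sum)
  hence F0: "F \<noteq> 0" using nz by auto
  have "poly F x = 0" if "x \<in> S" for x
    using assms(3)[OF that] by (simp add: F_def poly_sum poly_monom)
  hence "S \<subseteq> {x. poly F x = 0}" by blast
  hence "card S \<le> card {x. poly F x = 0}" using poly_roots_finite[OF F0] by (rule card_mono[rotated])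
  also have "\<dots> \<le> degree F" by (rule card_poly_roots_bound[OF F0])
  also have "degree F < q" unfolding F_def using assms(4)
    by (intro degree_sum_less) (auto intro: le_less_trans[OF degree_monom_le])
  finally show False using assms(2) by simp
qed

lemma not_int_dvd_diff:
  assumes "a < q" "b < q" "a \<noteq> b"
  shows "\<not> int q dvd int a - int b"
proof
  assume "int q dvd int a - int b"
  hence "int a mod int q = int b mod int q" by (simp add: mod_eq_dvd_iff)
  thus False using assms by simp
qed

section \<open>Automorphisms over \<open>K\<close>\<close>

context
  fixes K :: "'a::field set" and \<sigma> :: "'a \<Rightarrow> 'a"
  assumes \<sigma>: "\<sigma> \<in> galois_group K"
begin

lemma gal_add: "\<sigma> (x + y) = \<sigma> x + \<sigma> y"
  and gal_mult: "\<sigma> (x * y) = \<sigma> x * \<sigma> y"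
  and gal_one: "\<sigma> 1 = 1"
  and gal_bij: "bij \<sigma>"
  and gal_fix: "x \<in> K \<Longrightarrow> \<sigma> x = x"
  using \<sigma> by (auto simp: galois_group_def field_aut_def)

lemma gal_zero: "\<sigma> 0 = 0"
  using gal_add[of 0 0] by (simp only: add_0_left) (metis add_cancel_right_right)

lemma gal_minus: "\<sigma> (- x) = - \<sigma> x"
  using gal_add[of x "- x"] by (simp add: gal_zero eq_neg_iff_add_eq_0 add.commute)

lemma gal_diff: "\<sigma> (x - y) = \<sigma> x - \<sigma> y"
  using gal_add[of x "- y"] by (simp add: gal_minus)

lemma gal_sum: "\<sigma> (sum f S) = (\<Sum>i\<in>S. \<sigma> (f i))"
  by (induction S rule: infinite_finite_induct) (auto simp: gal_add gal_zero)

lemma gal_power: "\<sigma> (x ^ k) = \<sigma> x ^ k"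
  by (induction k) (auto simp: gal_mult gal_one)

lemma gal_of_nat: "\<sigma> (of_nat k) = of_nat k"
  by (induction k) (auto simp: gal_add gal_one gal_zero)

lemma gal_eq_iff: "\<sigma> x = \<sigma> y \<longleftrightarrow> x = y"
  using gal_bij by (auto simp: bij_def inj_def)

lemma gal_eq_0_iff: "\<sigma> x = 0 \<longleftrightarrow> x = 0"
  using gal_eq_iff[of x 0] by (simp add: gal_zero)

lemma gal_inverse: "\<sigma> (inverse x) = inverse (\<sigma> x)"
proof (cases "x = 0")
  case False
  have "\<sigma> x * \<sigma> (inverse x) = 1" using False by (simp add: gal_one flip: gal_mult)
  thus ?thesis by (metis inverse_unique)
qed (simp add: gal_zero)

lemma gal_divide: "\<sigma> (x / y) = \<sigma> x / \<sigma> y"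
  by (simp add: divide_inverse gal_mult gal_inverse)

lemma gal_inv: "inv \<sigma> \<in> galois_group K"
proof -
  have s: "\<sigma> (inv \<sigma> x) = x" for x using gal_bij by (simp add: bij_is_surj surj_f_inv_f)
  have "\<sigma> (inv \<sigma> (x + y)) = \<sigma> (inv \<sigma> x + inv \<sigma> y)" for x y by (simp add: s gal_add)
  moreover have "\<sigma> (inv \<sigma> (x * y)) = \<sigma> (inv \<sigma> x * inv \<sigma> y)" for x y by (simp add: s gal_mult)
  moreover have "\<sigma> (inv \<sigma> 1) = \<sigma> 1" by (simp only: s gal_one)
  moreover have "inv \<sigma> x = x" if "x \<in> K" for x using gal_fix[OF that] s gal_eq_iff by metis
  moreover have "bij (inv \<sigma>)" using gal_bij by (rule bij_imp_bij_inv)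
  ultimately show ?thesis using gal_eq_iff by (simp only: galois_group_def field_aut_def) simp
qed

lemma gal_inv_apply: "\<sigma> (inv \<sigma> x) = x" "inv \<sigma> (\<sigma> x) = x"
  using gal_bij by (simp_all add: bij_is_surj surj_f_inv_f bij_is_inj inv_f_f)

end

lemma gal_id: "id \<in> galois_group K"
  by (simp add: galois_group_def field_aut_def)

lemma gal_comp: "\<sigma> \<in> galois_group K \<Longrightarrow> \<tau> \<in> galois_group K \<Longrightarrow> \<sigma> \<circ> \<tau> \<in> galois_group K"
  by (simp add: galois_group_def field_aut_def bij_comp)

lemma gal_funpow: "\<sigma> \<in> galois_group K \<Longrightarrow> \<sigma> ^^ k \<in> galois_group K"
  by (induction k) (simp_all add: gal_comp gal_id del: id_apply)

lemma gal_comp_bij_betw: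
  assumes "\<sigma> \<in> galois_group K"
  shows "bij_betw (\<lambda>\<tau>. \<sigma> \<circ> \<tau>) (galois_group K) (galois_group K)"
proof (rule bij_betw_byWitness[where f' = "\<lambda>\<tau>. inv \<sigma> \<circ> \<tau>"])
  show "\<forall>\<tau>\<in>galois_group K. inv \<sigma> \<circ> (\<sigma> \<circ> \<tau>) = \<tau>" "\<forall>\<tau>\<in>galois_group K. \<sigma> \<circ> (inv \<sigma> \<circ> \<tau>) = \<tau>"
    by (auto simp: fun_eq_iff gal_inv_apply[OF assms])
qed (use assms in \<open>auto simp: gal_comp gal_inv\<close>)

lemma gal_comp_right_bij_betw:
  assumes "\<sigma> \<in> galois_group K"
  shows "bij_betw (\<lambda>\<tau>. \<tau> \<circ> \<sigma>) (galois_group K) (galois_group K)"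
proof (rule bij_betw_byWitness[where f' = "\<lambda>\<tau>. \<tau> \<circ> inv \<sigma>"])
  show "\<forall>\<tau>\<in>galois_group K. (\<tau> \<circ> \<sigma>) \<circ> inv \<sigma> = \<tau>" "\<forall>\<tau>\<in>galois_group K. (\<tau> \<circ> inv \<sigma>) \<circ> \<sigma> = \<tau>"
    by (auto simp: fun_eq_iff gal_inv_apply[OF assms])
qed (use assms in \<open>auto simp: gal_comp gal_inv\<close>)

locale weak_extension = valued_field v for v :: "'a::field \<Rightarrow> int" +
  fixes K :: "'a set" and p n :: nat
  assumes prime: "prime p" and char: "CHAR('a) = p" and subfield: "is_subfield K"
    and perfect: "perfect_residue_field v K p"
    and galois: "galois_of_degree K (p ^ n)"
    and ram: "totally_ramified v K (p ^ n)"
    and weak: "weakly_ramified v K"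
begin

abbreviation q :: nat where "q \<equiv> p ^ n"

abbreviation G :: "('a \<Rightarrow> 'a) set" where "G \<equiv> galois_group K"

sublocale tot_ramified v K q
  using subfield galois ram prime
  by unfold_locales (auto simp: galois_of_degree_def prime_gt_0_nat)

lemma finite_G: "finite G" and card_G: "card G = q"
  using galois by (auto simp: galois_of_degree_def)

lemma p_gt_1: "p > 1"
  using prime by (rule prime_gt_1_nat)

lemma of_nat_eq_0_iff_dvd: "(of_nat k :: 'a) = 0 \<longleftrightarrow> p dvd k"
  using of_nat_eq_0_iff_char_dvd[where 'a = 'a] char by simp

lemma frobenius_add: "(x + y :: 'a) ^ (p ^ k) = x ^ (p ^ k) + y ^ (p ^ k)"
  using freshmans_dream'[where 'a = 'a] prime char by simp

lemma frobenius_sum: "(sum f S :: 'a) ^ (p ^ k) = (\<Sum>i\<in>S. f i ^ (p ^ k))"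
  using freshmans_dream_sum'[where 'a = 'a, of "p ^ k" k] prime char by simp

lemma frobenius_diff: "(x - y :: 'a) ^ (p ^ k) = x ^ (p ^ k) - y ^ (p ^ k)"
  using frobenius_add[of "x - y" y k] by simp

lemma power_expansion:
  assumes "y \<noteq> 0" "v y = 1 \<or> v y = -1"
  obtains c where "\<And>j. c j \<in> K" "x = (\<Sum>j<q. c j * y ^ j)"
proof (rule expansion_exists[of "{..<q}" "\<lambda>j. y ^ j" x])
  fix a b assume "a \<in> {..<q}" "b \<in> {..<q}" "a \<noteq> b"
  thus "\<not> int q dvd v (y ^ a) - v (y ^ b)"
    using assms not_int_dvd_diff[of a q b] not_int_dvd_diff[of b q a] by (auto simp: v_power)
qed (use assms in auto)

lemma power_expansion_in_P:
  assumes "y \<noteq> 0" "v y = 1 \<or> v y = -1" "\<And>j. j < q \<Longrightarrow> c j \<in> K" "(\<Sum>j<q. c j * y ^ j) \<in> P h" "j < q"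
  shows "c j * y ^ j \<in> P h"
proof (rule expansion_in_P[of "{..<q}" "\<lambda>j. y ^ j" c h])
  fix a b assume "a \<in> {..<q}" "b \<in> {..<q}" "a \<noteq> b"
  thus "\<not> int q dvd v (y ^ a) - v (y ^ b)"
    using assms not_int_dvd_diff[of a q b] not_int_dvd_diff[of b q a] by (auto simp: v_power)
qed (use assms in auto)

text \<open>The bound \<open>v (c j) \<ge> - j > - q\<close> rounds up to \<open>0\<close> because
  \<open>v (c j)\<close> is a multiple of \<open>q\<close>.\<close>

lemma integral_coefficients:
  assumes "\<pi> \<noteq> 0" "v \<pi> = 1" "\<And>j. j < q \<Longrightarrow> c j \<in> K" "(\<Sum>j<q. c j * \<pi> ^ j) \<in> P 0" "j < q"
  shows "c j \<in> P 0"
proof (cases "c j = 0")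
  case False
  have "c j * \<pi> ^ j \<in> P 0" using power_expansion_in_P[OF assms(1) _ assms(3-5)] assms(2) by blast
  hence "- int j \<le> v (c j)" using False assms(1,2) by (simp add: P_iff v_mult v_power)
  hence "c j \<in> P (int q * 0)"
    using False assms(5) by (intro K_P_ceiling[of _ "- int j"]) (use assms(3) in \<open>auto simp: P_iff\<close>)
  thus ?thesis by simp
qed simp

text \<open>The powers of an integral \<open>x\<close> have integral coefficients in \<open>\<pi> ^ j\<close>, \<open>j < q\<close>, so the valuations
  of the powers of \<open>\<sigma> x\<close> are bounded below. This replaces the usual appeal to completeness.\<close>
lemma gal_P_0:
  assumes s: "\<sigma> \<in> G" and "x \<in> P 0"
  shows "\<sigma> x \<in> P 0"
proof (rule ccontr)
  assume n: "\<sigma> x \<notin> P 0"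
  obtain \<pi> where pi: "\<pi> \<noteq> 0" "v \<pi> = 1" by (rule ex_uniformizer)
  define N where "N = int q * \<bar>v (\<sigma> \<pi>)\<bar>"
  have s0: "\<sigma> \<pi> \<noteq> 0" using pi s by (simp add: gal_eq_0_iff)
  have pw: "\<sigma> \<pi> ^ j \<in> P (- N)" if "j < q" for j
  proof -
    have "\<bar>int j * v (\<sigma> \<pi>)\<bar> \<le> N" unfolding N_def abs_mult using that by (intro mult_mono) auto
    hence "- N \<le> int j * v (\<sigma> \<pi>)" by linarith
    thus ?thesis using s0 by (simp add: P_iff v_power)
  qed
  have "\<sigma> x ^ k \<in> P (- N)" for k
  proof -
    obtain c where c: "\<And>j. c j \<in> K" "x ^ k = (\<Sum>j<q. c j * \<pi> ^ j)"
      using power_expansion[of \<pi> "x ^ k"] pi by blast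
    have cj: "c j \<in> P 0" if "j < q" for j
      using integral_coefficients[OF pi, of c j] c that P_power_0[OF assms(2), of k] by simp
    have "\<sigma> x ^ k = \<sigma> (\<Sum>j<q. c j * \<pi> ^ j)" by (simp only: gal_power[OF s, symmetric] c(2))
    also have "\<dots> = (\<Sum>j<q. c j * \<sigma> \<pi> ^ j)"
      using c(1) s by (simp add: gal_sum[OF s] gal_mult[OF s] gal_power[OF s] gal_fix[OF s])
    also have "\<dots> \<in> P (- N)" using cj pw by (intro P_sum P_mult_left) auto
    finally show ?thesis .
  qed
  from this[of "nat (N + 1)"] have *: "- N \<le> int (nat (N + 1)) * v (\<sigma> x)" "v (\<sigma> x) \<le> -1"
    using n by (auto simp: ideal_pow_def v_power)
  have "N \<ge> 0" by (simp add: N_def)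
  hence "int (nat (N + 1)) = N + 1" by simp
  moreover have "(N + 1) * v (\<sigma> x) \<le> (N + 1) * (-1)" using *(2) \<open>N \<ge> 0\<close> by (intro mult_left_mono) auto
  ultimately show False using *(1) by simp
qed

text \<open>Scaling \<open>y ^ q\<close> by an element of \<open>K\<close> gives valuation
  \<open>0\<close>, which reduces one inequality to integrality; applying it to the inverse gives
  the other.\<close>

lemma gal_v:
  assumes s: "\<sigma> \<in> G" and x: "x \<noteq> 0"
  shows "v (\<sigma> x) = v x"
proof -
  have ge: "v (\<sigma> y) \<ge> v y" if y: "y \<noteq> 0" for y
  proof -
    obtain k where k: "k \<in> K" "k \<noteq> 0" "v k = int q * v y"
      using ex_K_valuation[of "int q * v y"] by auto
    have "y ^ q / k \<in> P 0" using k y by (simp add: P_iff v_divide v_power)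
    hence "\<sigma> (y ^ q / k) \<in> P 0" using gal_P_0[OF s] by blast
    hence "\<sigma> y ^ q / k \<in> P 0" using k by (simp add: gal_divide[OF s] gal_power[OF s] gal_fix[OF s])
    hence "int q * v y \<le> int q * v (\<sigma> y)" using k y gal_eq_0_iff[OF s, of y] by (simp add: P_iff v_divide v_power)
    thus ?thesis using q_pos by simp
  qed
  have "v (\<sigma> (inverse x)) \<ge> v (inverse x)" using x by (intro ge) simp
  thus ?thesis using ge[OF x] x gal_eq_0_iff[OF s, of x] by (simp add: gal_inverse[OF s] v_inverse)
qed

lemma gal_P: "\<sigma> \<in> G \<Longrightarrow> \<sigma> x \<in> P h \<longleftrightarrow> x \<in> P h"
  by (cases "x = 0") (auto simp: ideal_pow_def gal_v gal_eq_0_iff)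

lemma gal_apply_expansion:
  assumes "\<sigma> \<in> G" "\<And>j. c j \<in> K"
  shows "\<sigma> (\<Sum>j<q. c j * y ^ j) = (\<Sum>j<q. c j * \<sigma> y ^ j)"
  using assms by (simp add: gal_sum gal_mult gal_power gal_fix)

lemma gal_determined:
  assumes "y \<noteq> 0" "v y = 1 \<or> v y = -1" "\<sigma> \<in> G" "\<tau> \<in> G" "\<sigma> y = \<tau> y"
  shows "\<sigma> = \<tau>"
proof
  fix x
  obtain c where "\<And>j. c j \<in> K" "x = (\<Sum>j<q. c j * y ^ j)"
    using power_expansion[OF assms(1,2)] by blast
  thus "\<sigma> x = \<tau> x" using assms by (simp add: gal_apply_expansion)
qed

lemma inj_on_conjugates:
  assumes "y \<noteq> 0" "v y = 1 \<or> v y = -1"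
  shows "inj_on (\<lambda>\<sigma>. \<sigma> y) G"
  using gal_determined[OF assms] by (auto simp: inj_on_def)

lemma fixed_in_K:
  assumes "\<And>\<sigma>. \<sigma> \<in> G \<Longrightarrow> \<sigma> x = x"
  shows "x \<in> K"
proof -
  obtain \<pi> where pi: "\<pi> \<noteq> 0" "v \<pi> = 1" by (rule ex_uniformizer)
  obtain c where c: "\<And>j. c j \<in> K" "x = (\<Sum>j<q. c j * \<pi> ^ j)"
    using power_expansion[of \<pi> x] pi by blast
  define d where "d = c(0 := c 0 - x)"
  have d: "(\<Sum>j<q. d j * z ^ j) = (\<Sum>j<q. c j * z ^ j) - x" for z
  proof -
    have "(\<Sum>j<q. d j * z ^ j) = (\<Sum>j<q. c j * z ^ j - (if j = 0 then x else 0))"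
      by (intro sum.cong) (auto simp: d_def algebra_simps)
    also have "\<dots> = (\<Sum>j<q. c j * z ^ j) - x" using q_pos by (simp add: sum_subtractf)
    finally show ?thesis .
  qed
  \<comment> \<open>\<open>\<Sum>j. d j * X ^ j\<close> has degree less than \<open>q\<close> but the \<open>q\<close> conjugates of \<open>\<pi>\<close> as roots\<close>
  have "d 0 = 0"
  proof (rule polynomial_function_zero[of "(\<lambda>\<sigma>. \<sigma> \<pi>) ` G" q])
    show "card ((\<lambda>\<sigma>. \<sigma> \<pi>) ` G) \<ge> q" using inj_on_conjugates[of \<pi>] pi card_G by (simp add: card_image)
    fix z assume "z \<in> (\<lambda>\<sigma>. \<sigma> \<pi>) ` G"
    then obtain \<sigma> where s: "\<sigma> \<in> G" "z = \<sigma> \<pi>" by blast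
    have "\<sigma> x = (\<Sum>j<q. c j * z ^ j)" using gal_apply_expansion[OF s(1), of c \<pi>] c s(2) by simp
    thus "(\<Sum>j<q. d j * z ^ j) = 0" using d assms[OF s(1)] by simp
  qed (use finite_G q_pos in auto)
  hence "x = c 0" by (simp add: d_def)
  thus ?thesis using c by simp
qed

text \<open>Total ramification makes the residue fields agree: modulo \<open>P 1\<close> only the
  constant coefficient of the expansion in a uniformizer survives.\<close>

lemma residue_representative:
  assumes "x \<in> P 0"
  obtains c where "c \<in> K" "c \<in> P 0" "x - c \<in> P 1"
proof -
  obtain \<pi> where pi: "\<pi> \<noteq> 0" "v \<pi> = 1" by (rule ex_uniformizer)
  obtain c where c: "\<And>j. c j \<in> K" "x = (\<Sum>j<q. c j * \<pi> ^ j)"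
    using power_expansion[of \<pi> x] pi by blast
  have cj: "c j \<in> P 0" if "j < q" for j
    using integral_coefficients[OF pi, of c j] c that assms by simp
  have "x - c 0 = (\<Sum>j\<in>{..<q} - {0}. c j * \<pi> ^ j)" using q_pos c(2) by (simp add: sum.remove[of _ 0])
  also have "\<dots> \<in> P 1"
  proof (rule P_sum)
    fix j assume j: "j \<in> {..<q} - {0}"
    have "\<pi> ^ j \<in> P 1" using j pi by (simp add: P_iff v_power)
    thus "c j * \<pi> ^ j \<in> P 1" using cj[of j] j by (intro P_mult_left) auto
  qed
  finally show ?thesis using that[of "c 0"] c(1) cj[of 0] q_pos by auto
qed

lemma prod_congruent:
  assumes "finite S" "\<And>i. i \<in> S \<Longrightarrow> f i - u \<in> P 1" "u \<in> P 0"
  shows "prod f S - u ^ card S \<in> P 1"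
  using assms(1,2)
proof (induction S rule: finite_induct)
  case (insert i S)
  have "prod f (insert i S) - u ^ card (insert i S) = f i * (prod f S - u ^ card S) + (f i - u) * u ^ card S"
    using insert by (simp add: algebra_simps)
  moreover have "f i \<in> P 0"
    using P_add[of "f i - u" 0 u] P_mono[of 0 1 "f i - u"] insert.prems assms(3) by simp
  hence "f i * (prod f S - u ^ card S) \<in> P 1" using insert by (intro P_mult_left) auto
  moreover have "u ^ card S * (f i - u) \<in> P 1"
    using insert assms(3) by (intro P_mult_left P_power_0) auto
  ultimately show ?case by (simp add: P_add mult.commute)
qed simp

text \<open>The norm of \<open>\<epsilon> = \<sigma> \<pi> / \<pi>\<close> is \<open>1\<close> and is congruent to \<open>u ^ q\<close>, which forces the residue \<open>u\<close> of \<open>\<epsilon>\<close> to be \<open>1\<close>.\<close>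
lemma wild:
  assumes s: "\<sigma> \<in> G" and pi: "\<pi> \<noteq> 0" "v \<pi> = 1"
  shows "\<sigma> \<pi> - \<pi> \<in> P 2"
proof -
  define \<epsilon> where "\<epsilon> = \<sigma> \<pi> / \<pi>"
  have s0: "\<sigma> \<pi> \<noteq> 0" "v (\<sigma> \<pi>) = 1" using pi s by (auto simp: gal_eq_0_iff gal_v)
  hence "\<epsilon> \<in> P 0" using pi by (simp add: \<epsilon>_def P_iff v_divide)
  then obtain u where u: "u \<in> K" "u \<in> P 0" "\<epsilon> - u \<in> P 1" by (rule residue_representative)
  have "(\<Prod>\<tau>\<in>G. \<tau> (\<sigma> \<pi>)) = (\<Prod>\<tau>\<in>G. \<tau> \<pi>)"
    using prod.reindex_bij_betw[OF gal_comp_right_bij_betw[OF s], of "\<lambda>\<tau>. \<tau> \<pi>"] by simp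
  moreover have "\<sigma> \<pi> = \<epsilon> * \<pi>" using pi by (simp add: \<epsilon>_def)
  ultimately have "(\<Prod>\<tau>\<in>G. \<tau> \<epsilon>) * (\<Prod>\<tau>\<in>G. \<tau> \<pi>) = (\<Prod>\<tau>\<in>G. \<tau> \<pi>)"
    by (simp add: gal_mult prod.distrib)
  moreover have "(\<Prod>\<tau>\<in>G. \<tau> \<pi>) \<noteq> 0" using finite_G pi by (auto simp: gal_eq_0_iff)
  ultimately have N1: "(\<Prod>\<tau>\<in>G. \<tau> \<epsilon>) = 1" by simp
  have "(\<Prod>\<tau>\<in>G. \<tau> \<epsilon>) - u ^ card G \<in> P 1"
  proof (rule prod_congruent[OF finite_G _ u(2)])
    fix \<tau> assume t: "\<tau> \<in> G"
    have "\<tau> (\<epsilon> - u) \<in> P 1" using u t by (simp add: gal_P)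
    thus "\<tau> \<epsilon> - u \<in> P 1" using u t by (simp add: gal_diff gal_fix)
  qed
  hence "1 - u ^ q \<in> P 1" by (simp add: N1 card_G)
  hence "(1 - u) ^ q \<in> P 1" by (simp add: frobenius_diff)
  have "1 - u \<in> P 1"
  proof (rule ccontr)
    assume "1 - u \<notin> P 1"
    hence "1 - u \<noteq> 0" "v (1 - u) \<le> 0" by (auto simp: ideal_pow_def)
    hence "v ((1 - u) ^ q) \<le> 0" by (simp add: v_power mult_nonneg_nonpos)
    thus False using \<open>(1 - u) ^ q \<in> P 1\<close> \<open>1 - u \<noteq> 0\<close> by (simp add: P_iff)
  qed
  with u(3) have "(\<epsilon> - u) - (1 - u) \<in> P 1" by (rule P_diff)
  hence "(\<epsilon> - 1) * \<pi> \<in> P (1 + 1)" using pi by (intro P_mult) (auto simp: P_iff)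
  moreover have "(\<epsilon> - 1) * \<pi> = \<sigma> \<pi> - \<pi>" using pi by (simp add: \<epsilon>_def field_simps)
  ultimately show ?thesis by simp
qed

text \<open>Weak ramification enters here. Integral elements are combinations of powers of
  \<open>\<pi>\<close> with integral coefficients in \<open>K\<close>, so if
  \<open>inv \<tau> \<circ> \<sigma>\<close> moves \<open>\<pi>\<close> by an element of
  \<open>P 3\<close>, it moves all of them so and lies in the trivial second ramification
  group.\<close>

lemma gal_eq_if_congruent:
  assumes s: "\<sigma> \<in> G" and t: "\<tau> \<in> G" and pi: "\<pi> \<noteq> 0" "v \<pi> = 1" and c: "\<sigma> \<pi> - \<tau> \<pi> \<in> P 3"
  shows "\<sigma> = \<tau>"
proof -
  define \<rho> where "\<rho> = inv \<tau> \<circ> \<sigma>"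
  have r: "\<rho> \<in> G" using s t by (simp add: \<rho>_def gal_comp gal_inv)
  have "\<tau> (\<rho> \<pi> - \<pi>) \<in> P 3" using c t by (simp add: \<rho>_def gal_diff gal_inv_apply)
  hence rp: "\<rho> \<pi> - \<pi> \<in> P 3" using t by (simp add: gal_P)
  have pw: "\<rho> \<pi> ^ j - \<pi> ^ j \<in> P 3" for j
  proof (induction j)
    case (Suc j)
    have "\<rho> \<pi> \<in> P 0" "\<pi> \<in> P 0" using r pi by (simp_all add: gal_P P_iff)
    hence "\<rho> \<pi> * (\<rho> \<pi> ^ j - \<pi> ^ j) + \<pi> ^ j * (\<rho> \<pi> - \<pi>) \<in> P 3"
      using Suc rp by (intro P_add P_mult_left P_power_0) auto
    thus ?case by (simp add: algebra_simps)
  qed simp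
  have "\<rho> x - x \<in> P 3" if "x \<in> P 0" for x
  proof -
    obtain d where d: "\<And>j. d j \<in> K" "x = (\<Sum>j<q. d j * \<pi> ^ j)"
      using power_expansion[of \<pi> x] pi by blast
    have "\<rho> x - x = (\<Sum>j<q. d j * (\<rho> \<pi> ^ j - \<pi> ^ j))"
      using gal_apply_expansion[OF r, of d \<pi>] d by (simp add: sum_subtractf algebra_simps)
    also have "\<dots> \<in> P 3"
      using integral_coefficients[OF pi, of d] d that pw by (intro P_sum P_mult_left) auto
    finally show ?thesis .
  qed
  hence "\<rho> \<in> ram_group2 v K" using r by (simp add: ram_group2_def)
  hence "\<rho> = id" using weak by (simp add: weakly_ramified_def)
  from fun_cong[OF this] have "inv \<tau> (\<sigma> x) = x" for x unfolding \<rho>_def by simp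
  hence "\<tau> x = \<sigma> x" for x using gal_inv_apply(1)[OF t, of "\<sigma> x"] by simp
  thus ?thesis by (intro ext) (rule sym)
qed

text \<open>The coefficient \<open>a\<close> in
  \<open>\<sigma> \<pi> = \<pi> + a * \<pi>\<^sup>2\<close> modulo \<open>P 3\<close> behaves
  additively, because replacing \<open>(\<sigma> \<pi>)\<^sup>2\<close> by
  \<open>\<pi>\<^sup>2\<close> costs
  \<open>(\<sigma> \<pi> - \<pi>) * (\<sigma> \<pi> + \<pi>)\<close>, an element of
  \<open>P 3\<close>.\<close>

lemma displacement_comp:
  assumes s: "\<sigma> \<in> G" and t: "\<tau> \<in> G" and pi: "\<pi> \<noteq> 0" "v \<pi> = 1"
    and a: "a \<in> K" "a \<in> P 0" "\<sigma> \<pi> - \<pi> - a * \<pi>\<^sup>2 \<in> P 3"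
    and b: "b \<in> K" "b \<in> P 0" "\<tau> \<pi> - \<pi> - b * \<pi>\<^sup>2 \<in> P 3"
  shows "(\<sigma> \<circ> \<tau>) \<pi> - \<pi> - (a + b) * \<pi>\<^sup>2 \<in> P 3"
proof -
  have "\<sigma> (\<tau> \<pi> - \<pi> - b * \<pi>\<^sup>2) \<in> P 3" using b s by (simp add: gal_P)
  hence 1: "\<sigma> (\<tau> \<pi>) - \<sigma> \<pi> - b * (\<sigma> \<pi>)\<^sup>2 \<in> P 3"
    using s b by (simp add: gal_diff gal_mult gal_power gal_fix)
  have "\<sigma> \<pi> + \<pi> \<in> P 1" using s pi by (intro P_add) (simp_all add: gal_P P_iff)
  hence "(\<sigma> \<pi> - \<pi>) * (\<sigma> \<pi> + \<pi>) \<in> P (2 + 1)" using wild[OF s pi] by (intro P_mult)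
  hence "b * ((\<sigma> \<pi> - \<pi>) * (\<sigma> \<pi> + \<pi>)) \<in> P 3" using P_mult_left[OF b(2)] by simp
  hence "(\<sigma> (\<tau> \<pi>) - \<sigma> \<pi> - b * (\<sigma> \<pi>)\<^sup>2) + (\<sigma> \<pi> - \<pi> - a * \<pi>\<^sup>2) + b * ((\<sigma> \<pi> - \<pi>) * (\<sigma> \<pi> + \<pi>)) \<in> P 3"
    by (rule P_add[OF P_add[OF 1 a(3)]])
  thus ?thesis by (simp add: algebra_simps power2_eq_square)
qed

lemma displacement_exists:
  assumes s: "\<sigma> \<in> G" and pi: "\<pi> \<noteq> 0" "v \<pi> = 1"
  obtains a where "a \<in> K" "a \<in> P 0" "\<sigma> \<pi> - \<pi> - a * \<pi>\<^sup>2 \<in> P 3"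
proof -
  have "(\<sigma> \<pi> - \<pi>) * inverse (\<pi>\<^sup>2) \<in> P (2 + (- 2))"
    using wild[OF s pi] pi by (intro P_mult) (auto simp: P_iff v_inverse v_power)
  hence "(\<sigma> \<pi> - \<pi>) / \<pi>\<^sup>2 \<in> P 0" by (simp add: divide_inverse)
  then obtain a where a: "a \<in> K" "a \<in> P 0" "(\<sigma> \<pi> - \<pi>) / \<pi>\<^sup>2 - a \<in> P 1" by (rule residue_representative)
  have "((\<sigma> \<pi> - \<pi>) / \<pi>\<^sup>2 - a) * \<pi>\<^sup>2 \<in> P (1 + 2)"
    using a pi by (intro P_mult) (auto simp: P_iff v_power)
  moreover have "((\<sigma> \<pi> - \<pi>) / \<pi>\<^sup>2 - a) * \<pi>\<^sup>2 = \<sigma> \<pi> - \<pi> - a * \<pi>\<^sup>2" using pi by (simp add: field_simps)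
  ultimately show ?thesis using that[of a] a by simp
qed

text \<open>Both composites have displacement \<open>a + b\<close>, and an automorphism is
  determined by its effect on \<open>\<pi>\<close> modulo \<open>P 3\<close>.\<close>

lemma gal_commute:
  assumes s: "\<sigma> \<in> G" and t: "\<tau> \<in> G"
  shows "\<sigma> \<circ> \<tau> = \<tau> \<circ> \<sigma>"
proof -
  obtain \<pi> where pi: "\<pi> \<noteq> 0" "v \<pi> = 1" by (rule ex_uniformizer)
  obtain a where a: "a \<in> K" "a \<in> P 0" "\<sigma> \<pi> - \<pi> - a * \<pi>\<^sup>2 \<in> P 3" by (rule displacement_exists[OF s pi])
  obtain b where b: "b \<in> K" "b \<in> P 0" "\<tau> \<pi> - \<pi> - b * \<pi>\<^sup>2 \<in> P 3" by (rule displacement_exists[OF t pi])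
  have "((\<sigma> \<circ> \<tau>) \<pi> - \<pi> - (a + b) * \<pi>\<^sup>2) - ((\<tau> \<circ> \<sigma>) \<pi> - \<pi> - (b + a) * \<pi>\<^sup>2) \<in> P 3"
    using displacement_comp[OF s t pi a b] displacement_comp[OF t s pi b a] by (rule P_diff)
  hence "(\<sigma> \<circ> \<tau>) \<pi> - (\<tau> \<circ> \<sigma>) \<pi> \<in> P 3" by (simp add: algebra_simps)
  thus ?thesis using gal_eq_if_congruent[OF gal_comp[OF s t] gal_comp[OF t s] pi] by blast
qed

text \<open>The displacement of the \<open>p\<close>-th iterate is \<open>p * a = 0\<close>.\<close>

lemma gal_exponent:
  assumes s: "\<sigma> \<in> G"
  shows "\<sigma> ^^ p = id"
proof -
  obtain \<pi> where pi: "\<pi> \<noteq> 0" "v \<pi> = 1" by (rule ex_uniformizer)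
  obtain a where a: "a \<in> K" "a \<in> P 0" "\<sigma> \<pi> - \<pi> - a * \<pi>\<^sup>2 \<in> P 3" by (rule displacement_exists[OF s pi])
  have "(\<sigma> ^^ k) \<pi> - \<pi> - (of_nat k * a) * \<pi>\<^sup>2 \<in> P 3" for k
  proof (induction k)
    case (Suc k)
    have "of_nat k * a \<in> K" "of_nat k * a \<in> P 0"
      using K_mult[OF K_of_nat a(1)] P_mult_left[OF P_of_nat a(2)] by auto
    from displacement_comp[OF s gal_funpow[OF s] pi a this Suc] show ?case by (simp add: algebra_simps)
  qed simp
  from this[of p] have "(\<sigma> ^^ p) \<pi> - id \<pi> \<in> P 3" using of_nat_eq_0_iff_dvd[of p] by simp
  thus ?thesis using gal_eq_if_congruent[OF gal_funpow[OF s] gal_id pi] by blast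
qed

end

section \<open>Characters of the Galois group\<close>

text \<open>The product of the powers \<open>s i ^^ a i\<close>. Exponents are natural numbers read
  modulo \<open>p\<close>, so that \<open>G\<close> is treated as a vector space over the field with
  \<open>p\<close> elements without a type for that field.\<close>

primrec comp_pow :: "(nat \<Rightarrow> 'b \<Rightarrow> 'b) \<Rightarrow> (nat \<Rightarrow> nat) \<Rightarrow> nat \<Rightarrow> 'b \<Rightarrow> 'b" where
  "comp_pow s a 0 = id"
| "comp_pow s a (Suc k) = comp_pow s a k \<circ> (s k ^^ a k)"

lemma comp_pow_cong:
  "(\<And>i. i < k \<Longrightarrow> s i = s' i) \<Longrightarrow> (\<And>i. i < k \<Longrightarrow> a i = a' i) \<Longrightarrow> comp_pow s a k = comp_pow s' a' k"
  by (induction k) auto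

lemma comp_pow_zero: "(\<And>i. i < k \<Longrightarrow> a i = 0) \<Longrightarrow> comp_pow s a k = id"
  by (induction k) auto

lemma comp_pow_unit: "j < k \<Longrightarrow> comp_pow s (\<lambda>i. of_bool (i = j)) k = s j"
proof (induction k)
  case (Suc k)
  show ?case
  proof (cases "j = k")
    case True
    hence "comp_pow s (\<lambda>i. of_bool (i = j)) k = id" by (intro comp_pow_zero) auto
    thus ?thesis using True by simp
  next
    case False
    thus ?thesis using Suc by simp
  qed
qed simp

context weak_extension
begin

lemma comp_pow_in_G: "(\<And>i. i < k \<Longrightarrow> s i \<in> G) \<Longrightarrow> comp_pow s a k \<in> G"
proof (induction k)
  case (Suc k)
  have "comp_pow s a k \<in> G" using Suc by simp
  moreover have "s k ^^ a k \<in> G" using Suc.prems[of k] by (intro gal_funpow) simp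
  ultimately show ?case unfolding comp_pow.simps by (rule gal_comp)
qed (unfold comp_pow.simps, rule gal_id)

lemma comp_pow_add:
  "(\<And>i. i < k \<Longrightarrow> s i \<in> G) \<Longrightarrow> comp_pow s a k \<circ> comp_pow s b k = comp_pow s (\<lambda>i. a i + b i) k"
proof (induction k)
  case (Suc k)
  have "s k ^^ a k \<in> G" using Suc.prems[of k] by (intro gal_funpow) simp
  moreover have "comp_pow s b k \<in> G" using Suc.prems by (intro comp_pow_in_G) simp
  ultimately have "(s k ^^ a k) \<circ> comp_pow s b k = comp_pow s b k \<circ> (s k ^^ a k)" by (rule gal_commute)
  hence "(comp_pow s a k \<circ> (s k ^^ a k)) \<circ> (comp_pow s b k \<circ> (s k ^^ b k))
     = (comp_pow s a k \<circ> comp_pow s b k) \<circ> ((s k ^^ a k) \<circ> (s k ^^ b k))"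
    by (metis comp_assoc)
  also have "comp_pow s a k \<circ> comp_pow s b k = comp_pow s (\<lambda>i. a i + b i) k"
    by (rule Suc.IH) (simp add: Suc.prems)
  finally show ?case by (simp add: funpow_add)
qed simp

lemma funpow_mod_p:
  assumes "\<sigma> \<in> G" shows "\<sigma> ^^ (a mod p) = \<sigma> ^^ a"
proof -
  have "(\<sigma> ^^ p) ^^ (a div p) = id" by (simp add: gal_exponent[OF assms] id_funpow)
  hence "\<sigma> ^^ (p * (a div p)) = id" by (simp add: funpow_mult mult.commute)
  hence "\<sigma> ^^ (p * (a div p) + a mod p) = \<sigma> ^^ (a mod p)" by (simp only: funpow_add id_comp)
  thus ?thesis by simp
qed

lemma comp_pow_mod:
  assumes "\<And>i. i < k \<Longrightarrow> s i \<in> G" "\<And>i. i < k \<Longrightarrow> [a i = b i] (mod p)"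
  shows "comp_pow s a k = comp_pow s b k"
  using assms
proof (induction k)
  case (Suc k)
  have "s k ^^ a k = s k ^^ b k"
    using funpow_mod_p[of "s k" "a k"] funpow_mod_p[of "s k" "b k"] Suc.prems(1)[of k] Suc.prems(2)[of k]
    by (simp add: cong_def)
  thus ?case using Suc by simp
qed simp

definition independent :: "(nat \<Rightarrow> 'a \<Rightarrow> 'a) \<Rightarrow> nat \<Rightarrow> bool" where
  "independent s k \<longleftrightarrow> (\<forall>i<k. s i \<in> G) \<and>
     (\<forall>a b. comp_pow s a k = comp_pow s b k \<longrightarrow> (\<forall>i<k. [a i = b i] (mod p)))"

text \<open>An equation between two products puts \<open>x ^^ d\<close> in the span, where
  \<open>d\<close> represents the difference of the exponents of \<open>x\<close>. If
  \<open>p\<close> did not divide \<open>d\<close>, raising to an inverse of \<open>d\<close> modulo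
  \<open>p\<close> would put \<open>x\<close> itself there.\<close>

lemma independent_extend:
  assumes ind: "independent s k" and x: "x \<in> G" "x \<notin> range (\<lambda>a. comp_pow s a k)"
  shows "independent (s(k := x)) (Suc k)"
proof -
  let ?s = "s(k := x)"
  have s: "s i \<in> G" if "i < k" for i using ind that by (simp add: independent_def)
  have eq: "comp_pow ?s a k = comp_pow s a k" for a by (rule comp_pow_cong) auto
  have "[a i = b i] (mod p)" if ab: "comp_pow ?s a (Suc k) = comp_pow ?s b (Suc k)" and i: "i < Suc k" for a b i
  proof -
    have e: "comp_pow s a k \<circ> (x ^^ a k) = comp_pow s b k \<circ> (x ^^ b k)" using ab by (simp add: eq)
    have xp: "x ^^ m \<in> G" for m using x(1) by (rule gal_funpow)
    have cp: "comp_pow s c k \<in> G" for c using s by (rule comp_pow_in_G)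
    \<comment> \<open>The factor \<open>p - 1\<close> plays the role of \<open>-1\<close>, since
      exponents matter only modulo \<open>p\<close>.\<close>
    have "(p - 1) * c + c = p * c" for c using p_gt_1 by (cases p) auto
    have can: "comp_pow s (\<lambda>i. (p - 1) * a i) k \<circ> comp_pow s a k = id"
    proof -
      have "comp_pow s (\<lambda>i. (p - 1) * a i) k \<circ> comp_pow s a k = comp_pow s (\<lambda>i. (p - 1) * a i + a i) k"
        using s by (rule comp_pow_add)
      also have "\<dots> = comp_pow s (\<lambda>i. 0) k"
        using \<open>\<And>c. (p - 1) * c + c = p * c\<close> s by (intro comp_pow_mod) (auto simp: cong_def)
      finally show ?thesis by (simp add: comp_pow_zero)
    qed
    define d where "d = a k + (p - 1) * b k"
    define c where "c = (\<lambda>i. (p - 1) * a i + b i)"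
    have canx: "x ^^ (b k + (p - 1) * b k) = id"
    proof -
      have "b k + (p - 1) * b k = p * b k" using p_gt_1 by (cases p) auto
      thus ?thesis using funpow_mod_p[OF x(1), of "p * b k"] by simp
    qed
    have "x ^^ d = comp_pow s (\<lambda>i. (p - 1) * a i) k \<circ> (comp_pow s a k \<circ> (x ^^ a k)) \<circ> (x ^^ ((p - 1) * b k))"
      using can by (simp add: d_def funpow_add comp_assoc[symmetric])
    also have "\<dots> = (comp_pow s (\<lambda>i. (p - 1) * a i) k \<circ> comp_pow s b k) \<circ> ((x ^^ b k) \<circ> (x ^^ ((p - 1) * b k)))"
      unfolding e by (simp only: comp_assoc)
    also have "(x ^^ b k) \<circ> (x ^^ ((p - 1) * b k)) = id" using canx by (simp only: funpow_add)
    also have "comp_pow s (\<lambda>i. (p - 1) * a i) k \<circ> comp_pow s b k = comp_pow s c k"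
      unfolding c_def using s by (rule comp_pow_add)
    finally have xd: "x ^^ d = comp_pow s c k" by simp
    have "p dvd d"
    proof (rule ccontr)
      assume "\<not> p dvd d"
      hence "coprime d p" using prime_imp_coprime[OF prime, of d] coprime_commute by blast
      then obtain e where e: "[d * e = 1] (mod p)" using cong_solve_coprime_nat[of d p] by auto
      have "(comp_pow s c k) ^^ m = comp_pow s (\<lambda>i. m * c i) k" for m
      proof (induction m)
        case 0
        show ?case by (simp add: comp_pow_zero)
      next
        case (Suc m)
        have "comp_pow s c k \<circ> comp_pow s (\<lambda>i. m * c i) k = comp_pow s (\<lambda>i. c i + m * c i) k"
          using s by (rule comp_pow_add)
        thus ?case using Suc by simp
      qed
      hence "(x ^^ d) ^^ e = comp_pow s (\<lambda>i. e * c i) k" by (simp only: xd)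
      hence "x ^^ (d * e) = comp_pow s (\<lambda>i. e * c i) k" by (simp only: funpow_mult mult.commute)
      moreover have "x ^^ (d * e) = x ^^ 1"
        using funpow_mod_p[OF x(1), of "d * e"] funpow_mod_p[OF x(1), of 1] e by (simp add: cong_def)
      ultimately have "x = comp_pow s (\<lambda>i. e * c i) k" by simp
      thus False using x(2) by blast
    qed
    have ak: "[a k = b k] (mod p)"
    proof -
      have "d + b k = a k + p * b k" using p_gt_1 unfolding d_def by (cases p) auto
      hence "[d + b k = a k] (mod p)" by (simp add: cong_def)
      moreover have "[d + b k = b k] (mod p)" using \<open>p dvd d\<close> by (auto simp: cong_def elim!: dvdE)
      ultimately show ?thesis by (meson cong_sym cong_trans)
    qed
    have "x ^^ a k = x ^^ b k"
      using funpow_mod_p[OF x(1), of "a k"] funpow_mod_p[OF x(1), of "b k"] ak by (simp add: cong_def)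
    hence "comp_pow s a k \<circ> (x ^^ a k) \<circ> inv (x ^^ a k) = comp_pow s b k \<circ> (x ^^ a k) \<circ> inv (x ^^ a k)"
      using e by simp
    hence "comp_pow s a k = comp_pow s b k"
      by (simp only: comp_assoc bij_is_surj[OF gal_bij[OF xp]] surj_iff[THEN iffD1] comp_id)
    hence "\<forall>i<k. [a i = b i] (mod p)" using ind by (simp add: independent_def)
    thus ?thesis using i ak by (auto simp: less_Suc_eq)
  qed
  moreover have "\<forall>i<Suc k. ?s i \<in> G" using s x(1) by (auto simp: less_Suc_eq)
  ultimately show ?thesis unfolding independent_def by blast
qed

lemma range_comp_pow:
  assumes "\<And>i. i < k \<Longrightarrow> s i \<in> G"
  shows "range (\<lambda>a. comp_pow s a k) = (\<lambda>a. comp_pow s a k) ` (PiE {..<k} (\<lambda>_. {..<p}))"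
proof -
  have "comp_pow s a k \<in> (\<lambda>a. comp_pow s a k) ` (PiE {..<k} (\<lambda>_. {..<p}))" for a
  proof (rule image_eqI)
    show "comp_pow s a k = comp_pow s (restrict (\<lambda>i. a i mod p) {..<k}) k"
      using assms by (intro comp_pow_mod) (auto simp: cong_def)
    show "restrict (\<lambda>i. a i mod p) {..<k} \<in> PiE {..<k} (\<lambda>_. {..<p})"
      using p_gt_1 by (intro restrict_PiE_iff[THEN iffD2]) auto
  qed
  thus ?thesis by blast
qed

text \<open>Products of powers of \<open>k < n\<close> elements take at most \<open>p ^ k\<close>
  values, fewer than \<open>card G\<close>, so a further element is available.\<close>

lemma ex_independent: "k \<le> n \<Longrightarrow> \<exists>s. independent s k"
proof (induction k)
  case 0
  show ?case by (simp add: independent_def)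
next
  case (Suc k)
  then obtain s where s: "independent s k" by auto
  have "card (range (\<lambda>a. comp_pow s a k)) \<le> card (PiE {..<k} (\<lambda>_. {..<p}))"
    using s by (subst range_comp_pow) (auto simp: independent_def intro!: card_image_le finite_PiE)
  also have "\<dots> = p ^ k" by (simp add: card_PiE)
  also have "\<dots> < card G" using Suc.prems p_gt_1 by (simp add: card_G)
  finally have "card (range (\<lambda>a. comp_pow s a k)) < card G" .
  moreover have "range (\<lambda>a. comp_pow s a k) \<subseteq> G" using s by (auto simp: independent_def intro!: comp_pow_in_G)
  ultimately obtain x where "x \<in> G" "x \<notin> range (\<lambda>a. comp_pow s a k)" by (metis nless_le subsetI subset_antisym)
  thus ?case using independent_extend[OF s] by blast
qed

text \<open>The coordinate \<open>\<chi> i\<close> is an exponent chosen for each automorphism;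
  independence determines it only modulo \<open>p\<close>, hence the congruences.\<close>

lemma dual_basis:
  obtains s \<chi> where "\<And>i. i < n \<Longrightarrow> s i \<in> G"
    and "\<And>i \<sigma> \<tau>. i < n \<Longrightarrow> \<sigma> \<in> G \<Longrightarrow> \<tau> \<in> G \<Longrightarrow> [\<chi> i (\<sigma> \<circ> \<tau>) = \<chi> i \<sigma> + \<chi> i \<tau>] (mod p)"
    and "\<And>i j. i < n \<Longrightarrow> j < n \<Longrightarrow> [\<chi> i (s j) = of_bool (i = j)] (mod p)"
proof -
  obtain s where s: "independent s n" using ex_independent[of n] by auto
  have sG: "s i \<in> G" if "i < n" for i using s that by (simp add: independent_def)
  have inj: "[a i = b i] (mod p)" if "comp_pow s a n = comp_pow s b n" "i < n" for a b i
    using s that by (auto simp: independent_def)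
  let ?A = "PiE {..<n} (\<lambda>_. {..<p})"
  have "inj_on (\<lambda>a. comp_pow s a n) ?A"
  proof (rule inj_onI)
    fix a b assume a: "a \<in> ?A" and b: "b \<in> ?A" and e: "comp_pow s a n = comp_pow s b n"
    show "a = b"
    proof (rule PiE_ext[OF a b])
      fix i assume "i \<in> {..<n}"
      thus "a i = b i" using inj[OF e, of i] PiE_mem[OF a, of i] PiE_mem[OF b, of i] by (simp add: cong_def)
    qed
  qed
  hence "card ((\<lambda>a. comp_pow s a n) ` ?A) = card G" by (simp add: card_image card_PiE card_G)
  moreover have "(\<lambda>a. comp_pow s a n) ` ?A \<subseteq> G" using sG by (auto intro!: comp_pow_in_G)
  ultimately have surj: "(\<lambda>a. comp_pow s a n) ` ?A = G" using finite_G by (simp add: card_subset_eq)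
  define e where "e \<sigma> = (SOME a. comp_pow s a n = \<sigma>)" for \<sigma>
  have e: "comp_pow s (e \<sigma>) n = \<sigma>" if "\<sigma> \<in> G" for \<sigma>
  proof -
    have "\<sigma> \<in> (\<lambda>a. comp_pow s a n) ` ?A" using that by (simp only: surj)
    hence "\<exists>a. comp_pow s a n = \<sigma>" by auto
    thus ?thesis unfolding e_def by (rule someI_ex)
  qed
  show thesis
  proof (rule that[of s "\<lambda>i \<sigma>. e \<sigma> i"])
    show "[e (\<sigma> \<circ> \<tau>) i = e \<sigma> i + e \<tau> i] (mod p)" if "i < n" "\<sigma> \<in> G" "\<tau> \<in> G" for i \<sigma> \<tau>
    proof (rule inj[OF _ that(1)])
      show "comp_pow s (e (\<sigma> \<circ> \<tau>)) n = comp_pow s (\<lambda>i. e \<sigma> i + e \<tau> i) n"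
        using comp_pow_add[of n s "e \<sigma>" "e \<tau>"] sG e[OF that(2)] e[OF that(3)] e[OF gal_comp[OF that(2,3)]] by simp
    qed
    show "[e (s j) i = of_bool (i = j)] (mod p)" if "i < n" "j < n" for i j
      using inj[of "e (s j)" "\<lambda>i. of_bool (i = j)" i] e[OF sG[OF that(2)]] comp_pow_unit[OF that(2), of s] that by simp
  qed (rule sG)
qed

text \<open>\<open>F\<close> vanishes at all conjugates of \<open>\<pi>\<close> except
  \<open>\<pi>\<close> itself, so the sum of \<open>poly F (\<sigma> \<pi>)\<close> over
  \<open>G\<close> is \<open>poly F \<pi> \<noteq> 0\<close>. Expanding by powers shows that some
  \<open>\<pi> ^ i\<close> has nonzero trace.\<close>

lemma ex_trace_nonzero: obtains y where "(\<Sum>\<sigma>\<in>G. \<sigma> y) \<noteq> 0"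
proof -
  obtain \<pi> where pi: "\<pi> \<noteq> 0" "v \<pi> = 1" by (rule ex_uniformizer)
  define F where "F = (\<Prod>\<sigma>\<in>G - {id}. [:- \<sigma> \<pi>, 1:])"
  have inj: "inj_on (\<lambda>\<sigma>. \<sigma> \<pi>) G" using inj_on_conjugates[of \<pi>] pi by blast
  have zero: "poly F (\<tau> \<pi>) = 0" if "\<tau> \<in> G" "\<tau> \<noteq> id" for \<tau>
    using that finite_G by (auto simp: F_def poly_prod)
  have "\<pi> \<noteq> \<sigma> \<pi>" if "\<sigma> \<in> G - {id}" for \<sigma>
    using inj_onD[OF inj, of \<sigma> id] that gal_id by (metis DiffE id_apply insertI1)
  hence nz: "poly F \<pi> \<noteq> 0"
    using finite_G by (auto simp: F_def poly_prod)
  have "(\<Sum>i\<le>degree F. coeff F i * (\<Sum>\<sigma>\<in>G. \<sigma> (\<pi> ^ i))) = (\<Sum>\<sigma>\<in>G. poly F (\<sigma> \<pi>))"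
    unfolding poly_altdef by (subst sum.swap) (simp add: sum_distrib_left gal_power)
  also have "\<dots> = poly F (id \<pi>)"
    using zero finite_G gal_id by (subst sum.remove[of _ id]) auto
  finally have "(\<Sum>i\<le>degree F. coeff F i * (\<Sum>\<sigma>\<in>G. \<sigma> (\<pi> ^ i))) \<noteq> 0" using nz by simp
  then obtain i where "coeff F i * (\<Sum>\<sigma>\<in>G. \<sigma> (\<pi> ^ i)) \<noteq> 0" by (rule sum.not_neutral_contains_not_neutral)
  hence "(\<Sum>\<sigma>\<in>G. \<sigma> (\<pi> ^ i)) \<noteq> 0" by (metis mult_zero_right)
  thus ?thesis by (rule that)
qed

text \<open>With \<open>t\<close> the trace of \<open>y\<close>, the weighted sum \<open>z\<close>
  satisfies \<open>\<tau> z = z - of_nat (\<chi> \<tau>) * t\<close>, which makes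
  \<open>- z / t\<close> a solution.\<close>

lemma additive_hilbert90:
  assumes "\<And>\<sigma> \<tau>. \<sigma> \<in> G \<Longrightarrow> \<tau> \<in> G \<Longrightarrow> [\<chi> (\<sigma> \<circ> \<tau>) = \<chi> \<sigma> + \<chi> \<tau>] (mod p)"
  obtains x where "\<And>\<sigma>. \<sigma> \<in> G \<Longrightarrow> \<sigma> x = x + of_nat (\<chi> \<sigma>)"
proof -
  obtain y where y: "(\<Sum>\<sigma>\<in>G. \<sigma> y) \<noteq> 0" by (rule ex_trace_nonzero)
  define t where "t = (\<Sum>\<sigma>\<in>G. \<sigma> y)"
  define z where "z = (\<Sum>\<sigma>\<in>G. of_nat (\<chi> \<sigma>) * \<sigma> y)"
  have "\<tau> (- z / t) = - z / t + of_nat (\<chi> \<tau>)" if t: "\<tau> \<in> G" for \<tau>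
  proof -
    have reindex: "(\<Sum>\<sigma>\<in>G. f (\<tau> \<circ> \<sigma>)) = (\<Sum>\<sigma>\<in>G. f \<sigma>)" for f :: "('a \<Rightarrow> 'a) \<Rightarrow> 'a"
      using sum.reindex_bij_betw[OF gal_comp_bij_betw[OF t], of f] by simp
    have tt: "\<tau> t = t"
      using reindex[of "\<lambda>\<sigma>. \<sigma> y"] by (simp add: t_def gal_sum[OF t])
    have add: "of_nat (\<chi> (\<tau> \<circ> \<sigma>)) = (of_nat (\<chi> \<tau>) + of_nat (\<chi> \<sigma>) :: 'a)" if "\<sigma> \<in> G" for \<sigma>
      using assms[OF t that] of_nat_eq_iff_cong_CHAR[where 'a = 'a, of "\<chi> (\<tau> \<circ> \<sigma>)" "\<chi> \<tau> + \<chi> \<sigma>"] char by simp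
    have "z = (\<Sum>\<sigma>\<in>G. of_nat (\<chi> (\<tau> \<circ> \<sigma>)) * (\<tau> \<circ> \<sigma>) y)" unfolding z_def by (rule reindex[symmetric])
    also have "\<dots> = (\<Sum>\<sigma>\<in>G. of_nat (\<chi> \<tau>) * (\<tau> \<circ> \<sigma>) y + of_nat (\<chi> \<sigma>) * (\<tau> \<circ> \<sigma>) y)"
      by (intro sum.cong refl) (simp add: add distrib_right)
    also have "\<dots> = of_nat (\<chi> \<tau>) * t + (\<Sum>\<sigma>\<in>G. of_nat (\<chi> \<sigma>) * \<tau> (\<sigma> y))"
      using reindex[of "\<lambda>\<sigma>. \<sigma> y"] by (simp add: sum.distrib t_def flip: sum_distrib_left)
    also have "(\<Sum>\<sigma>\<in>G. of_nat (\<chi> \<sigma>) * \<tau> (\<sigma> y)) = \<tau> z"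
      by (simp add: z_def gal_sum[OF t] gal_mult[OF t] gal_of_nat[OF t])
    finally have "\<tau> z = z - of_nat (\<chi> \<tau>) * t" by (metis add_diff_cancel_left')
    hence "\<tau> (- z / t) = (of_nat (\<chi> \<tau>) * t - z) / t"
      using tt by (simp only: gal_divide[OF t] gal_minus[OF t] minus_diff_eq)
    thus ?thesis using y by (simp add: t_def[symmetric] field_simps)
  qed
  thus thesis by (rule that)
qed

end

section \<open>Artin--Schreier generators\<close>

lemma coeff_linear_mult:
  "coeff ([:a :: 'a::field, 1:] * f) j = a * coeff f j + (case j of 0 \<Rightarrow> 0 | Suc i \<Rightarrow> coeff f i)"
  by (simp add: coeff_pCons split: nat.split)

context weak_extension
begin

lemma frobenius_p: "(x + y :: 'a) ^ p = x ^ p + y ^ p" "(x - y :: 'a) ^ p = x ^ p - y ^ p"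
  using frobenius_add[of x y 1] frobenius_diff[of x y 1] by simp_all

lemma of_nat_power_p: "(of_nat k :: 'a) ^ p = of_nat k"
  using p_gt_1 by (induction k) (simp_all add: frobenius_p power_0_left)

lemma artin_schreier_in_K:
  assumes "\<And>\<sigma>. \<sigma> \<in> G \<Longrightarrow> \<exists>k. \<sigma> x = x + of_nat k"
  shows "x ^ p - x \<in> K"
proof (rule fixed_in_K)
  fix \<sigma> assume s: "\<sigma> \<in> G"
  then obtain k where "\<sigma> x = x + of_nat k" using assms by blast
  thus "\<sigma> (x ^ p - x) = x ^ p - x"
    by (simp add: gal_diff[OF s] gal_power[OF s] frobenius_p of_nat_power_p)
qed

text \<open>Induction on the pole order. If this order, measured in units of \<open>q\<close>, is a
  multiple \<open>p * m'\<close>, perfectness of the residue field provides \<open>y * t\<close>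
  whose \<open>p\<close>-th power has the same leading term, and subtracting it from
  \<open>x\<close> lowers the pole.\<close>

lemma artin_schreier_reduce:
  assumes "x ^ p - x \<in> K"
  shows "\<exists>y\<in>K. (x - y) ^ p - (x - y) \<in> P 0 \<or>
    (\<exists>m. \<not> p dvd m \<and> (x - y) ^ p - (x - y) \<noteq> 0 \<and> v ((x - y) ^ p - (x - y)) = - (int q * int m))"
  using assms
proof (induction "nat (- v (x ^ p - x))" arbitrary: x rule: less_induct)
  case less
  define c where "c = x ^ p - x"
  show ?case
  proof (cases "c \<in> P 0")
    case True
    thus ?thesis by (intro bexI[of _ 0]) (auto simp: c_def)
  next
    case False
    hence c0: "c \<noteq> 0" "v c < 0" by (auto simp: ideal_pow_def)
    have cK: "c \<in> K" using less.prems by (simp add: c_def)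
    obtain z where z: "v c = int q * z" using v_K_dvd[OF cK c0(1)] by blast
    define m where "m = nat (- z)"
    have "z < 0" using c0 z q_pos by (simp add: mult_less_0_iff)
    hence m: "v c = - (int q * int m)" "m > 0" using z by (simp_all add: m_def)
    show ?thesis
    proof (cases "p dvd m")
      case False
      thus ?thesis using m c0 by (intro bexI[of _ 0]) (auto simp: c_def)
    next
      case True
      then obtain m' where m': "m = p * m'" by blast
      have m'0: "m' > 0" using m m' by simp
      obtain t where t: "t \<in> K" "t \<noteq> 0" "v t = - (int q * int m')"
        using ex_K_valuation[of "- (int q * int m')"] by auto
      have vtp: "v (t ^ p) = v c" using t m(1) m' by (simp add: v_power algebra_simps)
      have "c / t ^ p \<in> K \<inter> P 0" using cK t c0 vtp by (auto simp: P_iff v_divide K_divide K_power)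
      then obtain y where y: "y \<in> K" "y \<in> P 0" "y ^ p - c / t ^ p \<in> P 1"
        using perfect unfolding perfect_residue_field_def by blast
      define x' where "x' = x - y * t"
      have ytK: "y * t \<in> K" using y t by (intro K_mult)
      have "(y ^ p - c / t ^ p) * t ^ p = y ^ p * t ^ p - c" using t(2) by (simp add: left_diff_distrib)
      hence "x' ^ p - x' = y * t - (y ^ p - c / t ^ p) * t ^ p"
        by (simp add: x'_def frobenius_p power_mult_distrib c_def)
      moreover have "(y ^ p - c / t ^ p) * t ^ p \<in> P (1 + v c)"
        using y t vtp by (intro P_mult) (auto simp: P_iff)
      \<comment> \<open>The linear term has pole order at most \<open>m'\<close>, against
        \<open>p * m'\<close> with \<open>p \<ge> 2\<close>, so it does not disturb the
        cancellation.\<close>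
      moreover have "y * t \<in> P (1 + v c)"
      proof -
        have "y * t \<in> P (v t)" using y t by (intro P_mult_left) (auto simp: P_iff)
        moreover have "0 < int q * int m'" using q_pos m'0 by (intro mult_pos_pos) auto
        hence "int q * int m' \<ge> 1" by linarith
        hence "2 * (int q * int m') \<le> int p * (int q * int m')" using p_gt_1 by (intro mult_right_mono) auto
        hence "1 + v c \<le> v t" using t(3) m(1) m' \<open>int q * int m' \<ge> 1\<close> by (simp add: algebra_simps)
        ultimately show ?thesis using P_mono by blast
      qed
      ultimately have c': "x' ^ p - x' \<in> P (1 + v c)" by (simp add: P_diff)
      have "x' ^ p - x' = (x ^ p - x) - ((y * t) ^ p - y * t)" by (simp add: x'_def frobenius_p)
      hence x'K: "x' ^ p - x' \<in> K" using less.prems ytK by (simp add: K_diff K_power)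
      have "\<exists>y\<in>K. (x' - y) ^ p - (x' - y) \<in> P 0 \<or>
        (\<exists>m. \<not> p dvd m \<and> (x' - y) ^ p - (x' - y) \<noteq> 0 \<and> v ((x' - y) ^ p - (x' - y)) = - (int q * int m))"
      proof (cases "x' ^ p - x' = 0")
        case True
        thus ?thesis by (intro bexI[of _ 0]) auto
      next
        case False
        hence "1 + v c \<le> v (x' ^ p - x')" using c' by (simp add: P_iff)
        hence "nat (- v (x' ^ p - x')) < nat (- v c)" using c0 by simp
        thus ?thesis using less.hyps[of x'] x'K c_def by simp
      qed
      then obtain y' where y': "y' \<in> K" "(x' - y') ^ p - (x' - y') \<in> P 0 \<or>
        (\<exists>m. \<not> p dvd m \<and> (x' - y') ^ p - (x' - y') \<noteq> 0 \<and> v ((x' - y') ^ p - (x' - y')) = - (int q * int m))"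
        by blast
      have "x' - y' = x - (y * t + y')" by (simp add: x'_def)
      show ?thesis
        using y'(2) K_add[OF ytK y'(1)] unfolding \<open>x' - y' = x - (y * t + y')\<close> by (rule bexI)
    qed
  qed
qed

lemma artin_schreier_valuation:
  assumes "x \<notin> P 0"
  shows "x ^ p - x \<noteq> 0 \<and> v (x ^ p - x) = int p * v x"
proof (rule v_eqI)
  have x: "x \<noteq> 0" "v x < 0" using assms by (auto simp: ideal_pow_def)
  have "int p * v x \<le> 2 * v x" using p_gt_1 x by (intro mult_right_mono_neg) auto
  hence "int p * v x + 1 \<le> v x" using x by linarith
  hence "x \<in> P (int p * v x + 1)" using x by (simp add: P_iff)
  moreover have "x ^ p \<in> P (int p * v x)" "x ^ p \<notin> P (int p * v x + 1)" using x by (simp_all add: P_iff v_power)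
  ultimately show "x ^ p - x \<in> P (int p * v x)" "x ^ p - x \<notin> P (int p * v x + 1)"
    using P_diff[of "x ^ p" "int p * v x" x] P_mono[of "int p * v x" "int p * v x + 1" x]
      P_add[of "x ^ p - x" "int p * v x + 1" x] by auto
qed

section \<open>The conductor bound\<close>

lemma coeff_prod_linear_gal:
  assumes "finite S" "\<tau> \<in> G"
  shows "coeff (\<Prod>h\<in>S. [:- \<tau> (g h), 1:]) j = \<tau> (coeff (\<Prod>h\<in>S. [:- g h, 1:]) j)"
  using assms(1)
proof (induction S arbitrary: j rule: finite_induct)
  case empty
  show ?case by (simp add: gal_one[OF assms(2)] gal_zero[OF assms(2)])
next
  case (insert h S)
  show ?case
    by (simp only: prod.insert[OF insert.hyps(1,2)] coeff_linear_mult insert.IH)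
      (simp add: gal_add[OF assms(2)] gal_mult[OF assms(2)] gal_minus[OF assms(2)] gal_zero[OF assms(2)]
        gal_diff[OF assms(2)] split: nat.split)
qed

lemma coeff_prod_linear_P:
  assumes "finite S" "\<And>h. h \<in> S \<Longrightarrow> g h \<in> P 0"
  shows "coeff (\<Prod>h\<in>S. [:- g h, 1:]) j \<in> P 0"
  using assms
proof (induction S arbitrary: j rule: finite_induct)
  case empty
  show ?case by (simp add: one_in_P)
next
  case (insert h S)
  have "- g h * coeff (\<Prod>h\<in>S. [:- g h, 1:]) j \<in> P 0" using insert by (intro P_mult_left P_minus) auto
  moreover have "(case j of 0 \<Rightarrow> 0 | Suc i \<Rightarrow> coeff (\<Prod>h\<in>S. [:- g h, 1:]) i) \<in> P 0"
    using insert by (auto split: nat.split)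
  ultimately show ?case by (simp only: prod.insert[OF insert.hyps(1,2)] coeff_linear_mult) (rule P_add)
qed

context
  fixes x :: 'a and s :: "'a \<Rightarrow> 'a"
  assumes x: "\<And>\<sigma>. \<sigma> \<in> G \<Longrightarrow> \<exists>k. \<sigma> x = x + of_nat k"
    and s: "s \<in> G" and sx: "s x = x + 1"
begin

text \<open>The Galois group of the top field over \<open>K(x)\<close>.\<close>

definition stab :: "('a \<Rightarrow> 'a) set" where "stab = {\<tau>\<in>G. \<tau> x = x}"

lemma s_funpow_x: "(s ^^ k) x = x + of_nat k"
  by (induction k) (auto simp: gal_add[OF s] gal_of_nat[OF s] sx algebra_simps)

text \<open>The translates of \<open>stab\<close> by \<open>s ^^ k\<close>, \<open>k < p\<close>,
  are disjoint because \<open>s ^^ k\<close> moves \<open>x\<close> by \<open>k\<close>.\<close>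

lemma card_stab: "p * card stab \<le> q"
proof -
  have "inj_on (\<lambda>(k, h). (s ^^ k) \<circ> h) ({..<p} \<times> stab)"
  proof (rule inj_onI, clarify)
    fix k h k' h' assume *: "k < p" "k' < p" "h \<in> stab" "h' \<in> stab" "(s ^^ k) \<circ> h = (s ^^ k') \<circ> h'"
    have "(s ^^ k) (h x) = (s ^^ k') (h' x)" using *(5) by (metis comp_apply)
    hence "(of_nat k :: 'a) = of_nat k'" using *(3,4) by (simp add: stab_def s_funpow_x)
    hence "k = k'" using *(1,2) of_nat_eq_iff_cong_CHAR[where 'a = 'a, of k k'] char by (simp add: cong_def)
    moreover have "h = h'"
    proof
      fix y
      have "(s ^^ k) (h y) = (s ^^ k) (h' y)" using *(5) \<open>k = k'\<close> by (metis comp_apply)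
      thus "h y = h' y" using gal_eq_iff[OF gal_funpow[OF s]] by blast
    qed
    ultimately show "k = k' \<and> h = h'" ..
  qed
  moreover have "(\<lambda>(k, h). (s ^^ k) \<circ> h) ` ({..<p} \<times> stab) \<subseteq> G"
    using s by (auto simp: stab_def intro!: gal_comp gal_funpow)
  ultimately have "card ({..<p} \<times> stab) \<le> card G" using finite_G by (rule card_inj_on_le)
  thus ?thesis by (simp add: card_cartesian_product card_G)
qed

text \<open>\<open>G\<close> is generated by \<open>s\<close> and \<open>stab\<close>: if
  \<open>\<sigma>\<close> moves \<open>x\<close> by \<open>k\<close>, then
  \<open>(s ^^ ((p - 1) * k)) \<circ> \<sigma>\<close> moves it by \<open>p * k = 0\<close>.\<close>

lemma in_K_if_fixed:
  assumes "\<And>\<tau>. \<tau> \<in> stab \<Longrightarrow> \<tau> y = y" "s y = y"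
  shows "y \<in> K"
proof (rule fixed_in_K)
  fix \<sigma> assume \<sigma>: "\<sigma> \<in> G"
  obtain k where k: "\<sigma> x = x + of_nat k" using x[OF \<sigma>] by blast
  let ?m = "(p - 1) * k"
  have "((s ^^ ?m) \<circ> \<sigma>) x = x + of_nat (?m + k)"
    using k by (simp add: gal_add[OF gal_funpow[OF s]] gal_of_nat[OF gal_funpow[OF s]] s_funpow_x add.assoc del: of_nat_mult)
  also have "?m + k = p * k" using p_gt_1 by (cases p) auto
  also have "(of_nat (p * k) :: 'a) = 0" by (simp only: of_nat_eq_0_iff_dvd dvd_triv_left)
  finally have "(s ^^ ?m) \<circ> \<sigma> \<in> stab" using gal_comp[OF gal_funpow[OF s] \<sigma>] by (simp add: stab_def)
  hence "(s ^^ ?m) (\<sigma> y) = y" using assms(1)[of "(s ^^ ?m) \<circ> \<sigma>"] by simp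
  moreover have "(s ^^ j) y = y" for j using assms(2) by (induction j) auto
  ultimately have "(s ^^ ?m) (\<sigma> y) = (s ^^ ?m) y" by simp
  thus "\<sigma> y = y" using gal_eq_iff[OF gal_funpow[OF s]] by blast
qed

text \<open>Finite difference with respect to \<open>x\<close>, as
  \<open>s x = x + 1\<close>.\<close>

definition diff_op :: "'a \<Rightarrow> 'a" where "diff_op y = s y - y"

lemma diff_op_sum: "(diff_op ^^ k) (sum f S) = (\<Sum>i\<in>S. (diff_op ^^ k) (f i))"
  by (induction k) (simp_all add: diff_op_def gal_sum[OF s] sum_subtractf)

lemma diff_op_scale: "c \<in> K \<Longrightarrow> (diff_op ^^ k) (c * y) = c * (diff_op ^^ k) y"
  by (induction k) (simp_all add: diff_op_def gal_mult[OF s] gal_fix[OF s] right_diff_distrib)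

lemma diff_op_diff: "(diff_op ^^ k) (y - z) = (diff_op ^^ k) y - (diff_op ^^ k) z"
  by (induction k) (simp_all add: diff_op_def gal_diff[OF s])

lemma gal_diff_op: "\<tau> \<in> G \<Longrightarrow> \<tau> ((diff_op ^^ k) y) = (diff_op ^^ k) (\<tau> y)"
proof (induction k)
  case (Suc k)
  have "\<tau> (s z) = s (\<tau> z)" for z using gal_commute[OF s Suc.prems] by (metis comp_apply)
  thus ?case using Suc by (simp add: diff_op_def gal_diff)
qed simp

lemma power_shift: "(x + 1) ^ i - x ^ i = (\<Sum>j<i. of_nat (i choose j) * x ^ j)"
proof -
  have "(x + 1) ^ i = (\<Sum>j<Suc i. of_nat (i choose j) * x ^ j)"
    by (simp add: binomial_ring lessThan_Suc_atMost)
  thus ?thesis by simp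
qed

lemma diff_op_power:
  "(diff_op ^^ Suc k) (x ^ j) = (\<Sum>i<j. of_nat (j choose i) * (diff_op ^^ k) (x ^ i))"
proof -
  have "diff_op (x ^ j) = (\<Sum>i<j. of_nat (j choose i) * x ^ i)"
    by (simp add: diff_op_def gal_power[OF s] sx power_shift)
  thus ?thesis by (simp only: funpow_Suc_right comp_apply diff_op_sum diff_op_scale[OF K_of_nat])
qed

lemma diff_op_lower: "j < k \<Longrightarrow> (diff_op ^^ k) (x ^ j) = 0"
proof (induction k arbitrary: j)
  case (Suc k)
  show ?case unfolding diff_op_power using Suc by (intro sum.neutral) auto
qed simp

lemma diff_op_fact: "(diff_op ^^ k) (x ^ k) = of_nat (fact k)"
proof (induction k)
  case (Suc k)
  have "(diff_op ^^ Suc k) (x ^ Suc k) = (\<Sum>i<k. of_nat (Suc k choose i) * (diff_op ^^ k) (x ^ i))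
      + of_nat (Suc k choose k) * (diff_op ^^ k) (x ^ k)"
    unfolding diff_op_power by simp
  also have "(\<Sum>i<k. of_nat (Suc k choose i) * (diff_op ^^ k) (x ^ i)) = 0"
    using diff_op_lower by (intro sum.neutral) auto
  finally show ?case using Suc by (simp add: distrib_right)
qed simp

text \<open>In the group ring \<open>(s - 1) ^ p = s ^ p - 1 = 0\<close>. This is read off from
  Newton's formula for \<open>s ^^ k\<close> in terms of differences, whose middle binomials vanish
  at \<open>k = p\<close>.\<close>

lemma diff_op_p: "(diff_op ^^ p) y = 0"
proof -
  have "(s ^^ k) y = (\<Sum>i\<le>k. of_nat (k choose i) * (diff_op ^^ i) y)" for k
  proof (induction k)
    case (Suc k)
    let ?f = "\<lambda>i. (diff_op ^^ i) y"
    have "(s ^^ Suc k) y = (s ^^ k) y + diff_op ((s ^^ k) y)" by (simp add: diff_op_def)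
    also have "diff_op ((s ^^ k) y) = (\<Sum>i\<le>k. of_nat (k choose i) * ?f (Suc i))"
      by (simp only: Suc) (simp add: diff_op_sum[of 1, simplified] diff_op_scale[OF K_of_nat, of 1, simplified])
    also have "(s ^^ k) y = ?f 0 + (\<Sum>i\<le>k. of_nat (k choose Suc i) * ?f (Suc i))"
    proof -
      have "(s ^^ k) y = (\<Sum>i\<le>Suc k. of_nat (k choose i) * ?f i)" using Suc by (simp add: binomial_eq_0)
      thus ?thesis by (simp only: sum.atMost_Suc_shift) simp
    qed
    also have "?f 0 + (\<Sum>i\<le>k. of_nat (k choose Suc i) * ?f (Suc i)) + (\<Sum>i\<le>k. of_nat (k choose i) * ?f (Suc i))
        = (\<Sum>i\<le>Suc k. of_nat (Suc k choose i) * ?f i)"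
      by (simp only: sum.atMost_Suc_shift) (simp add: sum.distrib algebra_simps)
    finally show ?case .
  qed simp
  from this[of p] have "y = (\<Sum>i\<le>p. of_nat (p choose i) * (diff_op ^^ i) y)" by (simp add: gal_exponent[OF s])
  also have "\<dots> = (\<Sum>i\<in>{0, p}. of_nat (p choose i) * (diff_op ^^ i) y)"
  proof (intro sum.mono_neutral_right ballI)
    fix i assume "i \<in> {..p} - {0, p}"
    hence "p dvd (p choose i)" using prime by (intro dvd_choose_prime) auto
    hence "(of_nat (p choose i) :: 'a) = 0" by (simp only: of_nat_eq_0_iff_dvd)
    thus "of_nat (p choose i) * (diff_op ^^ i) y = 0" by simp
  qed auto
  also have "\<dots> = y + (diff_op ^^ p) y" using p_gt_1 by simp
  finally show ?thesis by simp
qed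

text \<open>Newton interpolation: the last nonzero difference lies in \<open>K\<close>, and
  \<open>fact k\<close> is invertible for \<open>k < p\<close>, so the leading term
  \<open>c * x ^ k\<close> can be stripped off. Together with \<open>diff_op_p\<close> this
  describes the fixed field of \<open>stab\<close> by powers of \<open>x\<close>.\<close>

lemma fixed_expansion:
  assumes "k \<le> p" "\<And>\<tau>. \<tau> \<in> stab \<Longrightarrow> \<tau> y = y" "(diff_op ^^ k) y = 0"
  shows "\<exists>b. (\<forall>i. b i \<in> K) \<and> y = (\<Sum>i<k. b i * x ^ i)"
  using assms
proof (induction k arbitrary: y)
  case 0
  thus ?case by (intro exI[of _ "\<lambda>_. 0"]) auto
next
  case (Suc k)
  define e where "e = (diff_op ^^ k) y"
  have "diff_op e = 0" using Suc.prems(3) by (simp add: e_def)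
  moreover have "\<tau> e = e" if "\<tau> \<in> stab" for \<tau>
    using that Suc.prems(2)[OF that] gal_diff_op[of \<tau> k y] by (simp add: e_def stab_def)
  ultimately have eK: "e \<in> K" by (intro in_K_if_fixed) (auto simp: diff_op_def)
  define c where "c = e / of_nat (fact k)"
  have cK: "c \<in> K" using eK K_of_nat by (simp add: c_def K_divide)
  have nz: "(of_nat (fact k) :: 'a) \<noteq> 0"
    using Suc.prems(1) prime by (simp only: of_nat_eq_0_iff_dvd prime_dvd_fact_iff)
  have st: "\<tau> (y - c * x ^ k) = y - c * x ^ k" if "\<tau> \<in> stab" for \<tau>
  proof -
    have t: "\<tau> \<in> G" "\<tau> x = x" using that by (auto simp: stab_def)
    show ?thesis using Suc.prems(2)[OF that] t cK
      by (simp add: gal_diff[OF t(1)] gal_mult[OF t(1)] gal_power[OF t(1)] gal_fix[OF t(1)])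
  qed
  have dz: "(diff_op ^^ k) (y - c * x ^ k) = 0"
  proof -
    have "(diff_op ^^ k) (y - c * x ^ k) = e - c * of_nat (fact k)"
      by (simp only: diff_op_diff diff_op_scale[OF cK] diff_op_fact e_def)
    thus ?thesis using nz by (simp add: c_def)
  qed
  obtain b where b: "\<forall>i. b i \<in> K" "y - c * x ^ k = (\<Sum>i<k. b i * x ^ i)"
    using Suc.IH[of "y - c * x ^ k"] st dz Suc.prems(1) by auto
  have "y = (\<Sum>i<Suc k. (b(k := c)) i * x ^ i)" using b(2) by (simp add: algebra_simps)
  thus ?case using b(1) cK by (intro exI[of _ "b(k := c)"]) auto
qed

text \<open>Let \<open>f\<close> be the minimal polynomial of a uniformizer \<open>\<pi>\<close> over the fixed field \<open>K(x)\<close> of the stabilizer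
  of \<open>x\<close>. Its coefficients are moved by \<open>s\<close> by elements of valuation at least \<open>e * (m + 1)\<close>, while its
  conjugate takes at \<open>\<pi>\<close> the value \<open>\<Prod>h. \<pi> - s (h \<pi>)\<close>, of valuation at most \<open>2 * e\<close> by weak ramification.\<close>
lemma conductor_bound:
  assumes n: "n > 0" and m: "\<not> p dvd m" "x ^ p - x \<noteq> 0" "v (x ^ p - x) = - (int q * int m)"
  shows "m \<le> 1"
proof -
  define e where "e = p ^ (n - 1)"
  have e0: "e > 0" using p_gt_1 by (simp add: e_def)
  have qe: "q = p * e" using n by (simp add: e_def flip: power_Suc)
  have m0: "m > 0" using m(1) by (cases m) auto
  have "v (x ^ p - x) < 0" using m(3) m0 q_pos by simp
  hence xn: "x \<notin> P 0" using m(2) P_diff[OF P_power_0[of x p], of x] by (auto simp: P_iff)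
  hence x0: "x \<noteq> 0" by auto
  have "int p * v x = int p * - (int e * int m)" using artin_schreier_valuation[OF xn] m(3) qe by simp
  hence vx: "v x = - (int e * int m)" using p_gt_1 by (simp only: mult_cancel_left) auto
  let ?B = "int e * (int m + 1)"
  \<comment> \<open>In \<open>c = (\<Sum>i<p. b i * x ^ i)\<close> the powers of \<open>x\<close>
    have valuations distinct modulo \<open>q\<close>, as \<open>p\<close> does not divide
    \<open>m\<close>, so every term is integral. For \<open>i > 0\<close> a nonzero term has as
    valuation a nonzero multiple of \<open>e\<close>, hence at least \<open>e\<close>, and passing
    from \<open>x ^ i\<close> to a lower power gains at least \<open>e * m\<close>.\<close>
  have bound: "s c - c \<in> P ?B" if c: "c \<in> P 0" "\<And>\<tau>. \<tau> \<in> stab \<Longrightarrow> \<tau> c = c" for c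
  proof -
    obtain b where b: "\<And>i. b i \<in> K" "c = (\<Sum>i<p. b i * x ^ i)"
      using fixed_expansion[of p c] c(2) diff_op_p by blast
    have term0: "b i * x ^ i \<in> P 0" if "i < p" for i
    proof (rule expansion_in_P[of "{..<p}" "\<lambda>i. x ^ i"])
      fix i j assume ij: "i \<in> {..<p}" "j \<in> {..<p}" "i \<noteq> j"
      show "\<not> int q dvd v (x ^ i) - v (x ^ j)"
      proof
        assume "int q dvd v (x ^ i) - v (x ^ j)"
        moreover have "v (x ^ i) - v (x ^ j) = int e * (int m * (int j - int i))"
          using x0 by (simp add: v_power vx algebra_simps)
        ultimately have "int p dvd int m * (int j - int i)" using qe e0 by (simp add: mult.commute)
        hence "int p dvd int m \<or> int p dvd int j - int i"
          using prime by (simp add: prime_dvd_mult_iff)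
        thus False using m(1) not_int_dvd_diff[of j p i] ij by auto
      qed
    qed (use b that c x0 in auto)
    have terme: "b i * x ^ i \<in> P (int e)" if i: "i < p" "i > 0" for i
    proof (cases "b i = 0")
      case False
      obtain z where z: "v (b i) = int q * z" using v_K_dvd[OF b(1) False] by blast
      have vz: "v (b i * x ^ i) = int e * (int p * z - int i * int m)"
        using False x0 by (simp add: v_mult v_power vx z qe algebra_simps)
      have "\<not> p dvd i * m" using m(1) i prime by (auto simp: prime_dvd_mult_iff dest: dvd_imp_le)
      hence "int p * z - int i * int m \<noteq> 0"
        by (metis dvd_triv_left eq_iff_diff_eq_0 of_nat_dvd_iff of_nat_mult)
      moreover have "int e * (int p * z - int i * int m) \<ge> 0"
        using term0[OF i(1)] False x0 by (simp add: P_iff vz)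
      hence "int p * z - int i * int m \<ge> 0" using e0 by (simp add: zero_le_mult_iff)
      ultimately have "int p * z - int i * int m \<ge> 1" by simp
      hence "int e * 1 \<le> int e * (int p * z - int i * int m)" by (intro mult_left_mono) auto
      thus ?thesis using False x0 by (simp add: P_iff vz)
    qed simp
    have "s c - c = (\<Sum>i<p. b i * ((x + 1) ^ i - x ^ i))"
      using b by (simp add: gal_sum[OF s] gal_mult[OF s] gal_power[OF s] gal_fix[OF s] sx sum_subtractf algebra_simps)
    also have "\<dots> \<in> P ?B"
    proof (rule P_sum)
      fix i assume i: "i \<in> {..<p}"
      have "b i * x ^ j \<in> P ?B" if j: "j < i" for j
      proof -
        have "inverse x ^ (i - j) \<in> P (int e * int m)"
        proof -
          have "int e * int m * 1 \<le> int e * int m * int (i - j)" using j by (intro mult_left_mono) auto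
          thus ?thesis using x0 by (simp add: P_iff v_power v_inverse vx mult.commute)
        qed
        hence "(b i * x ^ i) * inverse x ^ (i - j) \<in> P (int e + int e * int m)"
          using terme[of i] i j by (intro P_mult) auto
        moreover have "x ^ i * inverse x ^ (i - j) = x ^ j"
        proof -
          have "x ^ i = x ^ j * x ^ (i - j)" using j by (simp flip: power_add)
          thus ?thesis using x0 by (simp add: power_inverse)
        qed
        ultimately show ?thesis by (simp add: mult.assoc algebra_simps)
      qed
      hence "(\<Sum>j<i. of_nat (i choose j) * (b i * x ^ j)) \<in> P ?B"
        by (intro P_sum P_mult_left[OF P_of_nat]) auto
      thus "b i * ((x + 1) ^ i - x ^ i) \<in> P ?B"
        by (simp add: power_shift sum_distrib_left mult_ac)
    qed
    finally show ?thesis .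
  qed
  obtain \<pi> where pi: "\<pi> \<noteq> 0" "v \<pi> = 1" by (rule ex_uniformizer)
  have fin: "finite stab" using finite_G by (simp add: stab_def)
  have idst: "id \<in> stab" using gal_id by (auto simp: stab_def)
  define f where "f = (\<Prod>h\<in>stab. [:- h \<pi>, 1:])"
  define f' where "f' = (\<Prod>h\<in>stab. [:- s (h \<pi>), 1:])"
  have cf': "coeff f' j = s (coeff f j)" for j
    unfolding f_def f'_def by (rule coeff_prod_linear_gal[OF fin s])
  have cP: "coeff f j \<in> P 0" for j
    unfolding f_def using pi by (intro coeff_prod_linear_P[OF fin]) (auto simp: stab_def gal_P P_iff)
  \<comment> \<open>\<open>stab\<close> is closed under composition, so \<open>\<tau>\<close>
    permutes the roots of \<open>f\<close>.\<close>
  have cfix: "\<tau> (coeff f j) = coeff f j" if "\<tau> \<in> stab" for \<tau> j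
  proof -
    have t: "\<tau> \<in> G" using that by (simp add: stab_def)
    have sub: "(\<lambda>h. \<tau> \<circ> h) ` stab \<subseteq> stab" using that by (auto simp: stab_def gal_comp)
    have inj: "inj_on (\<lambda>h. \<tau> \<circ> h) stab"
      using bij_betw_imp_inj_on[OF gal_comp_bij_betw[OF t]] by (rule inj_on_subset) (auto simp: stab_def)
    have "bij_betw (\<lambda>h. \<tau> \<circ> h) stab stab"
      using inj endo_inj_surj[OF fin sub inj] by (simp add: bij_betw_def)
    hence "(\<Prod>h\<in>stab. [:- (\<tau> \<circ> h) \<pi>, 1:]) = f"
      unfolding f_def by (rule prod.reindex_bij_betw)
    thus ?thesis using coeff_prod_linear_gal[OF fin t, of "\<lambda>h. h \<pi>" j] by (simp add: f_def)
  qed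
  have "poly f \<pi> = 0" using fin idst unfolding f_def poly_prod by (intro prod_zero) (auto intro!: bexI[of _ id])
  hence "poly f' \<pi> = poly (f' - f) \<pi>" by simp
  also have "\<dots> = (\<Sum>j\<le>degree (f' - f). \<pi> ^ j * (s (coeff f j) - coeff f j))"
    by (simp add: poly_altdef cf' mult.commute)
  also have "\<dots> \<in> P ?B"
    using pi bound cP cfix by (intro P_sum P_mult_left P_power_0) (auto simp: P_iff)
  finally have inB: "poly f' \<pi> \<in> P ?B" .
  \<comment> \<open>\<open>s \<circ> h\<close> moves \<open>x\<close>, so it is not the identity,
    and weak ramification limits how close \<open>s (h \<pi>)\<close> is to
    \<open>\<pi>\<close>.\<close>
  have factor: "\<pi> - s (h \<pi>) \<noteq> 0 \<and> v (\<pi> - s (h \<pi>)) \<le> 2" if "h \<in> stab" for h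
  proof -
    have h: "h \<in> G" "h x = x" using that by (auto simp: stab_def)
    have "id \<noteq> s \<circ> h"
    proof
      assume "id = s \<circ> h"
      hence "x = s (h x)" by (metis comp_apply id_apply)
      thus False using h sx by simp
    qed
    hence "\<pi> - s (h \<pi>) \<notin> P 3"
      using gal_eq_if_congruent[OF gal_id gal_comp[OF s h(1)] pi] by auto
    thus ?thesis by (auto simp: ideal_pow_def)
  qed
  have "poly f' \<pi> \<noteq> 0 \<and> v (poly f' \<pi>) \<le> 2 * int (card stab)"
  proof -
    have "prod g S \<noteq> 0 \<and> v (prod g S) \<le> 2 * int (card S)"
      if "finite S" "\<And>h. h \<in> S \<Longrightarrow> g h \<noteq> 0 \<and> v (g h) \<le> 2" for g and S :: "('a \<Rightarrow> 'a) set"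
      using that by (induction S rule: finite_induct) (auto simp: v_one v_mult algebra_simps, fastforce)
    from this[OF fin, of "\<lambda>h. \<pi> - s (h \<pi>)"] factor show ?thesis
      by (simp add: f'_def poly_prod)
  qed
  hence "?B \<le> 2 * int (card stab)" using inB by (auto simp: P_iff)
  moreover have "card stab \<le> e" using card_stab qe p_gt_1 by simp
  ultimately have "int e * (int m + 1) \<le> int e * 2" by simp
  thus ?thesis using e0 by simp
qed

end

lemma ex_artin_schreier_generator:
  assumes n: "n > 0" and s: "s \<in> G" "[\<chi> s = 1] (mod p)"
    and \<chi>: "\<And>\<sigma> \<tau>. \<sigma> \<in> G \<Longrightarrow> \<tau> \<in> G \<Longrightarrow> [\<chi> (\<sigma> \<circ> \<tau>) = \<chi> \<sigma> + \<chi> \<tau>] (mod p)"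
  obtains x where "\<And>\<sigma>. \<sigma> \<in> G \<Longrightarrow> \<sigma> x = x + of_nat (\<chi> \<sigma>)"
    and "x ^ p - x \<in> K" "x ^ p - x \<in> P (- int q)"
proof -
  obtain x0 where x0: "\<And>\<sigma>. \<sigma> \<in> G \<Longrightarrow> \<sigma> x0 = x0 + of_nat (\<chi> \<sigma>)"
    using additive_hilbert90[of \<chi>] \<chi> by blast
  have "x0 ^ p - x0 \<in> K" using x0 by (intro artin_schreier_in_K) blast
  from artin_schreier_reduce[OF this] obtain y where y: "y \<in> K" "(x0 - y) ^ p - (x0 - y) \<in> P 0 \<or>
    (\<exists>m. \<not> p dvd m \<and> (x0 - y) ^ p - (x0 - y) \<noteq> 0 \<and> v ((x0 - y) ^ p - (x0 - y)) = - (int q * int m))" by blast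
  define x where "x = x0 - y"
  have gx: "\<sigma> x = x + of_nat (\<chi> \<sigma>)" if "\<sigma> \<in> G" for \<sigma>
    using that x0 y by (simp add: x_def gal_diff gal_fix)
  have "(of_nat (\<chi> s) :: 'a) = of_nat 1"
    using s(2) of_nat_eq_iff_cong_CHAR[where 'a = 'a, of "\<chi> s" 1] char by simp
  hence sx: "s x = x + 1" using gx[OF s(1)] by simp
  have "x ^ p - x \<in> P (- int q)"
  proof (cases "x ^ p - x \<in> P 0")
    case True
    thus ?thesis by (rule P_mono[rotated]) simp
  next
    case False
    then obtain m where m: "\<not> p dvd m" "x ^ p - x \<noteq> 0" "v (x ^ p - x) = - (int q * int m)"
      using y(2) by (auto simp: x_def)
    have "m \<le> 1" using gx conductor_bound[OF _ s(1) sx n m] by blast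
    hence "int q * int m \<le> int q * 1" by (intro mult_left_mono) auto
    thus ?thesis using m by (simp add: P_iff)
  qed
  moreover have "x ^ p - x \<in> K" using gx by (intro artin_schreier_in_K) blast
  ultimately show thesis using gx that by blast
qed

section \<open>Construction of \<open>Y\<close>\<close>

lemma perfect_power:
  assumes "x \<in> K" "x \<in> P 0"
  shows "\<exists>g\<in>K. g \<in> P 0 \<and> g ^ (p ^ k) - x \<in> P 1"
  using assms
proof (induction k arbitrary: x)
  case 0
  thus ?case by (intro bexI[of _ x]) auto
next
  case (Suc k)
  obtain y where y: "y \<in> K" "y \<in> P 0" "y ^ p - x \<in> P 1"
    using perfect Suc.prems unfolding perfect_residue_field_def by blast
  obtain g where g: "g \<in> K" "g \<in> P 0" "g ^ (p ^ k) - y \<in> P 1" using Suc.IH[OF y(1,2)] by blast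
  have "(g ^ (p ^ k) - y) ^ p \<in> P (int p * 1)" using g by (intro P_power)
  hence "(g ^ (p ^ k) - y) ^ p \<in> P 1" by (rule P_mono[rotated]) (use p_gt_1 in simp)
  hence "g ^ (p ^ Suc k) - y ^ p \<in> P 1" by (simp add: frobenius_p mult.commute flip: power_mult)
  from P_add[OF this y(3)] show ?case using g by (intro bexI[of _ g]) auto
qed

text \<open>Iteration of \<open>x ^ p = x + c\<close>: high powers of \<open>x\<close> are expressed
  by \<open>x\<close> and Frobenius powers of \<open>c\<close>.\<close>

lemma iterated_artin_schreier:
  fixes x :: 'a
  shows "x ^ (p ^ k) = x + (\<Sum>j<k. (x ^ p - x) ^ (p ^ j))"
proof (induction k)
  case (Suc k)
  have "x ^ (p ^ Suc k) = (x + (x ^ p - x)) ^ (p ^ k)" by (simp add: power_mult)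
  also have "\<dots> = x ^ (p ^ k) + (x ^ p - x) ^ (p ^ k)" by (rule frobenius_add)
  finally show ?case using Suc by simp
qed simp

lemma ex_scaffold_generator:
  obtains Y where "Y \<noteq> 0" "v Y = - 1" "\<And>\<sigma>. \<sigma> \<in> G \<Longrightarrow> \<sigma> Y - Y \<in> K"
proof (cases "n = 0")
  case True
  obtain \<pi> where pi: "\<pi> \<noteq> 0" "v \<pi> = 1" by (rule ex_uniformizer)
  \<comment> \<open>For \<open>n = 0\<close> the group is trivial and any element of valuation
    \<open>-1\<close> serves.\<close>
  have "card G = 1" using card_G True by simp
  hence G: "G = {id}" using gal_id by (metis card_1_singletonE singletonD)
  show thesis
    by (rule that[of "inverse \<pi>"]) (use pi G in \<open>auto simp: v_inverse\<close>)
next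
  case False
  hence n: "n > 0" by simp
  define N where "N = n - 1"
  have qN: "q = p * p ^ N" using n by (simp add: N_def flip: power_Suc)
  obtain s \<chi> where sG: "\<And>i. i < n \<Longrightarrow> s i \<in> G"
    and add: "\<And>i \<sigma> \<tau>. i < n \<Longrightarrow> \<sigma> \<in> G \<Longrightarrow> \<tau> \<in> G \<Longrightarrow> [\<chi> i (\<sigma> \<circ> \<tau>) = \<chi> i \<sigma> + \<chi> i \<tau>] (mod p)"
    and dual: "\<And>i j. i < n \<Longrightarrow> j < n \<Longrightarrow> [\<chi> i (s j) = of_bool (i = j)] (mod p)"
    by (rule dual_basis) blast
  have "\<exists>x. (\<forall>\<sigma>\<in>G. \<sigma> x = x + of_nat (\<chi> i \<sigma>)) \<and> x ^ p - x \<in> K \<and> x ^ p - x \<in> P (- int q)" if "i < n" for i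
    using ex_artin_schreier_generator[OF n sG[OF that], of "\<chi> i"] dual[OF that that] add[OF that] by (metis of_bool_eq(2))
  then obtain x where gx: "\<And>i \<sigma>. i < n \<Longrightarrow> \<sigma> \<in> G \<Longrightarrow> \<sigma> (x i) = x i + of_nat (\<chi> i \<sigma>)"
    and cK: "\<And>i. i < n \<Longrightarrow> x i ^ p - x i \<in> K" and cP: "\<And>i. i < n \<Longrightarrow> x i ^ p - x i \<in> P (- int q)"
    by metis
  have xP: "x i \<in> P (- int (p ^ N))" if i: "i < n" for i
  proof (cases "x i \<in> P 0")
    case True
    thus ?thesis by (rule P_mono[rotated]) simp
  next
    case False
    have "x i \<noteq> 0" using False by auto
    have "int p * - int (p ^ N) \<le> int p * v (x i)"
      using cP[OF i] artin_schreier_valuation[OF False] qN by (simp add: P_iff)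
    hence "- int (p ^ N) \<le> v (x i)" using p_gt_1 by (simp only: mult_le_cancel_left)
    thus ?thesis using \<open>x i \<noteq> 0\<close> by (simp add: P_iff)
  qed
  obtain t where t: "t \<in> K" "t \<noteq> 0" "v t = int q" using ex_K_valuation[of "int q"] by auto
  have "\<exists>g\<in>K. g \<in> P 0 \<and> g ^ (p ^ N) - (x i ^ p - x i) * t \<in> P 1" if "i < n" for i
  proof (rule perfect_power)
    show "(x i ^ p - x i) * t \<in> K" using cK[OF that] t by (intro K_mult)
    have "(x i ^ p - x i) * t \<in> P (- int q + int q)" using cP[OF that] t by (intro P_mult) (auto simp: P_iff)
    thus "(x i ^ p - x i) * t \<in> P 0" by simp
  qed
  then obtain g where gK: "\<And>i. i < n \<Longrightarrow> g i \<in> K" and gP: "\<And>i. i < n \<Longrightarrow> g i ^ (p ^ N) - (x i ^ p - x i) * t \<in> P 1"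
    by metis
  define \<delta> where "\<delta> i = (x i ^ p - x i) - g i ^ (p ^ N) / t" for i
  have \<delta>P: "\<delta> i \<in> P 0" if i: "i < n" for i
  proof -
    have "(x i ^ p - x i) * t - g i ^ (p ^ N) \<in> P (int q * 1)"
    proof (rule K_P_ceiling)
      show "(x i ^ p - x i) * t - g i ^ (p ^ N) \<in> K" using cK[OF i] gK[OF i] t(1) by (intro K_diff[OF K_mult K_power])
      show "(x i ^ p - x i) * t - g i ^ (p ^ N) \<in> P 1" using gP[OF i] by (rule P_diff_commute)
    qed simp
    hence "((x i ^ p - x i) * t - g i ^ (p ^ N)) * inverse t \<in> P (int q * 1 + - int q)"
      using t by (intro P_mult) (auto simp: P_iff v_inverse)
    moreover have "((x i ^ p - x i) * t - g i ^ (p ^ N)) * inverse t = \<delta> i"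
      using t by (simp add: \<delta>_def field_simps)
    ultimately show ?thesis by simp
  qed
  \<comment> \<open>There are \<open>n - 1\<close> equations for \<open>n\<close> weights, so a
    nontrivial solution exists.\<close>
  have cN: "card {..<N} < card {..<n}" using n by (simp add: N_def)
  have AK: "g i ^ (p ^ j) \<in> K" if "i \<in> {..<n}" "j \<in> {..<N}" for i j using gK that by (intro K_power) simp
  obtain w0 where w0: "\<And>i. w0 i \<in> K" "\<exists>i\<in>{..<n}. w0 i \<noteq> 0"
    "\<And>j. j \<in> {..<N} \<Longrightarrow> (\<Sum>i\<in>{..<n}. w0 i * g i ^ (p ^ j)) = 0"
  proof (rule homogeneous_system_nontrivial[OF finite_lessThan finite_lessThan cN AK])
    fix c
    assume "\<And>i. c i \<in> K" "\<exists>i\<in>{..<n}. c i \<noteq> 0" "\<And>j. j \<in> {..<N} \<Longrightarrow> (\<Sum>i\<in>{..<n}. c i * g i ^ (p ^ j)) = 0"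
    thus thesis by (rule that)
  qed
  \<comment> \<open>Scaling makes the weights integral with one of them, \<open>w k\<close>, equal
    to \<open>1\<close>; this is what yields \<open>s k Y - Y = 1\<close>.\<close>
  obtain d where d: "d \<in> K" "d \<noteq> 0" "\<And>i. i < n \<Longrightarrow> d * w0 i \<in> P 0" "\<exists>i\<in>{..<n}. d * w0 i = 1"
    using primitive_scaling[of "{..<n}" w0] w0 by auto
  define w where "w i = d * w0 i" for i
  have wK: "w i \<in> K" for i using w0 d by (simp add: w_def K_mult)
  have wP: "w i \<in> P 0" if "i < n" for i using d(3)[OF that] by (simp add: w_def)
  have w_sys: "(\<Sum>i<n. w i * g i ^ (p ^ j)) = 0" if "j < N" for j
    using w0(3)[of j] that by (simp add: w_def mult.assoc flip: sum_distrib_left)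
  define Y where "Y = (\<Sum>i<n. w i * x i)"
  have gY: "\<sigma> Y - Y = (\<Sum>i<n. w i * of_nat (\<chi> i \<sigma>))" if "\<sigma> \<in> G" for \<sigma>
  proof -
    have "\<sigma> Y = (\<Sum>i<n. w i * x i + w i * of_nat (\<chi> i \<sigma>))"
      unfolding Y_def gal_sum[OF that] by (intro sum.cong refl)
        (simp add: gal_mult[OF that] gal_fix[OF that wK] gx[OF _ that] distrib_left)
    thus ?thesis by (simp add: Y_def sum.distrib)
  qed
  \<comment> \<open>In this power the large poles appear as
    \<open>(\<Sum>i<n. w i * g i ^ (p ^ j)) ^ (p ^ N) / t ^ (p ^ j)\<close>, which the equations for
    \<open>w\<close> annihilate. Only the poles of the \<open>x i\<close>, of order at most
    \<open>p ^ N\<close>, remain.\<close>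
  have "Y ^ (p ^ N) = (\<Sum>i<n. w i ^ (p ^ N) * x i ^ (p ^ N))"
    by (simp add: Y_def frobenius_sum power_mult_distrib)
  also have "\<dots> = (\<Sum>i<n. w i ^ (p ^ N) * x i) + (\<Sum>j<N. \<Sum>i<n. w i ^ (p ^ N) * (x i ^ p - x i) ^ (p ^ j))"
    by (subst sum.swap) (simp add: iterated_artin_schreier[of _ N] distrib_left sum.distrib sum_distrib_left)
  also have "\<dots> \<in> P (- int (p ^ N))"
  proof (intro P_add[OF P_sum P_sum])
    fix i assume "i \<in> {..<n}"
    thus "w i ^ (p ^ N) * x i \<in> P (- int (p ^ N))" using wP xP by (intro P_mult_left P_power_0) auto
  next
    fix j assume j: "j \<in> {..<N}"
    have ci: "(x i ^ p - x i) ^ (p ^ j) = (g i ^ (p ^ j)) ^ (p ^ N) / t ^ (p ^ j) + \<delta> i ^ (p ^ j)" for i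
    proof -
      have "(x i ^ p - x i) = g i ^ (p ^ N) / t + \<delta> i" by (simp add: \<delta>_def)
      hence "(x i ^ p - x i) ^ (p ^ j) = (g i ^ (p ^ N) / t) ^ (p ^ j) + \<delta> i ^ (p ^ j)"
        using frobenius_add[of "g i ^ (p ^ N) / t" "\<delta> i" j] by simp
      thus ?thesis by (simp add: power_divide mult.commute flip: power_mult)
    qed
    have "(\<Sum>i<n. w i ^ (p ^ N) * (x i ^ p - x i) ^ (p ^ j))
        = (\<Sum>i<n. (w i * g i ^ (p ^ j)) ^ (p ^ N)) / t ^ (p ^ j) + (\<Sum>i<n. w i ^ (p ^ N) * \<delta> i ^ (p ^ j))"
      by (simp add: ci distrib_left sum.distrib power_mult_distrib sum_divide_distrib)
    also have "(\<Sum>i<n. (w i * g i ^ (p ^ j)) ^ (p ^ N)) = (\<Sum>i<n. w i * g i ^ (p ^ j)) ^ (p ^ N)"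
      by (rule frobenius_sum[symmetric])
    also have "\<dots> = 0" using w_sys[of j] j p_gt_1 by (simp add: power_0_left)
    also have "0 / t ^ (p ^ j) + (\<Sum>i<n. w i ^ (p ^ N) * \<delta> i ^ (p ^ j)) \<in> P 0"
      using wP \<delta>P by (simp, intro P_sum P_mult_left P_power_0) auto
    finally show "(\<Sum>i<n. w i ^ (p ^ N) * (x i ^ p - x i) ^ (p ^ j)) \<in> P (- int (p ^ N))"
      by (rule P_mono[rotated]) simp
  qed
  finally have "Y ^ (p ^ N) \<in> P (int (p ^ N) * (- 1))" by simp
  hence YP: "Y \<in> P (- 1)" using p_gt_1 by (subst (asm) P_power_iff) auto
  obtain k where k: "k < n" "w k = 1" using d(4) by (auto simp: w_def)
  have "s k Y - Y = (\<Sum>i<n. w i * of_bool (i = k))"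
  proof -
    have "(of_nat (\<chi> i (s k)) :: 'a) = of_bool (i = k)" if "i < n" for i
      using dual[OF that k(1)] of_nat_eq_iff_cong_CHAR[where 'a = 'a, of "\<chi> i (s k)" "of_bool (i = k)"] char by simp
    thus ?thesis using gY[OF sG[OF k(1)]] by simp
  qed
  also have "\<dots> = (\<Sum>i<n. if i = k then w i else 0)" by (intro sum.cong) auto
  also have "\<dots> = 1" using k by simp
  finally have sY: "s k Y - Y = 1" .
  \<comment> \<open>An integral \<open>Y\<close> would be congruent modulo \<open>P 1\<close> to an
    element of \<open>K\<close>, and \<open>s k Y - Y\<close> would lie in \<open>P 1\<close>
    instead of being \<open>1\<close>.\<close>
  have "Y \<notin> P 0"
  proof
    assume "Y \<in> P 0"
    then obtain c where c: "c \<in> K" "Y - c \<in> P 1" by (rule residue_representative)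
    have "s k (Y - c) - (Y - c) \<in> P 1" using c(2) sG[OF k(1)] by (intro P_diff[of "s k (Y - c)" 1 "Y - c"]) (simp_all only: gal_P)
    hence "s k Y - Y \<in> P 1" using c sG[OF k(1)] by (simp add: gal_diff gal_fix)
    thus False by (simp add: sY one_in_P)
  qed
  hence "Y \<noteq> 0 \<and> v Y = - 1" using v_eqI[OF YP] by simp
  moreover have "\<sigma> Y - Y \<in> K" if "\<sigma> \<in> G" for \<sigma>
    unfolding gY[OF that] using wK by (intro K_sum K_mult K_of_nat)
  ultimately show thesis using that by blast
qed

end

section \<open>Coordinates of the group algebra\<close>

text \<open>The inverse of \<open>c\<close> for binomial convolution, solved degree by degree.
  Binomial convolution is the product of the group algebra in the coordinates
  \<open>coord\<close>.\<close>

fun inverse_seq :: "(nat \<Rightarrow> 'a::field) \<Rightarrow> nat \<Rightarrow> 'a" where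
  "inverse_seq c k = (of_bool (k = 0) - (\<Sum>i<k. of_nat (k choose i) * c (k - i) * inverse_seq c i)) / c 0"

declare inverse_seq.simps [simp del]

lemma inverse_seq:
  assumes "c 0 \<noteq> 0"
  shows "(\<Sum>i\<le>k. of_nat (k choose i) * c i * inverse_seq c (k - i)) = of_bool (k = 0)"
proof -
  have sym: "k choose (k - i) = k choose i" if "i \<le> k" for i
    using binomial_symmetric[OF that] by simp
  have "(\<Sum>i\<le>k. of_nat (k choose i) * c i * inverse_seq c (k - i))
      = (\<Sum>i\<le>k. of_nat (k choose i) * c (k - i) * inverse_seq c i)"
    by (rule sum.reindex_bij_witness[of _ "\<lambda>i. k - i" "\<lambda>i. k - i"]) (auto simp: sym)
  also have "\<dots> = (\<Sum>i<k. of_nat (k choose i) * c (k - i) * inverse_seq c i) + c 0 * inverse_seq c k"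
    by (simp flip: lessThan_Suc_atMost)
  also have "c 0 * inverse_seq c k = of_bool (k = 0) - (\<Sum>i<k. of_nat (k choose i) * c (k - i) * inverse_seq c i)"
    using assms by (subst inverse_seq.simps) simp
  finally show ?thesis by simp
qed

locale scaffold = weak_extension v K p n for v :: "'a::field \<Rightarrow> int" and K p n +
  fixes Y :: 'a
  assumes Y0: "Y \<noteq> 0" and vY: "v Y = - 1" and uK: "\<And>\<sigma>. \<sigma> \<in> galois_group K \<Longrightarrow> \<sigma> Y - Y \<in> K"
begin

definition u :: "('a \<Rightarrow> 'a) \<Rightarrow> 'a" where "u \<sigma> = \<sigma> Y - Y"

lemma u_in_K: "\<sigma> \<in> G \<Longrightarrow> u \<sigma> \<in> K"
  using uK by (simp add: u_def)

lemma gal_Y: "\<sigma> Y = Y + u \<sigma>"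
  by (simp add: u_def)

lemma u_comp: "\<sigma> \<in> G \<Longrightarrow> \<tau> \<in> G \<Longrightarrow> u (\<sigma> \<circ> \<tau>) = u \<sigma> + u \<tau>"
  using gal_fix[of \<sigma> K "u \<tau>"] u_in_K[of \<tau>] by (simp add: u_def gal_diff algebra_simps)

lemma u_id: "u id = 0"
  by (simp add: u_def)

lemma u_inj: "inj_on u G"
proof (rule inj_onI)
  fix \<sigma> \<tau> assume "\<sigma> \<in> G" "\<tau> \<in> G" "u \<sigma> = u \<tau>"
  thus "\<sigma> = \<tau>" using gal_determined[OF Y0] vY by (simp add: u_def)
qed

text \<open>Interpolation polynomial with value \<open>1\<close> at \<open>u \<tau>\<close> and
  \<open>0\<close> at the other nodes; the coefficients form the inverse of the Vandermonde matrix
  of the nodes.\<close>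

definition lagrange :: "('a \<Rightarrow> 'a) \<Rightarrow> 'a poly" where
  "lagrange \<tau> = smult (inverse (\<Prod>\<rho>\<in>G - {\<tau>}. u \<tau> - u \<rho>)) (\<Prod>\<rho>\<in>G - {\<tau>}. [:- u \<rho>, 1:])"

lemma degree_lagrange: "\<tau> \<in> G \<Longrightarrow> degree (lagrange \<tau>) < q"
proof -
  assume t: "\<tau> \<in> G"
  have "degree (lagrange \<tau>) \<le> degree (\<Prod>\<rho>\<in>G - {\<tau>}. [:- u \<rho>, 1:])"
    unfolding lagrange_def by (rule degree_smult_le)
  also have "\<dots> \<le> (\<Sum>\<rho>\<in>G - {\<tau>}. degree [:- u \<rho>, 1:])"
    by (rule degree_prod_sum_le[unfolded comp_def]) (use finite_G in simp)
  also have "\<dots> = card G - 1" using t finite_G by simp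
  finally show ?thesis using q_pos card_G by linarith
qed

lemma poly_lagrange:
  assumes "\<tau> \<in> G" "\<sigma> \<in> G"
  shows "poly (lagrange \<tau>) (u \<sigma>) = of_bool (\<sigma> = \<tau>)"
proof (cases "\<sigma> = \<tau>")
  case True
  have "(\<Prod>\<rho>\<in>G - {\<tau>}. u \<tau> - u \<rho>) \<noteq> 0"
    using finite_G u_inj assms by (auto simp: inj_on_def)
  thus ?thesis using True by (simp add: lagrange_def poly_prod)
next
  case False
  hence "(\<Prod>\<rho>\<in>G - {\<tau>}. poly [:- u \<rho>, 1:] (u \<sigma>)) = 0"
    using finite_G assms by (intro prod_zero) auto
  thus ?thesis using False by (simp add: lagrange_def poly_prod)
qed

lemma coeff_lagrange_in_K: "\<tau> \<in> G \<Longrightarrow> coeff (lagrange \<tau>) j \<in> K"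
proof -
  assume t: "\<tau> \<in> G"
  have "coeff (\<Prod>\<rho>\<in>S. [:- u \<rho>, 1:]) j \<in> K" if "finite S" "S \<subseteq> G" for S j
    using that
  proof (induction S arbitrary: j rule: finite_induct)
    case (insert \<rho> S)
    show ?case unfolding prod.insert[OF insert.hyps] coeff_linear_mult
      using insert by (intro K_add K_mult K_minus u_in_K) (auto split: nat.split)
  qed simp
  from this[of "G - {\<tau>}"] show ?thesis
    unfolding lagrange_def using t finite_G by (auto intro!: K_mult K_inverse K_prod K_diff u_in_K)
qed

lemma sum_coeff_poly:
  assumes "degree (f :: 'a poly) < q" shows "poly f x = (\<Sum>j<q. coeff f j * x ^ j)"
proof -
  have "poly f x = (\<Sum>j\<le>degree f. coeff f j * x ^ j)" by (rule poly_altdef)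
  also have "\<dots> = (\<Sum>j<q. coeff f j * x ^ j)"
    using assms by (intro sum.mono_neutral_left) (auto simp: coeff_eq_0)
  finally show ?thesis .
qed

text \<open>\<open>X ^ k\<close> has degree below \<open>q\<close>, so it coincides with its
  interpolation at the \<open>q\<close> nodes, and coefficients can be compared.\<close>

lemma lagrange_dual:
  assumes "j < q" "k < q"
  shows "(\<Sum>\<tau>\<in>G. coeff (lagrange \<tau>) j * u \<tau> ^ k) = of_bool (j = k)"
proof -
  define F where "F j = (\<Sum>\<tau>\<in>G. coeff (lagrange \<tau>) j * u \<tau> ^ k) - of_bool (j = k)" for j
  have "F j = 0"
  proof (rule polynomial_function_zero[of "u ` G" q])
    show "card (u ` G) \<ge> q" using u_inj card_G by (simp add: card_image)
    fix x assume "x \<in> u ` G"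
    then obtain \<sigma> where s: "\<sigma> \<in> G" "x = u \<sigma>" by blast
    have "(\<Sum>j<q. (\<Sum>\<tau>\<in>G. coeff (lagrange \<tau>) j * u \<tau> ^ k) * x ^ j)
        = (\<Sum>\<tau>\<in>G. (\<Sum>j<q. coeff (lagrange \<tau>) j * x ^ j) * u \<tau> ^ k)"
      by (simp only: sum_distrib_right) (subst sum.swap, simp add: mult_ac)
    also have "\<dots> = (\<Sum>\<tau>\<in>G. of_bool (\<sigma> = \<tau>) * u \<tau> ^ k)"
      by (intro sum.cong refl) (simp add: poly_lagrange s flip: sum_coeff_poly[OF degree_lagrange])
    also have "\<dots> = (\<Sum>\<tau>\<in>G. if \<sigma> = \<tau> then u \<tau> ^ k else 0)" by (intro sum.cong) auto
    also have "\<dots> = x ^ k" using s finite_G by simp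
    finally have 1: "(\<Sum>j<q. (\<Sum>\<tau>\<in>G. coeff (lagrange \<tau>) j * u \<tau> ^ k) * x ^ j) = x ^ k" .
    have "(\<Sum>j<q. of_bool (j = k) * x ^ j) = (\<Sum>j<q. if j = k then x ^ j else 0)" by (intro sum.cong) auto
    also have "\<dots> = x ^ k" using assms(2) by simp
    finally have 2: "(\<Sum>j<q. of_bool (j = k) * x ^ j) = x ^ k" .
    show "(\<Sum>j<q. F j * x ^ j) = 0"
      by (simp only: F_def left_diff_distrib sum_subtractf 1 2) simp
  qed (use finite_G assms in auto)
  thus ?thesis by (simp add: F_def)
qed

abbreviation GA :: "(('a \<Rightarrow> 'a) \<Rightarrow> 'a) set" where "GA \<equiv> group_alg K G"

text \<open>The coefficient of \<open>D k\<close> in \<open>\<alpha>\<close>: by the binomial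
  theorem \<open>\<sigma>\<close> acts on \<open>Y ^ a\<close>, \<open>a < q\<close>, as the sum of
  the \<open>u \<sigma> ^ k * D k\<close>.\<close>

definition coord :: "(('a \<Rightarrow> 'a) \<Rightarrow> 'a) \<Rightarrow> nat \<Rightarrow> 'a" where
  "coord \<alpha> k = (\<Sum>\<sigma>\<in>G. \<alpha> \<sigma> * u \<sigma> ^ k)"

definition of_coords :: "(nat \<Rightarrow> 'a) \<Rightarrow> (('a \<Rightarrow> 'a) \<Rightarrow> 'a)" where
  "of_coords c = (\<lambda>\<tau>. if \<tau> \<in> G then \<Sum>k<q. c k * coeff (lagrange \<tau>) k else 0)"

lemma GA_in_K: "\<alpha> \<in> GA \<Longrightarrow> \<sigma> \<in> G \<Longrightarrow> \<alpha> \<sigma> \<in> K"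
  and GA_outside: "\<alpha> \<in> GA \<Longrightarrow> \<sigma> \<notin> G \<Longrightarrow> \<alpha> \<sigma> = 0"
  by (auto simp: group_alg_def)

lemma coord_in_K: "\<alpha> \<in> GA \<Longrightarrow> coord \<alpha> k \<in> K"
  unfolding coord_def by (intro K_sum K_mult K_power u_in_K GA_in_K)

lemma of_coords_GA: "(\<And>k. k < q \<Longrightarrow> c k \<in> K) \<Longrightarrow> of_coords c \<in> GA"
  by (auto simp: group_alg_def of_coords_def intro!: K_sum K_mult coeff_lagrange_in_K)

lemma coord_of_coords: "k < q \<Longrightarrow> coord (of_coords c) k = c k"
proof -
  assume k: "k < q"
  have "coord (of_coords c) k = (\<Sum>\<tau>\<in>G. \<Sum>j<q. c j * (coeff (lagrange \<tau>) j * u \<tau> ^ k))"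
    by (simp add: coord_def of_coords_def sum_distrib_right mult.assoc)
  also have "\<dots> = (\<Sum>j<q. c j * (\<Sum>\<tau>\<in>G. coeff (lagrange \<tau>) j * u \<tau> ^ k))"
    by (subst sum.swap) (simp add: sum_distrib_left)
  also have "\<dots> = (\<Sum>j<q. if j = k then c j else 0)"
    using k by (intro sum.cong) (auto simp: lagrange_dual)
  finally show ?thesis using k by simp
qed

lemma of_coords_coord:
  assumes "\<alpha> \<in> GA" shows "of_coords (coord \<alpha>) = \<alpha>"
proof
  fix \<tau>
  show "of_coords (coord \<alpha>) \<tau> = \<alpha> \<tau>"
  proof (cases "\<tau> \<in> G")
    case True
    have "of_coords (coord \<alpha>) \<tau> = (\<Sum>k<q. \<Sum>\<sigma>\<in>G. \<alpha> \<sigma> * (coeff (lagrange \<tau>) k * u \<sigma> ^ k))"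
      using True by (simp add: of_coords_def coord_def sum_distrib_right sum_distrib_left mult_ac)
    also have "\<dots> = (\<Sum>\<sigma>\<in>G. \<alpha> \<sigma> * poly (lagrange \<tau>) (u \<sigma>))"
      by (subst sum.swap) (simp add: sum_coeff_poly[OF degree_lagrange[OF True]] sum_distrib_left)
    also have "\<dots> = (\<Sum>\<sigma>\<in>G. if \<sigma> = \<tau> then \<alpha> \<sigma> else 0)"
      using True by (intro sum.cong) (auto simp: poly_lagrange)
    finally show ?thesis using True finite_G by simp
  qed (use assms in \<open>simp add: of_coords_def GA_outside\<close>)
qed

lemma GA_eqI:
  assumes "\<alpha> \<in> GA" "\<beta> \<in> GA" "\<And>k. k < q \<Longrightarrow> coord \<alpha> k = coord \<beta> k"
  shows "\<alpha> = \<beta>"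
proof -
  have "of_coords (coord \<alpha>) = of_coords (coord \<beta>)"
    using assms(3) by (auto simp: of_coords_def fun_eq_iff intro!: sum.cong)
  thus ?thesis using of_coords_coord assms(1,2) by simp
qed

lemma ga_one_GA: "ga_one \<in> GA"
  by (auto simp: group_alg_def ga_one_def gal_id)

lemma coord_one: "coord ga_one k = of_bool (k = 0)"
proof -
  have "coord ga_one k = (\<Sum>\<sigma>\<in>G. if \<sigma> = id then u id ^ k else 0)"
    unfolding coord_def by (intro sum.cong) (auto simp: ga_one_def)
  thus ?thesis using finite_G by (simp add: u_id power_0_left gal_id)
qed

lemma ga_sum_GA: "(\<And>i. i \<in> S \<Longrightarrow> f i \<in> GA) \<Longrightarrow> (\<lambda>\<tau>. \<Sum>i\<in>S. f i \<tau>) \<in> GA"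
  by (auto simp: group_alg_def intro!: K_sum)

lemma coord_sum: "coord (\<lambda>\<tau>. \<Sum>i\<in>S. f i \<tau>) k = (\<Sum>i\<in>S. coord (f i) k)"
  unfolding coord_def by (subst sum.swap) (simp add: sum_distrib_right)

lemma ga_mult_GA:
  assumes "\<alpha> \<in> GA" "\<beta> \<in> GA" shows "ga_mult G \<alpha> \<beta> \<in> GA"
proof -
  have "ga_mult G \<alpha> \<beta> \<tau> = 0" if "\<tau> \<notin> G" for \<tau>
    unfolding ga_mult_def using that gal_comp by (intro sum.neutral ballI) auto
  moreover have "\<alpha> \<sigma> * \<beta> \<rho> \<in> K" if "\<sigma> \<in> G" "\<rho> \<in> G" for \<sigma> \<rho>
    using assms that by (intro K_mult GA_in_K[of \<alpha>] GA_in_K[of \<beta>])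
  hence "ga_mult G \<alpha> \<beta> \<tau> \<in> K" for \<tau>
    unfolding ga_mult_def by (intro K_sum) simp
  ultimately show ?thesis by (simp add: group_alg_def)
qed

text \<open>\<open>u\<close> is additive on \<open>G\<close>, so the binomial theorem for
  \<open>(u \<sigma> + u \<rho>) ^ k\<close> gives the rule for composing divided
  derivatives.\<close>

lemma coord_mult:
  "coord (ga_mult G \<alpha> \<beta>) k = (\<Sum>i\<le>k. of_nat (k choose i) * coord \<alpha> i * coord \<beta> (k - i))"
proof -
  have "coord (ga_mult G \<alpha> \<beta>) k
      = (\<Sum>\<tau>\<in>G. \<Sum>\<sigma>\<in>G. \<Sum>\<rho>\<in>G. (if \<sigma> \<circ> \<rho> = \<tau> then \<alpha> \<sigma> * \<beta> \<rho> * u \<tau> ^ k else 0))"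
    unfolding coord_def ga_mult_def by (simp only: sum_distrib_right) (intro sum.cong refl, auto)
  also have "\<dots> = (\<Sum>\<sigma>\<in>G. \<Sum>\<tau>\<in>G. \<Sum>\<rho>\<in>G. (if \<sigma> \<circ> \<rho> = \<tau> then \<alpha> \<sigma> * \<beta> \<rho> * u \<tau> ^ k else 0))"
    by (rule sum.swap)
  also have "\<dots> = (\<Sum>\<sigma>\<in>G. \<Sum>\<rho>\<in>G. \<Sum>\<tau>\<in>G. (if \<sigma> \<circ> \<rho> = \<tau> then \<alpha> \<sigma> * \<beta> \<rho> * u \<tau> ^ k else 0))"
    by (intro sum.cong refl sum.swap)
  also have "\<dots> = (\<Sum>\<sigma>\<in>G. \<Sum>\<rho>\<in>G. \<alpha> \<sigma> * \<beta> \<rho> * (u \<sigma> + u \<rho>) ^ k)"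
    using finite_G by (intro sum.cong refl) (simp add: gal_comp u_comp)
  also have "\<dots> = (\<Sum>\<sigma>\<in>G. \<Sum>\<rho>\<in>G. \<Sum>i\<le>k. of_nat (k choose i) * (\<alpha> \<sigma> * u \<sigma> ^ i) * (\<beta> \<rho> * u \<rho> ^ (k - i)))"
    by (simp add: binomial_ring sum_distrib_left mult_ac)
  also have "\<dots> = (\<Sum>\<sigma>\<in>G. \<Sum>i\<le>k. \<Sum>\<rho>\<in>G. of_nat (k choose i) * (\<alpha> \<sigma> * u \<sigma> ^ i) * (\<beta> \<rho> * u \<rho> ^ (k - i)))"
    by (intro sum.cong refl sum.swap)
  also have "\<dots> = (\<Sum>i\<le>k. \<Sum>\<sigma>\<in>G. \<Sum>\<rho>\<in>G. of_nat (k choose i) * (\<alpha> \<sigma> * u \<sigma> ^ i) * (\<beta> \<rho> * u \<rho> ^ (k - i)))"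
    by (rule sum.swap)
  also have "\<dots> = (\<Sum>i\<le>k. of_nat (k choose i) * coord \<alpha> i * coord \<beta> (k - i))"
    unfolding coord_def by (intro sum.cong refl) (unfold mult.assoc[of "of_nat _" "sum _ _"] sum_product, simp only: sum_distrib_left mult.assoc)
  finally show ?thesis .
qed

lemma ga_act_mult:
  assumes "\<alpha> \<in> GA" "\<beta> \<in> GA"
  shows "ga_act G (ga_mult G \<alpha> \<beta>) y = ga_act G \<alpha> (ga_act G \<beta> y)"
proof -
  have "ga_act G (ga_mult G \<alpha> \<beta>) y
      = (\<Sum>\<tau>\<in>G. \<Sum>\<sigma>\<in>G. \<Sum>\<rho>\<in>G. (if \<sigma> \<circ> \<rho> = \<tau> then \<alpha> \<sigma> * \<beta> \<rho> * \<tau> y else 0))"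
    unfolding ga_act_def ga_mult_def by (simp only: sum_distrib_right) (intro sum.cong refl, auto)
  also have "\<dots> = (\<Sum>\<sigma>\<in>G. \<Sum>\<tau>\<in>G. \<Sum>\<rho>\<in>G. (if \<sigma> \<circ> \<rho> = \<tau> then \<alpha> \<sigma> * \<beta> \<rho> * \<tau> y else 0))"
    by (rule sum.swap)
  also have "\<dots> = (\<Sum>\<sigma>\<in>G. \<Sum>\<rho>\<in>G. \<Sum>\<tau>\<in>G. (if \<sigma> \<circ> \<rho> = \<tau> then \<alpha> \<sigma> * \<beta> \<rho> * \<tau> y else 0))"
    by (intro sum.cong refl sum.swap)
  also have "\<dots> = (\<Sum>\<sigma>\<in>G. \<Sum>\<rho>\<in>G. \<alpha> \<sigma> * \<beta> \<rho> * \<sigma> (\<rho> y))"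
    using finite_G by (intro sum.cong refl) (simp add: gal_comp)
  also have "\<dots> = (\<Sum>\<sigma>\<in>G. \<alpha> \<sigma> * \<sigma> (\<Sum>\<rho>\<in>G. \<beta> \<rho> * \<rho> y))"
    by (intro sum.cong refl) (simp add: gal_sum gal_mult gal_fix[OF _ GA_in_K[OF assms(2)]] sum_distrib_left mult.assoc)
  finally show ?thesis by (simp add: ga_act_def)
qed

lemma ga_act_one: "ga_act G ga_one y = y"
proof -
  have "ga_act G ga_one y = (\<Sum>\<sigma>\<in>G. if \<sigma> = id then y else 0)"
    unfolding ga_act_def by (intro sum.cong) (auto simp: ga_one_def)
  thus ?thesis using finite_G by (simp add: gal_id)
qed

lemma ga_act_sum: "ga_act G (\<lambda>\<tau>. \<Sum>i\<in>S. f i \<tau>) y = (\<Sum>i\<in>S. ga_act G (f i) y)"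
  unfolding ga_act_def by (subst sum.swap) (simp add: sum_distrib_right)

lemma ga_act_sum_right: "ga_act G \<alpha> (\<Sum>i\<in>S. f i) = (\<Sum>i\<in>S. ga_act G \<alpha> (f i))"
proof -
  have "ga_act G \<alpha> (\<Sum>i\<in>S. f i) = (\<Sum>\<sigma>\<in>G. \<Sum>i\<in>S. \<alpha> \<sigma> * \<sigma> (f i))"
    unfolding ga_act_def by (intro sum.cong refl) (simp add: gal_sum sum_distrib_left)
  thus ?thesis unfolding ga_act_def by (subst (asm) sum.swap)
qed

lemma ga_act_scale: "c \<in> K \<Longrightarrow> ga_act G \<alpha> (c * y) = c * ga_act G \<alpha> y"
  unfolding ga_act_def by (simp add: sum_distrib_left gal_mult gal_fix mult_ac)

lemma ga_act_power:
  "ga_act G \<alpha> (Y ^ a) = (\<Sum>b\<le>a. of_nat (a choose b) * coord \<alpha> (a - b) * Y ^ b)"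
proof -
  have "ga_act G \<alpha> (Y ^ a) = (\<Sum>\<sigma>\<in>G. \<Sum>b\<le>a. of_nat (a choose b) * Y ^ b * (\<alpha> \<sigma> * u \<sigma> ^ (a - b)))"
    unfolding ga_act_def by (intro sum.cong refl) (simp add: gal_power gal_Y[of _] binomial_ring sum_distrib_left mult_ac)
  also have "\<dots> = (\<Sum>b\<le>a. of_nat (a choose b) * coord \<alpha> (a - b) * Y ^ b)"
    unfolding coord_def by (subst sum.swap) (simp add: sum_distrib_left mult_ac)
  finally show ?thesis .
qed

section \<open>Coordinates with respect to powers of \<open>Y\<close>, and monomials\<close>

definition ycoord :: "'a \<Rightarrow> nat \<Rightarrow> 'a" where
  "ycoord y = (SOME c. (\<forall>j. c j \<in> K) \<and> y = (\<Sum>j<q. c j * Y ^ j))"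

lemma ycoord_in_K: "ycoord y j \<in> K" and ycoord_expansion: "y = (\<Sum>j<q. ycoord y j * Y ^ j)"
proof -
  have "\<exists>c. (\<forall>j. c j \<in> K) \<and> y = (\<Sum>j<q. c j * Y ^ j)"
    using power_expansion[OF Y0, of y] vY by metis
  hence "(\<forall>j. ycoord y j \<in> K) \<and> y = (\<Sum>j<q. ycoord y j * Y ^ j)"
    unfolding ycoord_def by (rule someI_ex)
  thus "ycoord y j \<in> K" "y = (\<Sum>j<q. ycoord y j * Y ^ j)" by auto
qed

lemma ycoord_unique:
  assumes "\<And>j. j < q \<Longrightarrow> c j \<in> K" "y = (\<Sum>j<q. c j * Y ^ j)" "j < q"
  shows "ycoord y j = c j"
proof -
  have "(\<Sum>j<q. (ycoord y j - c j) * Y ^ j) = 0"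
    using assms(2) ycoord_expansion[of y] by (simp add: left_diff_distrib sum_subtractf)
  hence "(ycoord y j - c j) * Y ^ j \<in> P h" for h
    using assms ycoord_in_K vY by (intro power_expansion_in_P[OF Y0, of "\<lambda>j. ycoord y j - c j"]) (auto intro: K_diff)
  hence "(ycoord y j - c j) * Y ^ j = 0" by (rule P_all_zero)
  thus ?thesis using Y0 by simp
qed

lemma ycoord_sum: "j < q \<Longrightarrow> ycoord (\<Sum>i\<in>S. f i) j = (\<Sum>i\<in>S. ycoord (f i) j)"
proof (rule ycoord_unique)
  have "(\<Sum>i\<in>S. f i) = (\<Sum>i\<in>S. \<Sum>j<q. ycoord (f i) j * Y ^ j)"
    by (intro sum.cong refl ycoord_expansion)
  also have "\<dots> = (\<Sum>j<q. \<Sum>i\<in>S. ycoord (f i) j * Y ^ j)" by (rule sum.swap)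
  finally show "(\<Sum>i\<in>S. f i) = (\<Sum>j<q. (\<Sum>i\<in>S. ycoord (f i) j) * Y ^ j)"
    by (simp only: sum_distrib_right)
qed (auto intro: K_sum ycoord_in_K)

lemma ycoord_monomial: "c \<in> K \<Longrightarrow> a < q \<Longrightarrow> j < q \<Longrightarrow> ycoord (c * Y ^ a) j = (if j = a then c else 0)"
proof (rule ycoord_unique)
  assume "a < q"
  have "(\<Sum>j<q. (if j = a then c else 0) * Y ^ j) = (\<Sum>j<q. if j = a then c * Y ^ j else 0)"
    by (intro sum.cong) auto
  thus "c * Y ^ a = (\<Sum>j<q. (if j = a then c else 0) * Y ^ j)" using \<open>a < q\<close> by simp
qed auto

lemma ycoord_act:
  assumes "\<alpha> \<in> GA" "b < q"
  shows "ycoord (ga_act G \<alpha> y) b = (\<Sum>a\<in>{b..<q}. of_nat (a choose b) * coord \<alpha> (a - b) * ycoord y a)"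
proof (rule ycoord_unique[where c = "\<lambda>b. \<Sum>a\<in>{b..<q}. of_nat (a choose b) * coord \<alpha> (a - b) * ycoord y a", OF _ _ assms(2)])
  show "(\<Sum>a\<in>{b..<q}. of_nat (a choose b) * coord \<alpha> (a - b) * ycoord y a) \<in> K" for b
    using assms(1) by (intro K_sum K_mult K_of_nat coord_in_K ycoord_in_K)
  have "ga_act G \<alpha> y = (\<Sum>a<q. ycoord y a * ga_act G \<alpha> (Y ^ a))"
    by (subst ycoord_expansion[of y]) (simp add: ga_act_sum_right ga_act_scale ycoord_in_K)
  also have "\<dots> = (\<Sum>a<q. \<Sum>b\<le>a. of_nat (a choose b) * coord \<alpha> (a - b) * ycoord y a * Y ^ b)"
    by (simp add: ga_act_power sum_distrib_left mult_ac)
  also have "\<dots> = (\<Sum>a<q. \<Sum>b<q. if b \<le> a then of_nat (a choose b) * coord \<alpha> (a - b) * ycoord y a * Y ^ b else 0)"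
  proof (rule sum.cong[OF refl])
    fix a assume a: "a \<in> {..<q}"
    have "{..a} = {..<q} \<inter> {b. b \<le> a}" using a by auto
    thus "(\<Sum>b\<le>a. of_nat (a choose b) * coord \<alpha> (a - b) * ycoord y a * Y ^ b) =
      (\<Sum>b<q. if b \<le> a then of_nat (a choose b) * coord \<alpha> (a - b) * ycoord y a * Y ^ b else 0)"
      by (simp add: sum.inter_restrict)
  qed
  also have "\<dots> = (\<Sum>b<q. \<Sum>a<q. if b \<le> a then of_nat (a choose b) * coord \<alpha> (a - b) * ycoord y a * Y ^ b else 0)"
    by (rule sum.swap)
  also have "\<dots> = (\<Sum>b<q. (\<Sum>a\<in>{b..<q}. of_nat (a choose b) * coord \<alpha> (a - b) * ycoord y a) * Y ^ b)"
  proof (rule sum.cong[OF refl])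
    fix b assume "b \<in> {..<q}"
    have "{b..<q} = {..<q} \<inter> {a. b \<le> a}" by auto
    hence "(\<Sum>a\<in>{b..<q}. of_nat (a choose b) * coord \<alpha> (a - b) * ycoord y a * Y ^ b) =
      (\<Sum>a<q. if b \<le> a then of_nat (a choose b) * coord \<alpha> (a - b) * ycoord y a * Y ^ b else 0)"
      by (simp add: sum.inter_restrict)
    thus "(\<Sum>a<q. if b \<le> a then of_nat (a choose b) * coord \<alpha> (a - b) * ycoord y a * Y ^ b else 0) =
      (\<Sum>a\<in>{b..<q}. of_nat (a choose b) * coord \<alpha> (a - b) * ycoord y a) * Y ^ b"
      by (simp only: sum_distrib_right)
  qed
  finally show "ga_act G \<alpha> y = (\<Sum>b<q. (\<Sum>a\<in>{b..<q}. of_nat (a choose b) * coord \<alpha> (a - b) * ycoord y a) * Y ^ b)" .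
qed

text \<open>The element \<open>c * D s\<close>, for \<open>s < q\<close>.\<close>

definition mono :: "nat \<Rightarrow> 'a \<Rightarrow> (('a \<Rightarrow> 'a) \<Rightarrow> 'a)" where
  "mono s c = of_coords (\<lambda>k. if k = s then c else 0)"

lemma mono_GA: "c \<in> K \<Longrightarrow> mono s c \<in> GA"
  unfolding mono_def by (intro of_coords_GA) auto

lemma coord_mono: "k < q \<Longrightarrow> coord (mono s c) k = (if k = s then c else 0)"
  by (simp add: mono_def coord_of_coords)

lemma coord_scalar_mult:
  assumes "k < q" shows "coord (ga_mult G (mono 0 c) \<beta>) k = c * coord \<beta> k"
proof -
  have "coord (ga_mult G (mono 0 c) \<beta>) k = (\<Sum>i\<le>k. if i = 0 then c * coord \<beta> k else 0)"
    unfolding coord_mult using assms by (intro sum.cong) (auto simp: coord_mono)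
  thus ?thesis by simp
qed

lemma mono_mult:
  assumes "i + j < q" "a \<in> K" "b \<in> K"
  shows "ga_mult G (mono i a) (mono j b) = mono (i + j) (of_nat ((i + j) choose i) * a * b)"
proof (rule GA_eqI)
  fix k assume k: "k < q"
  have "coord (ga_mult G (mono i a) (mono j b)) k
      = (\<Sum>l\<le>k. if l = i then of_nat (k choose i) * a * (if k - i = j then b else 0) else 0)"
    unfolding coord_mult using k by (intro sum.cong) (auto simp: coord_mono)
  also have "\<dots> = (if i \<le> k then of_nat (k choose i) * a * (if k - i = j then b else 0) else 0)" by simp
  also have "\<dots> = coord (mono (i + j) (of_nat ((i + j) choose i) * a * b)) k"
    using k by (auto simp: coord_mono)
  finally show "coord (ga_mult G (mono i a) (mono j b)) k = coord (mono (i + j) (of_nat ((i + j) choose i) * a * b)) k" .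
qed (use assms in \<open>auto intro!: ga_mult_GA mono_GA K_mult K_of_nat\<close>)

lemma mono_act:
  assumes "b + k < q" "c \<in> K" "d \<in> K"
  shows "ga_act G (mono k c) (d * Y ^ (b + k)) = of_nat ((b + k) choose b) * c * d * Y ^ b"
proof -
  have "ga_act G (mono k c) (d * Y ^ (b + k)) =
      d * (\<Sum>j\<le>b + k. if j = b then of_nat ((b + k) choose b) * c * Y ^ b else 0)"
    unfolding ga_act_scale[OF assms(3)] ga_act_power
    using assms(1) by (intro arg_cong2[where f = "(*)"] sum.cong) (auto simp: coord_mono)
  thus ?thesis by (simp add: mult_ac)
qed

lemma ex_v_int_q: "\<exists>x. x \<in> K \<and> x \<noteq> 0 \<and> v x = int q * i"
  using ex_K_valuation[of "int q * i"] by auto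

text \<open>Stands for the \<open>i\<close>-th power of a uniformizer of \<open>K\<close>, but is
  chosen separately for each \<open>i\<close>, so products are controlled by valuation
  alone.\<close>

definition kpow :: "int \<Rightarrow> 'a" where "kpow i = (SOME x. x \<in> K \<and> x \<noteq> 0 \<and> v x = int q * i)"

lemma kpow_in_K: "kpow i \<in> K" and kpow_nonzero: "kpow i \<noteq> 0" and v_kpow: "v (kpow i) = int q * i"
  using someI_ex[OF ex_v_int_q[of i]] by (auto simp: kpow_def)

lemma kpow_P: "kpow i \<in> P h \<longleftrightarrow> h \<le> int q * i"
  by (simp add: P_iff kpow_nonzero v_kpow)

lemma P_divide: "y \<noteq> 0 \<Longrightarrow> x / y \<in> P h \<longleftrightarrow> x \<in> P (h + v y)"
  by (cases "x = 0") (auto simp: P_iff v_divide)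

lemma P_mult_cancel: "y \<noteq> 0 \<Longrightarrow> x * y \<in> P h \<longleftrightarrow> x \<in> P (h - v y)"
  by (cases "x = 0") (auto simp: P_iff v_mult)

text \<open>\<open>of_nat c\<close> is fixed by Frobenius, so its valuation equals \<open>p\<close>
  times itself.\<close>

lemma v_of_nat: "\<not> p dvd c \<Longrightarrow> v (of_nat c) = 0"
proof -
  assume "\<not> p dvd c"
  hence nz: "(of_nat c :: 'a) \<noteq> 0" by (simp add: of_nat_eq_0_iff_dvd)
  have "int p * v (of_nat c) = v (of_nat c)" using v_power[OF nz, of p] by (simp add: of_nat_power_p)
  thus ?thesis using p_gt_1 by simp
qed

end

section \<open>The associated order\<close>

locale ideal_scaffold = scaffold v K p n Y for v :: "'a::field \<Rightarrow> int" and K p n Y +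
  fixes h z :: int and m :: nat
  assumes m_less: "m < p ^ n" and h_eq: "h = 1 + int m + int (p ^ n) * z"
begin

definition t where "t = q - m"

text \<open>Threshold of the order. Lowering exponents by \<open>j\<close> costs a level in all
  cases exactly when \<open>j \<ge> t\<close>, as seen from exponent \<open>j\<close>, and
  \<open>j \<ge> m\<close>, as seen from exponent \<open>q - 1\<close>.\<close>

definition k where "k = max m t"

text \<open>The bound for the coefficient of \<open>Y ^ a\<close> in units of \<open>q\<close>,
  namely \<open>(h + a) / q\<close> rounded up. The ceiling jumps once, when \<open>m + a\<close>
  reaches \<open>q\<close>.\<close>

definition lev :: "nat \<Rightarrow> int" where "lev a = z + 1 + step_fn t a"

abbreviation \<AA> where "\<AA> \<equiv> assoc_order v K h"

lemma t_bounds: "0 < t" "t \<le> q"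
  using m_less by (auto simp: t_def)

lemma k_bounds: "0 < k" "t \<le> k" "m \<le> k" "k \<le> q" "q \<le> 2 * k"
  using m_less by (auto simp: k_def t_def)

text \<open>Two indices with sum below \<open>q \<le> 2 * k\<close> cannot both reach
  \<open>k\<close>.\<close>

lemma step_superadd: "i + j < q \<Longrightarrow> step_fn k i + step_fn k j \<le> step_fn k (i + j)"
  using k_bounds by (auto simp: step_fn_def)

lemma step_zero: "step_fn k 0 = 0"
  using k_bounds by (simp add: step_fn_def)

lemma ideal_iff: "y \<in> P h \<longleftrightarrow> (\<forall>a<q. ycoord y a \<in> P (int q * lev a))"
proof -
  have *: "ycoord y a * Y ^ a \<in> P h \<longleftrightarrow> ycoord y a \<in> P (int q * lev a)" if a: "a < q" for a
  proof (cases "ycoord y a = 0")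
    case False
    obtain i where i: "v (ycoord y a) = int q * i" using v_K_dvd[OF ycoord_in_K False] by blast
    have "ycoord y a * Y ^ a \<in> P h \<longleftrightarrow> h + int a \<le> int q * i"
      using False Y0 by (auto simp: P_iff v_mult v_power vY i)
    also have "\<dots> \<longleftrightarrow> lev a \<le> i"
    proof
      assume "h + int a \<le> int q * i"
      hence le: "1 + int m + int a \<le> int q * (i - z)" by (simp add: h_eq algebra_simps)
      show "lev a \<le> i"
      proof (rule ccontr)
        assume "\<not> lev a \<le> i"
        hence "i - z \<le> step_fn t a" by (simp add: lev_def)
        hence "int q * (i - z) \<le> int q * step_fn t a" by (intro mult_left_mono) auto
        hence le': "1 + int m + int a \<le> int q * step_fn t a" using le by linarith
        show False
        proof (cases "t \<le> a")
          case True
          hence "q \<le> m + a" using m_less by (auto simp: t_def)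
          hence "int q \<le> int m + int a" by linarith
          thus False using le' True by (simp add: step_fn_def)
        qed (use le' in \<open>simp add: step_fn_def\<close>)
      qed
    next
      assume "lev a \<le> i"
      hence "1 + step_fn t a \<le> i - z" by (simp add: lev_def)
      hence "int q * (1 + step_fn t a) \<le> int q * (i - z)" by (intro mult_left_mono) auto
      moreover have "1 + int m + int a \<le> int q * (1 + step_fn t a)"
        using a m_less by (auto simp: step_fn_def t_def algebra_simps simp del: of_nat_power)
      ultimately show "h + int a \<le> int q * i" by (simp add: h_eq algebra_simps)
    qed
    also have "\<dots> \<longleftrightarrow> ycoord y a \<in> P (int q * lev a)"
      using False q_pos by (auto simp: P_iff i)
    finally show ?thesis .
  qed simp
  show ?thesis
  proof
    assume y: "y \<in> P h"
    show "\<forall>a<q. ycoord y a \<in> P (int q * lev a)"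
    proof (intro allI impI)
      fix a assume a: "a < q"
      have "ycoord y a * Y ^ a \<in> P h"
        using y vY ycoord_expansion[of y] ycoord_in_K a
        by (intro power_expansion_in_P[OF Y0, of "ycoord y"]) auto
      thus "ycoord y a \<in> P (int q * lev a)" using *[OF a] by simp
    qed
  next
    assume "\<forall>a<q. ycoord y a \<in> P (int q * lev a)"
    hence "(\<Sum>a<q. ycoord y a * Y ^ a) \<in> P h" using * by (intro P_sum) auto
    thus "y \<in> P h" using ycoord_expansion[of y] by simp
  qed
qed

lemma lev_drop: "b \<le> a \<Longrightarrow> a < q \<Longrightarrow> step_fn k (a - b) \<le> lev a - lev b"
  using m_less by (auto simp: lev_def step_fn_def k_def t_def)

text \<open>The bound in \<open>lev_drop\<close> is attained with a binomial prime to
  \<open>p\<close>: at \<open>a = j\<close> in general, and at \<open>a = q - 1\<close> when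
  \<open>t \<le> j < k\<close>, where both levels are the upper one.\<close>

lemma lev_drop_exact:
  assumes "j < q"
  obtains a where "j \<le> a" "a < q" "\<not> p dvd (a choose j)" "lev a - lev (a - j) = step_fn k j"
proof (cases "j < t \<or> k \<le> j")
  case True
  thus ?thesis using that[of j] assms p_gt_1 k_bounds t_bounds by (auto simp: lev_def step_fn_def)
next
  case False
  have "\<not> p dvd (q - 1 choose j)"
    using not_dvd_choose_pred_prime_power[OF prime, of n "q - 1" j] assms q_pos by (metis Suc_diff_1 dvd_refl)
  moreover have "t \<le> q - 1 - j" using False assms by (auto simp: k_def t_def)
  ultimately show ?thesis using that[of "q - 1"] False assms by (auto simp: lev_def step_fn_def)
qed

text \<open>Sufficiency follows coordinatewise from \<open>lev_drop\<close>. For necessity, applying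
  \<open>\<alpha>\<close> to one extremal monomial, chosen by \<open>lev_drop_exact\<close>,
  isolates \<open>coord \<alpha> j\<close>.\<close>

lemma order_iff: "\<alpha> \<in> \<AA> \<longleftrightarrow> \<alpha> \<in> GA \<and> (\<forall>j<q. coord \<alpha> j \<in> P (- int q * step_fn k j))"
proof
  assume A: "\<alpha> \<in> GA \<and> (\<forall>j<q. coord \<alpha> j \<in> P (- int q * step_fn k j))"
  have "ga_act G \<alpha> y \<in> P h" if y: "y \<in> P h" for y
    unfolding ideal_iff
  proof (intro allI impI)
    fix b assume b: "b < q"
    have "of_nat (a choose b) * coord \<alpha> (a - b) * ycoord y a \<in> P (int q * lev b)" if a: "a \<in> {b..<q}" for a
    proof -
      have "coord \<alpha> (a - b) * ycoord y a \<in> P (- int q * step_fn k (a - b) + int q * lev a)"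
        using A y a by (intro P_mult) (auto simp: ideal_iff)
      moreover have "int q * lev b \<le> - int q * step_fn k (a - b) + int q * lev a"
      proof -
        have "int q * (lev b + step_fn k (a - b)) \<le> int q * lev a"
          using lev_drop[of b a] a by (intro mult_left_mono) auto
        thus ?thesis by (simp add: algebra_simps)
      qed
      ultimately have "coord \<alpha> (a - b) * ycoord y a \<in> P (int q * lev b)" using P_mono by blast
      thus ?thesis unfolding mult.assoc by (rule P_mult_left[OF P_of_nat])
    qed
    thus "ycoord (ga_act G \<alpha> y) b \<in> P (int q * lev b)"
      unfolding ycoord_act[OF conjunct1[OF A] b] by (rule P_sum)
  qed
  thus "\<alpha> \<in> \<AA>" using A by (simp add: assoc_order_def)
next
  assume A: "\<alpha> \<in> \<AA>"
  hence GA: "\<alpha> \<in> GA" by (simp add: assoc_order_def)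
  have "coord \<alpha> j \<in> P (- int q * step_fn k j)" if j: "j < q" for j
  proof -
    obtain a where a: "j \<le> a" "a < q" "\<not> p dvd (a choose j)" "lev a - lev (a - j) = step_fn k j"
      by (rule lev_drop_exact[OF j])
    define y where "y = kpow (lev a) * Y ^ a"
    have yc: "ycoord y i = (if i = a then kpow (lev a) else 0)" if "i < q" for i
      unfolding y_def using that a by (intro ycoord_monomial kpow_in_K)
    hence "y \<in> P h" by (auto simp: ideal_iff kpow_P)
    hence "ga_act G \<alpha> y \<in> P h" using A by (simp add: assoc_order_def)
    hence "ycoord (ga_act G \<alpha> y) (a - j) \<in> P (int q * lev (a - j))" using a by (simp add: ideal_iff)
    also have "ycoord (ga_act G \<alpha> y) (a - j)
        = (\<Sum>i\<in>{a - j..<q}. of_nat (i choose (a - j)) * coord \<alpha> (i - (a - j)) * ycoord y i)"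
      using a by (intro ycoord_act GA) simp
    also have "\<dots> = (\<Sum>i\<in>{a - j..<q}. if i = a then of_nat (a choose (a - j)) * coord \<alpha> (a - (a - j)) * kpow (lev a) else 0)"
      by (intro sum.cong refl) (auto simp: yc)
    also have "\<dots> = of_nat (a choose j) * coord \<alpha> j * kpow (lev a)"
      using a binomial_symmetric[of j a] by simp
    finally have *: "coord \<alpha> j * of_nat (a choose j) * kpow (lev a) \<in> P (int q * lev (a - j))" by (simp add: mult_ac)
    have nz: "(of_nat (a choose j) :: 'a) \<noteq> 0" using a(3) by (simp add: of_nat_eq_0_iff_dvd)
    have "coord \<alpha> j \<in> P (int q * lev (a - j) - int q * lev a)"
      using * by (simp add: P_mult_cancel nz kpow_nonzero v_kpow v_of_nat[OF a(3)])
    also have "int q * lev (a - j) - int q * lev a = - int q * step_fn k j"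
      using a(4) by (simp add: algebra_simps flip: a(4))
    finally show ?thesis .
  qed
  thus "\<alpha> \<in> GA \<and> (\<forall>j<q. coord \<alpha> j \<in> P (- int q * step_fn k j))" using GA by blast
qed

lemma order_GA: "\<alpha> \<in> \<AA> \<Longrightarrow> \<alpha> \<in> GA"
  by (simp add: order_iff)

lemma order_coord: "\<alpha> \<in> \<AA> \<Longrightarrow> j < q \<Longrightarrow> coord \<alpha> j \<in> P (- int q * step_fn k j)"
  by (simp add: order_iff)

lemma order_coord_0: "\<alpha> \<in> \<AA> \<Longrightarrow> coord \<alpha> 0 \<in> P 0"
  using order_coord[of \<alpha> 0] q_pos by (simp add: step_zero)

lemma order_one: "ga_one \<in> \<AA>"
  using ga_one_GA by (auto simp: order_iff coord_one one_in_P step_fn_def)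

lemma order_mult: "\<alpha> \<in> \<AA> \<Longrightarrow> \<beta> \<in> \<AA> \<Longrightarrow> ga_mult G \<alpha> \<beta> \<in> \<AA>"
  using order_GA[of \<alpha>] order_GA[of \<beta>] by (auto simp: assoc_order_def ga_mult_GA ga_act_mult)

lemma order_sum: "(\<And>i. i \<in> S \<Longrightarrow> f i \<in> \<AA>) \<Longrightarrow> (\<lambda>\<tau>. \<Sum>i\<in>S. f i \<tau>) \<in> \<AA>"
  by (simp add: order_iff ga_sum_GA coord_sum P_sum)

lemma order_mono: "c \<in> K \<Longrightarrow> s < q \<Longrightarrow> mono s c \<in> \<AA> \<longleftrightarrow> c \<in> P (- int q * step_fn k s)"
  by (auto simp: order_iff mono_GA coord_mono)

section \<open>Units, the maximal ideal and its square\<close>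

lemma K_P_1: "x \<in> K \<Longrightarrow> x \<in> P 1 \<longleftrightarrow> x \<in> P (int q)"
  using K_P_ceiling[of x 1 1] P_mono[of 1 "int q" x] q_pos by auto

text \<open>Coordinate \<open>0\<close> is multiplicative with integral values, so a unit has a unit
  there. Conversely the inverse given by \<open>inverse_seq\<close> respects the denominators
  because \<open>step_fn k\<close> is superadditive.\<close>

lemma unit_iff:
  assumes A: "\<alpha> \<in> \<AA>"
  shows "(\<exists>\<beta>\<in>\<AA>. ga_mult G \<alpha> \<beta> = ga_one) \<longleftrightarrow> coord \<alpha> 0 \<notin> P (int q)"
proof
  assume "\<exists>\<beta>\<in>\<AA>. ga_mult G \<alpha> \<beta> = ga_one"
  then obtain \<beta> where b: "\<beta> \<in> \<AA>" "ga_mult G \<alpha> \<beta> = ga_one" by blast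
  have e: "coord \<alpha> 0 * coord \<beta> 0 = 1" using coord_mult[of \<alpha> \<beta> 0] b(2) by (simp add: coord_one)
  show "coord \<alpha> 0 \<notin> P (int q)"
  proof
    assume "coord \<alpha> 0 \<in> P (int q)"
    hence "coord \<alpha> 0 * coord \<beta> 0 \<in> P (int q + 0)" by (rule P_mult[OF _ order_coord_0[OF b(1)]])
    thus False using q_pos by (simp add: e one_in_P del: of_nat_power)
  qed
next
  assume n: "coord \<alpha> 0 \<notin> P (int q)"
  define c where "c = coord \<alpha>"
  have cK: "c i \<in> K" for i unfolding c_def using order_GA[OF A] by (rule coord_in_K)
  have cP: "c i \<in> P (- int q * step_fn k i)" if "i < q" for i unfolding c_def using A that by (rule order_coord)
  have c0: "c 0 \<noteq> 0" "v (c 0) = 0"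
    using n K_P_1[OF cK[of 0]] order_coord_0[OF A] by (auto simp: c_def ideal_pow_def)
  have dK: "inverse_seq c i \<in> K" for i
  proof (induction i rule: less_induct)
    case (less i)
    show ?case by (subst inverse_seq.simps) (use less cK in \<open>auto intro!: K_minus K_divide K_diff K_sum K_mult K_of_nat\<close>)
  qed
  have dP: "i < q \<longrightarrow> inverse_seq c i \<in> P (- int q * step_fn k i)" for i
  proof (induction i rule: less_induct)
    case (less i)
    show ?case
    proof
      assume i: "i < q"
      have "of_nat (i choose j) * c (i - j) * inverse_seq c j \<in> P (- int q * step_fn k i)" if j: "j < i" for j
      proof -
        have "c (i - j) * inverse_seq c j \<in> P (- int q * step_fn k (i - j) + - int q * step_fn k j)"
          using less j i by (intro P_mult cP) auto
        moreover have "- int q * step_fn k i \<le> - int q * step_fn k (i - j) + - int q * step_fn k j"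
        proof -
          have "int q * (step_fn k (i - j) + step_fn k j) \<le> int q * step_fn k i"
            using step_superadd[of "i - j" j] i j by (intro mult_left_mono) auto
          thus ?thesis by (simp add: algebra_simps)
        qed
        ultimately have "c (i - j) * inverse_seq c j \<in> P (- int q * step_fn k i)" using P_mono by blast
        thus ?thesis unfolding mult.assoc by (rule P_mult_left[OF P_of_nat])
      qed
      hence "(\<Sum>j<i. of_nat (i choose j) * c (i - j) * inverse_seq c j) \<in> P (- int q * step_fn k i)" by (intro P_sum) auto
      moreover have "of_bool (i = 0) \<in> P (- int q * step_fn k i)" by (auto simp: one_in_P step_fn_def)
      ultimately have "inverse_seq c i * c 0 \<in> P (- int q * step_fn k i)"
        using c0 by (subst inverse_seq.simps) (simp add: P_diff)
      thus "inverse_seq c i \<in> P (- int q * step_fn k i)" using c0 by (simp add: P_mult_cancel)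
    qed
  qed
  define \<beta> where "\<beta> = of_coords (inverse_seq c)"
  have bA: "\<beta> \<in> \<AA>" using dK dP by (simp add: \<beta>_def order_iff of_coords_GA coord_of_coords)
  have "ga_mult G \<alpha> \<beta> = ga_one"
  proof (rule GA_eqI)
    fix i assume "i < q"
    hence "coord (ga_mult G \<alpha> \<beta>) i = (\<Sum>j\<le>i. of_nat (i choose j) * c j * inverse_seq c (i - j))"
      unfolding coord_mult c_def[symmetric] by (intro sum.cong) (auto simp: \<beta>_def coord_of_coords)
    also have "\<dots> = coord ga_one i" using inverse_seq[of c i] c0 by (simp add: coord_one)
    finally show "coord (ga_mult G \<alpha> \<beta>) i = coord ga_one i" .
  qed (use A bA order_GA ga_one_GA ga_mult_GA in auto)
  thus "\<exists>\<beta>\<in>\<AA>. ga_mult G \<alpha> \<beta> = ga_one" using bA by blast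
qed

abbreviation \<MM> where "\<MM> \<equiv> loc_max_ideal G \<AA>"

lemma max_ideal_iff: "\<alpha> \<in> \<MM> \<longleftrightarrow> \<alpha> \<in> \<AA> \<and> coord \<alpha> 0 \<in> P (int q)"
  using unit_iff by (auto simp: loc_max_ideal_def)

text \<open>Coordinatewise bounds of the maximal ideal: those of the order, raised from
  \<open>0\<close> to \<open>q\<close> at index \<open>0\<close>.\<close>

definition \<nu> :: "nat \<Rightarrow> int" where "\<nu> s = (if s = 0 then int q else - int q * step_fn k s)"

lemma \<nu>_ge: "- int q * step_fn k s \<le> \<nu> s"
  by (auto simp: \<nu>_def step_fn_def)

lemma max_ideal_coords: "\<alpha> \<in> \<MM> \<longleftrightarrow> \<alpha> \<in> GA \<and> (\<forall>s<q. coord \<alpha> s \<in> P (\<nu> s))"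
proof
  assume "\<alpha> \<in> \<MM>"
  thus "\<alpha> \<in> GA \<and> (\<forall>s<q. coord \<alpha> s \<in> P (\<nu> s))"
    by (auto simp: max_ideal_iff order_iff \<nu>_def)
next
  assume *: "\<alpha> \<in> GA \<and> (\<forall>s<q. coord \<alpha> s \<in> P (\<nu> s))"
  hence "\<alpha> \<in> \<AA>" using \<nu>_ge P_mono by (fastforce simp: order_iff)
  moreover have "coord \<alpha> 0 \<in> P (int q)" using * q_pos by (force simp: \<nu>_def)
  ultimately show "\<alpha> \<in> \<MM>" by (simp add: max_ideal_iff)
qed

text \<open>Indices at which the square of the maximal ideal is strictly smaller than that ideal.
  Index \<open>0\<close> accounts for the uniformizer of \<open>K\<close>.\<close>

definition N where "N = insert 0 (indecomposables p q k)"

lemma finite_N: "finite N"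
  by (simp add: N_def finite_indecomposables)

lemma card_N: "card N = 1 + card (indecomposables p q k)"
  unfolding N_def by (subst card_insert_disjoint) (auto simp: finite_indecomposables, auto simp: indecomposables_def)

lemma N_less: "s \<in> N \<Longrightarrow> s < q"
  using q_pos by (auto simp: N_def indecomposables_def)

abbreviation \<mu> :: "nat \<Rightarrow> int" where "\<mu> s \<equiv> \<nu> s + (if s \<in> N then int q else 0)"

text \<open>Superadditivity bounds the product, and for \<open>s \<in> N\<close> it is strict
  whenever the binomial is prime to \<open>p\<close>, which gains a further
  \<open>q\<close>.\<close>

lemma middle_term:
  assumes "0 < i" "i < s" "s < q" "a \<in> P (- int q * step_fn k i)" "b \<in> P (- int q * step_fn k (s - i))"
  shows "of_nat (s choose i) * a * b \<in> P (\<mu> s)"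
proof (cases "p dvd (s choose i)")
  case True
  hence "(of_nat (s choose i) :: 'a) = 0" by (simp add: of_nat_eq_0_iff_dvd)
  thus ?thesis by simp
next
  case False
  have ab: "a * b \<in> P (- int q * step_fn k i + - int q * step_fn k (s - i))" using assms by (intro P_mult)
  have "step_fn k i + step_fn k (s - i) + (if s \<in> N then 1 else 0) \<le> step_fn k s"
  proof -
    have le: "step_fn k i + step_fn k (s - i) \<le> step_fn k s" using step_superadd[of i "s - i"] assms by simp
    have "step_fn k i + step_fn k (s - i) \<noteq> step_fn k s" if "s \<in> N"
      using that assms False by (auto simp: N_def indecomposables_def)
    thus ?thesis using le by auto
  qed
  hence "int q * (step_fn k i + step_fn k (s - i) + (if s \<in> N then 1 else 0)) \<le> int q * step_fn k s"
    by (intro mult_left_mono) auto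
  hence "\<mu> s \<le> - int q * step_fn k i + - int q * step_fn k (s - i)"
    using assms by (auto simp: \<nu>_def algebra_simps)
  hence "a * b \<in> P (\<mu> s)" using ab P_mono by blast
  thus ?thesis unfolding mult.assoc by (rule P_mult_left[OF P_of_nat])
qed

text \<open>Terms \<open>0 < i < s\<close> of the product are covered by \<open>middle_term\<close>,
  and the term \<open>i = s\<close> contains \<open>coord x 0\<close>, an element of
  \<open>P (int q)\<close>. So the order acts through the scalar \<open>coord \<alpha> 0\<close> up
  to the bounds \<open>\<mu>\<close>.\<close>

lemma coord_mult_max:
  assumes A: "\<alpha> \<in> \<AA>" and x: "x \<in> \<MM>" and s: "s < q"
  shows "coord (ga_mult G \<alpha> x) s - coord \<alpha> 0 * coord x s \<in> P (\<mu> s)"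
proof -
  have xA: "x \<in> \<AA>" using x by (simp add: max_ideal_iff)
  have "{..s} = insert 0 {1..s}" by auto
  hence "coord (ga_mult G \<alpha> x) s - coord \<alpha> 0 * coord x s
     = (\<Sum>i\<in>{1..s}. of_nat (s choose i) * coord \<alpha> i * coord x (s - i))"
    unfolding coord_mult by simp
  also have "\<dots> \<in> P (\<mu> s)"
  proof (rule P_sum)
    fix i assume i: "i \<in> {1..s}"
    show "of_nat (s choose i) * coord \<alpha> i * coord x (s - i) \<in> P (\<mu> s)"
    proof (cases "i = s")
      case True
      have "coord \<alpha> s * coord x 0 \<in> P (- int q * step_fn k s + int q)"
        using order_coord[OF A s] x by (intro P_mult) (auto simp: max_ideal_iff)
      moreover have "\<nu> s = - int q * step_fn k s" using i True by (simp add: \<nu>_def)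
      ultimately show ?thesis using True by (auto intro: P_mono[rotated])
    next
      case False
      show ?thesis
        using i False s by (intro middle_term order_coord[OF A] order_coord[OF xA]) auto
    qed
  qed
  finally show ?thesis .
qed

text \<open>The bounds are necessary by \<open>coord_mult_max\<close>. For sufficiency each monomial
  is written as one product: for \<open>s \<in> N\<close> with the factor
  \<open>mono 0 (kpow 1)\<close>, otherwise along a splitting of \<open>s\<close> that loses no
  valuation.\<close>

lemma ideal_square_iff:
  "\<alpha> \<in> ideal_square G \<MM> \<longleftrightarrow> \<alpha> \<in> GA \<and> (\<forall>s<q. coord \<alpha> s \<in> P (\<mu> s))"
proof
  assume "\<alpha> \<in> ideal_square G \<MM>"
  then obtain xs ys where \<alpha>: "\<alpha> = (\<lambda>\<tau>. \<Sum>i<length xs. ga_mult G (xs ! i) (ys ! i) \<tau>)"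
    and xs: "length xs = length ys" "set xs \<subseteq> \<MM>" "set ys \<subseteq> \<MM>"
    unfolding ideal_square_def by blast
  have xM: "xs ! i \<in> \<MM>" and yM: "ys ! i \<in> \<MM>" if "i < length xs" for i
    using that xs nth_mem[of i xs] nth_mem[of i ys] by (simp_all add: subset_iff)
  have "\<alpha> \<in> GA" unfolding \<alpha> using xM yM
    by (intro ga_sum_GA ga_mult_GA) (auto simp: max_ideal_coords)
  moreover have "coord \<alpha> s \<in> P (\<mu> s)" if s: "s < q" for s
    unfolding \<alpha> coord_sum
  proof (rule P_sum)
    fix i assume "i \<in> {..<length xs}"
    hence i: "i < length xs" by simp
    have "coord (xs ! i) 0 * coord (ys ! i) s \<in> P (int q + \<nu> s)"
      using xM[OF i] yM[OF i] s by (intro P_mult) (auto simp: max_ideal_iff[of "xs ! i"] max_ideal_coords[of "ys ! i"])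
    hence "coord (xs ! i) 0 * coord (ys ! i) s \<in> P (\<mu> s)"
      by (rule P_mono[rotated]) auto
    moreover have "coord (ga_mult G (xs ! i) (ys ! i)) s - coord (xs ! i) 0 * coord (ys ! i) s
      \<in> P (\<mu> s)"
      using xM[OF i] yM[OF i] s by (intro coord_mult_max) (auto simp: max_ideal_iff)
    ultimately show "coord (ga_mult G (xs ! i) (ys ! i)) s \<in> P (\<mu> s)"
      using P_add by fastforce
  qed
  ultimately show "\<alpha> \<in> GA \<and> (\<forall>s<q. coord \<alpha> s \<in> P (\<mu> s))" by blast
next
  assume A: "\<alpha> \<in> GA \<and> (\<forall>s<q. coord \<alpha> s \<in> P (\<mu> s))"
  have "\<exists>x y. x \<in> \<MM> \<and> y \<in> \<MM> \<and> ga_mult G x y = mono s (coord \<alpha> s)" if s: "s < q" for s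
  proof (cases "s \<in> N")
    case True
    define c where "c = coord \<alpha> s / kpow 1"
    have cK: "c \<in> K" using A kpow_in_K by (simp add: c_def K_divide coord_in_K)
    have "coord \<alpha> s \<in> P (\<mu> s)" using A s by blast
    hence "coord \<alpha> s \<in> P (\<nu> s + int q)" using True by (simp only: if_True)
    hence cP: "c \<in> P (\<nu> s)" by (simp add: c_def P_divide kpow_nonzero v_kpow)
    have "mono 0 (kpow 1) \<in> \<MM>" using q_pos
      by (auto simp: max_ideal_coords mono_GA kpow_in_K coord_mono kpow_P \<nu>_def)
    moreover have "mono s c \<in> \<MM>" using cK cP by (auto simp: max_ideal_coords mono_GA coord_mono)
    moreover have "ga_mult G (mono 0 (kpow 1)) (mono s c) = mono s (coord \<alpha> s)"
      using s cK kpow_in_K kpow_nonzero by (subst mono_mult) (auto simp: c_def)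
    ultimately show ?thesis by blast
  next
    case False
    then obtain i where i: "0 < i" "i < s" "\<not> p dvd (s choose i)" "step_fn k i + step_fn k (s - i) = step_fn k s"
      using s by (auto simp: N_def indecomposables_def)
    have nz: "(of_nat (s choose i) :: 'a) \<noteq> 0" using i(3) by (simp add: of_nat_eq_0_iff_dvd)
    define a where "a = kpow (- step_fn k i)"
    define b where "b = coord \<alpha> s / (of_nat (s choose i) * a)"
    have aK: "a \<in> K" "a \<noteq> 0" "v a = - int q * step_fn k i"
      by (simp_all add: a_def kpow_in_K kpow_nonzero v_kpow)
    have bK: "b \<in> K" unfolding b_def using A aK by (intro K_divide K_mult K_of_nat coord_in_K) auto
    have "coord \<alpha> s \<in> P (\<nu> s)" using A s False by (metis add.right_neutral)
    moreover have "\<nu> s = \<nu> (s - i) + v a"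
      using i aK(3) by (simp add: \<nu>_def algebra_simps flip: i(4))
    ultimately have bP: "b \<in> P (\<nu> (s - i))"
      using aK nz v_of_nat[OF i(3)] by (simp add: b_def P_divide v_mult)
    have "mono i a \<in> \<MM>" using aK i by (auto simp: max_ideal_coords mono_GA coord_mono \<nu>_def P_iff)
    moreover have "mono (s - i) b \<in> \<MM>" using bK bP by (auto simp: max_ideal_coords mono_GA coord_mono)
    moreover have "ga_mult G (mono i a) (mono (s - i) b) = mono s (coord \<alpha> s)"
      using i s aK bK nz by (subst mono_mult) (auto simp: b_def)
    ultimately show ?thesis by blast
  qed
  then obtain x y where xy: "\<And>s. s < q \<Longrightarrow> x s \<in> \<MM>" "\<And>s. s < q \<Longrightarrow> y s \<in> \<MM>"
    "\<And>s. s < q \<Longrightarrow> ga_mult G (x s) (y s) = mono s (coord \<alpha> s)"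
    by metis
  have "\<alpha> = (\<lambda>\<tau>. \<Sum>i<length (map x [0..<q]). ga_mult G (map x [0..<q] ! i) (map y [0..<q] ! i) \<tau>)"
  proof (rule GA_eqI)
    have c: "coord \<alpha> s \<in> K" for s using A by (intro coord_in_K) auto
    show "(\<lambda>\<tau>. \<Sum>i<length (map x [0..<q]). ga_mult G (map x [0..<q] ! i) (map y [0..<q] ! i) \<tau>) \<in> GA"
      using xy c by (intro ga_sum_GA) (simp add: mono_GA)
    fix j assume j: "j < q"
    have "coord (\<lambda>\<tau>. \<Sum>i<length (map x [0..<q]). ga_mult G (map x [0..<q] ! i) (map y [0..<q] ! i) \<tau>) j
      = (\<Sum>s<q. if s = j then coord \<alpha> s else 0)"
      unfolding coord_sum using xy j by (intro sum.cong) (auto simp: coord_mono)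
    thus "coord \<alpha> j = coord (\<lambda>\<tau>. \<Sum>i<length (map x [0..<q]). ga_mult G (map x [0..<q] ! i) (map y [0..<q] ! i) \<tau>) j"
      using j by simp
  qed (use A in blast)
  thus "\<alpha> \<in> ideal_square G \<MM>"
    unfolding ideal_square_def mem_Collect_eq using xy
    by (intro exI[of _ "map x [0..<q]"] exI[of _ "map y [0..<q]"]) auto
qed

end

section \<open>Embedding dimension and generators\<close>

context ideal_scaffold
begin

lemma scalar_in_order: "c \<in> K \<Longrightarrow> c \<in> P 0 \<Longrightarrow> mono 0 c \<in> \<AA>"
  using q_pos by (simp add: order_mono step_zero)

text \<open>Monomials of least possible valuation at the indices in \<open>N\<close> serve as the
  family. Modulo the square only the scalars \<open>coord (as ! i) 0\<close> act, so coordinate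
  \<open>f j\<close> of the combination forces the \<open>j\<close>-th scalar into
  \<open>P (int q)\<close>.\<close>

lemma independent_mod_square:
  fixes f :: "nat \<Rightarrow> nat"
  assumes f: "bij_betw f {..<r} N"
  shows "\<exists>xs. length xs = r \<and> set xs \<subseteq> \<MM> \<and>
    (\<forall>as. length as = r \<longrightarrow> set as \<subseteq> \<AA> \<longrightarrow>
      (\<lambda>\<tau>. \<Sum>i<r. ga_mult G (as ! i) (xs ! i) \<tau>) \<in> ideal_square G \<MM> \<longrightarrow> set as \<subseteq> \<MM>)"
proof -
  define \<epsilon> where "\<epsilon> s = kpow (if s = 0 then 1 else - step_fn k s)" for s
  define x where "x i = mono (f i) (\<epsilon> (f i))" for i
  have \<epsilon>: "\<epsilon> s \<in> K" "\<epsilon> s \<noteq> 0" "v (\<epsilon> s) = \<nu> s" for s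
    by (auto simp: \<epsilon>_def kpow_in_K kpow_nonzero v_kpow \<nu>_def)
  have fN: "f i \<in> N" if "i < r" for i using f that by (auto simp: bij_betw_def)
  have inj: "f i = f j \<longleftrightarrow> i = j" if "i < r" "j < r" for i j
    using f that by (auto simp: bij_betw_def inj_on_def)
  have xM: "x i \<in> \<MM>" if "i < r" for i
    using \<epsilon> by (auto simp: x_def max_ideal_coords mono_GA coord_mono P_iff)
  have "set as \<subseteq> \<MM>" if as: "length as = r" "set as \<subseteq> \<AA>"
    and sq: "(\<lambda>\<tau>. \<Sum>i<r. ga_mult G (as ! i) (map x [0..<r] ! i) \<tau>) \<in> ideal_square G \<MM>" for as
  proof
    fix \<alpha> assume "\<alpha> \<in> set as"
    then obtain j where j: "j < r" "\<alpha> = as ! j" using as(1) by (metis in_set_conv_nth)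
    have asA: "as ! i \<in> \<AA>" if "i < r" for i using as that by (metis nth_mem subsetD)
    let ?s = "f j"
    have sN: "?s \<in> N" "?s < q" using fN[OF j(1)] N_less by auto
    have "coord (\<lambda>\<tau>. \<Sum>i<r. ga_mult G (as ! i) (map x [0..<r] ! i) \<tau>) ?s \<in> P (\<mu> ?s)"
      using sq sN unfolding ideal_square_iff by blast
    hence "(\<Sum>i<r. coord (ga_mult G (as ! i) (x i)) ?s) \<in> P (\<nu> ?s + int q)"
      using sN by (simp add: coord_sum)
    moreover have "(\<Sum>i<r. coord (ga_mult G (as ! i) (x i)) ?s - coord (as ! i) 0 * coord (x i) ?s) \<in> P (\<nu> ?s + int q)"
    proof (rule P_sum)
      fix i assume "i \<in> {..<r}"
      thus "coord (ga_mult G (as ! i) (x i)) ?s - coord (as ! i) 0 * coord (x i) ?s \<in> P (\<nu> ?s + int q)"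
        using coord_mult_max[OF asA xM sN(2), of i i] sN by simp
    qed
    ultimately have "(\<Sum>i<r. coord (ga_mult G (as ! i) (x i)) ?s)
      - (\<Sum>i<r. coord (ga_mult G (as ! i) (x i)) ?s - coord (as ! i) 0 * coord (x i) ?s) \<in> P (\<nu> ?s + int q)"
      by (rule P_diff)
    hence "(\<Sum>i<r. coord (as ! i) 0 * coord (x i) ?s) \<in> P (\<nu> ?s + int q)"
      by (simp add: sum_subtractf)
    also have "(\<Sum>i<r. coord (as ! i) 0 * coord (x i) ?s) = (\<Sum>i<r. if i = j then coord \<alpha> 0 * \<epsilon> ?s else 0)"
      using sN inj j by (intro sum.cong refl) (auto simp: x_def coord_mono)
    also have "\<dots> = coord \<alpha> 0 * \<epsilon> ?s" using j(1) by simp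
    finally have "coord \<alpha> 0 \<in> P (int q)" using \<epsilon> by (simp add: P_mult_cancel)
    thus "\<alpha> \<in> \<MM>" using asA[OF j(1)] j(2) by (simp add: max_ideal_iff)
  qed
  moreover have "set (map x [0..<r]) \<subseteq> \<MM>" using xM by auto
  ultimately show ?thesis by (intro exI[of _ "map x [0..<r]"]) simp
qed

text \<open>A relation over \<open>K\<close> among the coordinates at \<open>N\<close>, scaled to be
  primitive, gives scalars in the order, not all in the maximal ideal. The combination vanishes at
  \<open>N\<close>, and at other indices the square has the same bounds as the maximal
  ideal.\<close>

lemma dependent_mod_square:
  assumes xs: "length xs = r" "set xs \<subseteq> \<MM>" and r: "card N < r"
  shows "\<exists>as. length as = r \<and> set as \<subseteq> \<AA> \<and> \<not> set as \<subseteq> \<MM> \<and>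
      (\<lambda>\<tau>. \<Sum>i<r. ga_mult G (as ! i) (xs ! i) \<tau>) \<in> ideal_square G \<MM>"
proof -
  have xM: "xs ! i \<in> \<MM>" if "i < r" for i using xs that by (metis nth_mem subsetD)
  have xGA: "xs ! i \<in> GA" if "i < r" for i using xM[OF that] by (simp add: max_ideal_coords)
  have cr: "card N < card {..<r}" using r by simp
  have cK: "coord (xs ! i) s \<in> K" if "i \<in> {..<r}" for i s using xGA that by (intro coord_in_K) auto
  obtain c where c: "\<And>i. c i \<in> K" "\<exists>i\<in>{..<r}. c i \<noteq> 0" "\<And>s. s \<in> N \<Longrightarrow> (\<Sum>i<r. c i * coord (xs ! i) s) = 0"
  proof (rule homogeneous_system_nontrivial[OF finite_N finite_lessThan cr, of "\<lambda>i s. coord (xs ! i) s"])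
    fix c
    assume "\<And>i. c i \<in> K" "\<exists>i\<in>{..<r}. c i \<noteq> 0" "\<And>s. s \<in> N \<Longrightarrow> (\<Sum>i<r. c i * coord (xs ! i) s) = 0"
    thus thesis by (rule that)
  qed (rule cK)
  obtain d where d: "d \<in> K" "d \<noteq> 0" "\<And>i. i \<in> {..<r} \<Longrightarrow> d * c i \<in> P 0" "\<exists>i\<in>{..<r}. d * c i = 1"
    using primitive_scaling[of "{..<r}" c] c by auto
  define as where "as = map (\<lambda>i. mono 0 (d * c i)) [0..<r]"
  have asA: "mono 0 (d * c i) \<in> \<AA>" if "i < r" for i
    using d c that by (intro scalar_in_order K_mult) auto
  have "(\<lambda>\<tau>. \<Sum>i<r. ga_mult G (as ! i) (xs ! i) \<tau>) \<in> ideal_square G \<MM>"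
    unfolding ideal_square_iff
  proof (intro conjI allI impI)
    show "(\<lambda>\<tau>. \<Sum>i<r. ga_mult G (as ! i) (xs ! i) \<tau>) \<in> GA"
      using asA xGA by (intro ga_sum_GA ga_mult_GA) (auto simp: as_def order_GA)
    fix s assume s: "s < q"
    have e: "coord (\<lambda>\<tau>. \<Sum>i<r. ga_mult G (as ! i) (xs ! i) \<tau>) s = (\<Sum>i<r. d * c i * coord (xs ! i) s)"
      unfolding coord_sum using s by (intro sum.cong) (auto simp: as_def coord_scalar_mult)
    show "coord (\<lambda>\<tau>. \<Sum>i<r. ga_mult G (as ! i) (xs ! i) \<tau>) s \<in> P (\<mu> s)"
    proof (cases "s \<in> N")
      case True
      thus ?thesis using c(3)[OF True] unfolding e by (simp add: mult.assoc flip: sum_distrib_left)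
    next
      case False
      have "d * c i * coord (xs ! i) s \<in> P (\<nu> s)" if "i \<in> {..<r}" for i
        using xM[of i] that s by (intro P_mult_left[OF d(3)[OF that]]) (auto simp: max_ideal_coords)
      hence "(\<Sum>i<r. d * c i * coord (xs ! i) s) \<in> P (\<nu> s)" by (rule P_sum)
      thus ?thesis using False unfolding e by simp
    qed
  qed
  moreover have "\<not> set as \<subseteq> \<MM>"
  proof -
    obtain i where i: "i < r" "d * c i = 1" using d(4) by auto
    have "mono 0 1 \<notin> \<MM>"
      using q_pos by (simp add: max_ideal_iff coord_mono one_in_P del: of_nat_power)
    moreover have "mono 0 1 \<in> set as" using i by (force simp: as_def)
    ultimately show ?thesis by blast
  qed
  ultimately show ?thesis using asA by (intro exI[of _ as]) (auto simp: as_def)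
qed

lemma embedding_dim_eq: "embedding_dim G \<AA> = 1 + card (indecomposables p q k)"
proof -
  obtain f where f: "bij_betw f {..<card N} N"
    using ex_bij_betw_nat_finite[OF finite_N] by (auto simp: atLeast0LessThan)
  have "embedding_dim G \<AA> = card N"
    unfolding embedding_dim_def Let_def
  proof (rule Greatest_equality)
    fix r
    assume "\<exists>xs. length xs = r \<and> set xs \<subseteq> \<MM> \<and> (\<forall>as. length as = r \<longrightarrow> set as \<subseteq> \<AA> \<longrightarrow>
      (\<lambda>\<tau>. \<Sum>i<r. ga_mult G (as ! i) (xs ! i) \<tau>) \<in> ideal_square G \<MM> \<longrightarrow> set as \<subseteq> \<MM>)"
    then obtain xs where xs: "length xs = r" "set xs \<subseteq> \<MM>" and ind: "\<And>as. length as = r \<Longrightarrow> set as \<subseteq> \<AA> \<Longrightarrow>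
      (\<lambda>\<tau>. \<Sum>i<r. ga_mult G (as ! i) (xs ! i) \<tau>) \<in> ideal_square G \<MM> \<Longrightarrow> set as \<subseteq> \<MM>" by blast
    show "r \<le> card N"
    proof (rule ccontr)
      assume "\<not> r \<le> card N"
      then obtain as where "length as = r" "set as \<subseteq> \<AA>" "\<not> set as \<subseteq> \<MM>"
        "(\<lambda>\<tau>. \<Sum>i<r. ga_mult G (as ! i) (xs ! i) \<tau>) \<in> ideal_square G \<MM>"
        using dependent_mod_square[OF xs] by auto
      thus False using ind by blast
    qed
  qed (rule independent_mod_square[OF f])
  thus ?thesis by (simp add: card_N)
qed

section \<open>Minimal number of generators and freeness\<close>

definition B where "B = unreachables p q t k"

lemma finite_B: "finite B"
  by (simp add: B_def finite_unreachables)

lemma B_less: "b \<in> B \<Longrightarrow> b < q"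
  by (simp add: B_def unreachables_def)

lemma top_in_B: "q - 1 \<in> B"
  using q_pos by (auto simp: B_def unreachables_def)

text \<open>No exponent \<open>a > b\<close> contributes to coordinate \<open>b\<close> without an
  extra \<open>q\<close> of valuation: either the binomial vanishes, or the level drop strictly
  exceeds the allowed denominator.\<close>

lemma act_congruent:
  assumes A: "\<alpha> \<in> \<AA>" and y: "y \<in> P h" and b: "b \<in> B"
  shows "ycoord (ga_act G \<alpha> y) b - coord \<alpha> 0 * ycoord y b \<in> P (int q * lev b + int q)"
proof -
  have bq: "b < q" using b by (rule B_less)
  have "{b..<q} = insert b {b<..<q}" using bq by auto
  hence "ycoord (ga_act G \<alpha> y) b - coord \<alpha> 0 * ycoord y b
     = (\<Sum>a\<in>{b<..<q}. of_nat (a choose b) * coord \<alpha> (a - b) * ycoord y a)"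
    unfolding ycoord_act[OF order_GA[OF A] bq] by simp
  also have "\<dots> \<in> P (int q * lev b + int q)"
  proof (rule P_sum)
    fix a assume a: "a \<in> {b<..<q}"
    show "of_nat (a choose b) * coord \<alpha> (a - b) * ycoord y a \<in> P (int q * lev b + int q)"
    proof (cases "p dvd (a choose b)")
      case True
      hence "(of_nat (a choose b) :: 'a) = 0" by (simp add: of_nat_eq_0_iff_dvd)
      thus ?thesis by simp
    next
      case False
      hence "lev a - lev b \<noteq> step_fn k (a - b)"
        using a b by (auto simp: B_def unreachables_def lev_def)
      hence "lev b + 1 + step_fn k (a - b) \<le> lev a" using lev_drop[of b a] a by simp
      hence "int q * (lev b + 1 + step_fn k (a - b)) \<le> int q * lev a" by (intro mult_left_mono) auto
      moreover have "coord \<alpha> (a - b) * ycoord y a \<in> P (- int q * step_fn k (a - b) + int q * lev a)"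
        using order_coord[OF A, of "a - b"] y a by (intro P_mult) (auto simp: ideal_iff)
      ultimately have "coord \<alpha> (a - b) * ycoord y a \<in> P (int q * lev b + int q)"
        by (elim P_mono[rotated]) (simp add: algebra_simps)
      thus ?thesis unfolding mult.assoc by (rule P_mult_left[OF P_of_nat])
    qed
  qed
  finally show ?thesis .
qed

definition gen :: "nat \<Rightarrow> 'a" where "gen b = kpow (lev b) * Y ^ b"

lemma ycoord_gen: "b < q \<Longrightarrow> j < q \<Longrightarrow> ycoord (gen b) j = (if j = b then kpow (lev b) else 0)"
  unfolding gen_def by (intro ycoord_monomial kpow_in_K)

lemma gen_in_ideal: "b < q \<Longrightarrow> gen b \<in> P h"
  by (auto simp: ideal_iff ycoord_gen kpow_P)

text \<open>For fewer than \<open>card B\<close> elements there is a primitive linear form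
  \<open>L\<close> in the normalized coordinates at \<open>B\<close> that kills them all. By
  \<open>act_congruent\<close> its values on everything they generate lie in
  \<open>P (int q)\<close>, yet \<open>L (gen b) = 1\<close> for some \<open>b\<close>.\<close>

lemma card_B_le_gens:
  assumes "generates_over G \<AA> (P h) xs"
  shows "card B \<le> length xs"
proof (rule ccontr)
  assume "\<not> card B \<le> length xs"
  hence cr: "card {..<length xs} < card B" by simp
  have xP: "xs ! i \<in> P h" if "i < length xs" for i
    using assms that nth_mem[OF that] by (auto simp: generates_over_def)
  have cK: "ycoord (xs ! i) b / kpow (lev b) \<in> K" for i b
    by (intro K_divide ycoord_in_K kpow_in_K)
  obtain c where c: "\<And>i. c i \<in> K" "\<exists>b\<in>B. c b \<noteq> 0"
    "\<And>i. i \<in> {..<length xs} \<Longrightarrow> (\<Sum>b\<in>B. c b * (ycoord (xs ! i) b / kpow (lev b))) = 0"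
  proof (rule homogeneous_system_nontrivial[OF finite_lessThan finite_B cr,
        of "\<lambda>b i. ycoord (xs ! i) b / kpow (lev b)"])
    fix c
    assume "\<And>i. c i \<in> K" "\<exists>b\<in>B. c b \<noteq> 0"
      "\<And>i. i \<in> {..<length xs} \<Longrightarrow> (\<Sum>b\<in>B. c b * (ycoord (xs ! i) b / kpow (lev b))) = 0"
    thus thesis by (rule that)
  qed (rule cK)
  obtain d where d: "d \<in> K" "d \<noteq> 0" "\<And>b. b \<in> B \<Longrightarrow> d * c b \<in> P 0" "\<exists>b\<in>B. d * c b = 1"
    using primitive_scaling[of B c] c finite_B by auto
  obtain b where b: "b \<in> B" "d * c b = 1" using d(4) by blast
  define L where "L y = (\<Sum>b\<in>B. d * c b * (ycoord y b / kpow (lev b)))" for y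
  have Lx: "L (xs ! i) = 0" if "i < length xs" for i
  proof -
    have "L (xs ! i) = d * (\<Sum>b\<in>B. c b * (ycoord (xs ! i) b / kpow (lev b)))"
      by (simp only: L_def sum_distrib_left mult.assoc)
    thus ?thesis using c(3)[of i] that by simp
  qed
  obtain as where as: "length as = length xs" "set as \<subseteq> \<AA>" "gen b = (\<Sum>i<length xs. ga_act G (as ! i) (xs ! i))"
    using assms gen_in_ideal[OF B_less[OF b(1)]] by (auto simp: generates_over_def)
  have asA: "as ! i \<in> \<AA>" if "i < length xs" for i using as that by (metis nth_mem subsetD)
  have "L (ga_act G (as ! i) (xs ! i)) - coord (as ! i) 0 * L (xs ! i) \<in> P (int q)" if i: "i < length xs" for i
  proof -
    have "L (ga_act G (as ! i) (xs ! i)) - coord (as ! i) 0 * L (xs ! i)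
      = (\<Sum>b\<in>B. d * c b * ((ycoord (ga_act G (as ! i) (xs ! i)) b - coord (as ! i) 0 * ycoord (xs ! i) b) / kpow (lev b)))"
      by (simp add: L_def sum_distrib_left diff_divide_distrib right_diff_distrib sum_subtractf mult_ac)
    also have "\<dots> \<in> P (int q)"
    proof (rule P_sum)
      fix b assume b: "b \<in> B"
      show "d * c b * ((ycoord (ga_act G (as ! i) (xs ! i)) b - coord (as ! i) 0 * ycoord (xs ! i) b) / kpow (lev b)) \<in> P (int q)"
        using act_congruent[OF asA[OF i] xP[OF i] b]
        by (intro P_mult_left[OF d(3)[OF b]]) (simp add: P_divide kpow_nonzero v_kpow add.commute)
    qed
    finally show ?thesis .
  qed
  hence "(\<Sum>i<length xs. L (ga_act G (as ! i) (xs ! i))) \<in> P (int q)" using Lx by (intro P_sum) auto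
  also have "(\<Sum>i<length xs. L (ga_act G (as ! i) (xs ! i))) = L (gen b)"
    unfolding as(3) L_def using B_less
    by (subst sum.swap) (intro sum.cong refl, simp add: ycoord_sum sum_divide_distrib sum_distrib_left)
  also have "L (gen b) = (\<Sum>b'\<in>B. if b' = b then 1 else 0)"
    unfolding L_def using b B_less by (intro sum.cong refl) (auto simp: ycoord_gen kpow_nonzero)
  also have "\<dots> = 1" using b(1) finite_B by simp
  finally show False using q_pos by (simp add: one_in_P del: of_nat_power)
qed

text \<open>Descending induction on \<open>b\<close>: an index outside \<open>B\<close> is hit from
  some \<open>a > b\<close> without loss, so a suitable \<open>mono (a - b) c\<close> in the order
  maps \<open>gen a\<close> to \<open>gen b\<close>.\<close>

lemma gen_reachable:
  assumes "b < q"
  shows "\<exists>b'\<in>B. \<exists>\<beta>\<in>\<AA>. ga_act G \<beta> (gen b') = gen b"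
  using assms
proof (induction "q - b" arbitrary: b rule: less_induct)
  case less
  show ?case
  proof (cases "b \<in> B")
    case True
    thus ?thesis using order_one ga_act_one by blast
  next
    case False
    then obtain a where a: "b < a" "a < q" "\<not> p dvd (a choose b)" "step_fn t a - step_fn t b = step_fn k (a - b)"
      using less.prems by (auto simp: B_def unreachables_def)
    have nz: "(of_nat (a choose b) :: 'a) \<noteq> 0" using a(3) by (simp add: of_nat_eq_0_iff_dvd)
    define c where "c = kpow (lev b) / (of_nat (a choose b) * kpow (lev a))"
    have cK: "c \<in> K" unfolding c_def by (intro K_divide K_mult K_of_nat kpow_in_K)
    have "int q * lev b - int q * lev a = - int q * step_fn k (a - b)"
      using a(4) by (simp add: lev_def algebra_simps flip: a(4))
    hence "v c = - int q * step_fn k (a - b)"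
      using nz v_of_nat[OF a(3)] by (simp add: c_def v_divide v_mult kpow_nonzero v_kpow)
    hence cA: "mono (a - b) c \<in> \<AA>" using cK a by (cases "c = 0") (auto simp: order_mono P_iff)
    have "gen a = kpow (lev a) * Y ^ (b + (a - b))" using a by (simp add: gen_def)
    hence "ga_act G (mono (a - b) c) (gen a) = gen b"
      using mono_act[of b "a - b" c "kpow (lev a)"] a cK kpow_in_K nz kpow_nonzero by (simp add: gen_def c_def)
    moreover obtain b' \<beta> where "b' \<in> B" "\<beta> \<in> \<AA>" "ga_act G \<beta> (gen b') = gen a"
      using less.hyps[OF diff_less_mono2[OF a(1) less.prems] a(2)] by blast
    ultimately have "ga_act G (ga_mult G (mono (a - b) c) \<beta>) (gen b') = gen b"
      using ga_act_mult[OF order_GA[OF cA] order_GA] by simp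
    thus ?thesis using order_mult[OF cA \<open>\<beta> \<in> \<AA>\<close>] \<open>b' \<in> B\<close> by blast
  qed
qed

lemma generated_by_B:
  assumes f: "bij_betw f {..<r} B"
  shows "generates_over G \<AA> (P h) (map (\<lambda>i. gen (f i)) [0..<r])"
proof -
  have fB: "f i \<in> B" if "i < r" for i using f that by (auto simp: bij_betw_def)
  have "\<exists>as. length as = length (map (\<lambda>i. gen (f i)) [0..<r]) \<and> set as \<subseteq> \<AA> \<and>
      y = (\<Sum>i<length (map (\<lambda>i. gen (f i)) [0..<r]). ga_act G (as ! i) (map (\<lambda>i. gen (f i)) [0..<r] ! i))"
    if y: "y \<in> P h" for y
  proof -
    obtain g \<beta> where g: "\<And>b. b < q \<Longrightarrow> g b \<in> B" "\<And>b. b < q \<Longrightarrow> \<beta> b \<in> \<AA>"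
      "\<And>b. b < q \<Longrightarrow> ga_act G (\<beta> b) (gen (g b)) = gen b"
      using gen_reachable by metis
    define c where "c b = ycoord y b / kpow (lev b)" for b
    have cK: "c b \<in> K" for b unfolding c_def by (intro K_divide ycoord_in_K kpow_in_K)
    have cP: "c b \<in> P 0" if "b < q" for b
      using y that by (simp add: c_def P_divide kpow_nonzero v_kpow ideal_iff)
    define \<gamma> where "\<gamma> b = ga_mult G (mono 0 (c b)) (\<beta> b)" for b
    have \<gamma>A: "\<gamma> b \<in> \<AA>" if "b < q" for b
      unfolding \<gamma>_def using that cK cP g by (intro order_mult scalar_in_order) auto
    have \<gamma>act: "ga_act G (\<gamma> b) (gen (g b)) = ycoord y b * Y ^ b" if b: "b < q" for b
    proof -
      have "ga_act G (\<gamma> b) (gen (g b)) = ga_act G (mono 0 (c b)) (gen b)"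
        unfolding \<gamma>_def using g b cK by (subst ga_act_mult) (auto simp: mono_GA order_GA)
      also have "\<dots> = ycoord y b * Y ^ b"
        using mono_act[of b 0 "c b" "kpow (lev b)"] b cK kpow_in_K kpow_nonzero by (simp add: gen_def c_def)
      finally show ?thesis .
    qed
    \<comment> \<open>The indices \<open>b\<close> are grouped by the generator from which
      \<open>gen b\<close> is reached.\<close>
    define as where "as = map (\<lambda>i. (\<lambda>\<tau>. \<Sum>b\<in>{b\<in>{..<q}. g b = f i}. \<gamma> b \<tau>)) [0..<r]"
    have "set as \<subseteq> \<AA>" using \<gamma>A by (auto simp: as_def intro!: order_sum)
    moreover have "y = (\<Sum>i<r. ga_act G (as ! i) (gen (f i)))"
    proof -
      have "(\<Sum>i<r. ga_act G (as ! i) (gen (f i))) = (\<Sum>i<r. \<Sum>b\<in>{b\<in>{..<q}. g b = f i}. ycoord y b * Y ^ b)"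
        by (intro sum.cong refl) (auto simp: as_def ga_act_sum \<gamma>act[symmetric] intro!: sum.cong)
      also have "\<dots> = (\<Sum>s\<in>B. \<Sum>b\<in>{b\<in>{..<q}. g b = s}. ycoord y b * Y ^ b)"
        by (rule sum.reindex_bij_betw[OF f])
      also have "\<dots> = (\<Sum>b<q. ycoord y b * Y ^ b)"
        using g(1) finite_B by (intro sum.group) auto
      finally show ?thesis using ycoord_expansion[of y] by simp
    qed
    ultimately show ?thesis by (intro exI[of _ as]) (auto simp: as_def)
  qed
  moreover have "set (map (\<lambda>i. gen (f i)) [0..<r]) \<subseteq> P h" using gen_in_ideal fB B_less by auto
  ultimately show ?thesis unfolding generates_over_def by blast
qed

lemma min_num_gens_eq: "min_num_gens G \<AA> (P h) = card B"
proof -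
  obtain f where f: "bij_betw f {..<card B} B"
    using ex_bij_betw_nat_finite[OF finite_B] by (auto simp: atLeast0LessThan)
  show ?thesis unfolding min_num_gens_def
  proof (rule Least_equality)
    show "\<exists>xs. length xs = card B \<and> generates_over G \<AA> (P h) xs"
      using generated_by_B[OF f] by (intro exI[of _ "map (\<lambda>i. gen (f i)) [0..<card B]"]) simp
  qed (use card_B_le_gens in auto)
qed

text \<open>The only generator is a multiple of \<open>Y ^ (q - 1)\<close>. All binomials
  \<open>(q - 1) choose j\<close> with \<open>j < q\<close> are prime to \<open>p\<close>, so every
  coordinate of \<open>\<alpha>\<close> can be recovered from its action on the generator.\<close>

lemma free_if_card_B_1:
  assumes "card B = 1"
  shows "is_free_over G \<AA> (P h)"
proof -
  define b where "b = q - 1"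
  have b: "b < q" using q_pos by (simp add: b_def)
  have B1: "B = {b}" using assms top_in_B by (metis b_def card_1_singletonE singletonD)
  have "bij_betw (\<lambda>_. b) {..<1::nat} B" by (auto simp: B1 bij_betw_def inj_on_def)
  from generated_by_B[OF this] have gen: "generates_over G \<AA> (P h) [gen b]" by simp
  have uniq: "as = bs" if as: "length as = 1" "set as \<subseteq> \<AA>" and bs: "length bs = 1" "set bs \<subseteq> \<AA>"
    and e: "ga_act G (as ! 0) (gen b) = ga_act G (bs ! 0) (gen b)" for as bs
  proof -
    obtain \<alpha> \<beta> where ab: "as = [\<alpha>]" "bs = [\<beta>]" using as(1) bs(1) by (metis One_nat_def length_0_conv length_Suc_conv)
    have A: "\<alpha> \<in> GA" "\<beta> \<in> GA" using as bs ab order_GA by auto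
    have "\<alpha> = \<beta>"
    proof (rule GA_eqI[OF A])
      fix j assume j: "j < q"
      have "coord \<alpha> j * (of_nat (b choose (b - j)) * kpow (lev b)) = ycoord (ga_act G \<alpha> (gen b)) (b - j)" if "\<alpha> \<in> GA" for \<alpha>
      proof -
        have "ycoord (ga_act G \<alpha> (gen b)) (b - j)
          = (\<Sum>a\<in>{b - j..<q}. if a = b then of_nat (b choose (b - j)) * coord \<alpha> (b - (b - j)) * kpow (lev b) else 0)"
          unfolding ycoord_act[OF that, of "b - j", OF le_less_trans[OF diff_le_self b]]
          using b by (intro sum.cong refl) (auto simp: ycoord_gen)
        also have "\<dots> = of_nat (b choose (b - j)) * coord \<alpha> (b - (b - j)) * kpow (lev b)" using b by simp
        finally show ?thesis using j by (simp add: b_def mult_ac)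
      qed
      note * = this[OF A(1)] this[OF A(2)]
      have "\<not> p dvd (b choose (b - j))"
        using not_dvd_choose_pred_prime_power[OF prime, of n b "b - j"] q_pos b_def by simp
      hence "(of_nat (b choose (b - j)) :: 'a) \<noteq> 0" by (simp add: of_nat_eq_0_iff_dvd)
      thus "coord \<alpha> j = coord \<beta> j" using * e ab kpow_nonzero[of "lev b"]
        by (metis mult_eq_0_iff mult_right_cancel nth_Cons_0)
    qed
    thus ?thesis using ab by simp
  qed
  show ?thesis unfolding is_free_over_def
  proof (intro exI[of _ "[gen b]"] conjI ballI)
    show "set [gen b] \<subseteq> P h" using gen_in_ideal[OF b] by simp
    fix y assume "y \<in> P h"
    then obtain as where as: "length as = length [gen b]" "set as \<subseteq> \<AA>"
      "y = (\<Sum>i<length [gen b]. ga_act G (as ! i) ([gen b] ! i))"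
      using gen unfolding generates_over_def by blast
    show "\<exists>!as. length as = length [gen b] \<and> set as \<subseteq> \<AA> \<and>
        y = (\<Sum>i<length [gen b]. ga_act G (as ! i) ([gen b] ! i))"
    proof (rule ex1I[of _ as])
      fix bs assume "length bs = length [gen b] \<and> set bs \<subseteq> \<AA> \<and>
        y = (\<Sum>i<length [gen b]. ga_act G (bs ! i) ([gen b] ! i))"
      thus "bs = as" using as by (intro uniq) auto
    qed (use as in blast)
  qed
qed

text \<open>A basis generates, so it has at least \<open>card B\<close> elements. If these were two
  or more, their images under all \<open>mono j 1\<close> would outnumber the degree
  \<open>q\<close> and be dependent over \<open>K\<close>; a primitive form of the relation has
  coefficients in the order and contradicts uniqueness.\<close>

lemma card_B_1_if_free:
  assumes "is_free_over G \<AA> (P h)"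
  shows "card B = 1"
proof (rule ccontr)
  assume n1: "card B \<noteq> 1"
  have "card B > 0" using top_in_B finite_B by (auto simp: card_gt_0_iff)
  hence B2: "card B \<ge> 2" using n1 by simp
  obtain xs where xs: "set xs \<subseteq> P h" and free: "\<forall>y\<in>P h. \<exists>!as. length as = length xs \<and> set as \<subseteq> \<AA> \<and>
            y = (\<Sum>i<length xs. ga_act G (as ! i) (xs ! i))"
    using assms unfolding is_free_over_def by (elim exE conjE)
  let ?r = "length xs"
  have "generates_over G \<AA> (P h) xs"
    unfolding generates_over_def using xs by (intro conjI ballI ex1_implies_ex[OF bspec[OF free]])
  hence r: "?r \<ge> 2" using card_B_le_gens B2 by fastforce
  define I where "I = {..<?r} \<times> {..<q}"
  have qI: "q < card I" using r q_pos by (simp add: I_def card_cartesian_product)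
  have finI: "finite I" by (simp add: I_def)
  obtain c where c: "\<And>i. c i \<in> K" "\<exists>i\<in>I. c i \<noteq> 0"
    "(\<Sum>i\<in>I. c i * ga_act G (mono (snd i) 1) (xs ! fst i)) = 0"
  proof (rule dependent_if_card_gt_degree[OF finI qI, of "\<lambda>i. ga_act G (mono (snd i) 1) (xs ! fst i)"])
    fix c
    assume "\<And>i. c i \<in> K" "\<exists>i\<in>I. c i \<noteq> 0" "(\<Sum>i\<in>I. c i * ga_act G (mono (snd i) 1) (xs ! fst i)) = 0"
    thus thesis by (rule that)
  qed
  obtain d where d: "d \<in> K" "d \<noteq> 0" "\<And>i. i \<in> I \<Longrightarrow> d * c i \<in> P 0" "\<exists>i\<in>I. d * c i = 1"
    using primitive_scaling[of I c] c finI by auto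
  define \<alpha> where "\<alpha> i = of_coords (\<lambda>j. d * c (i, j))" for i
  have \<alpha>A: "\<alpha> i \<in> \<AA>" if i: "i < ?r" for i
  proof -
    have "d * c (i, j) \<in> P (- int q * step_fn k j)" if "j < q" for j
      by (rule P_mono[OF _ d(3)]) (use i that in \<open>auto simp: I_def step_fn_def\<close>)
    thus ?thesis using d c by (simp add: order_iff \<alpha>_def of_coords_GA coord_of_coords K_mult)
  qed
  have act: "ga_act G (\<alpha> i) y = (\<Sum>j<q. d * c (i, j) * ga_act G (mono j 1) y)" for i y
  proof -
    have "\<alpha> i \<tau> = (\<Sum>j<q. d * c (i, j) * mono j 1 \<tau>)" for \<tau>
    proof (cases "\<tau> \<in> G")
      case True
      have "mono j 1 \<tau> = coeff (lagrange \<tau>) j" if "j < q" for j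
      proof -
        have "mono j 1 \<tau> = (\<Sum>l<q. (if l = j then 1 else 0) * coeff (lagrange \<tau>) l)"
          using True by (simp add: mono_def of_coords_def)
        also have "\<dots> = (\<Sum>l<q. if l = j then coeff (lagrange \<tau>) l else 0)"
          by (intro sum.cong) auto
        finally have "mono j 1 \<tau> = (\<Sum>l<q. if l = j then coeff (lagrange \<tau>) l else 0)" .
        thus ?thesis using that by simp
      qed
      thus ?thesis using True by (simp add: \<alpha>_def of_coords_def)
    qed (simp add: \<alpha>_def of_coords_def mono_def)
    hence "\<alpha> i = (\<lambda>\<tau>. \<Sum>j<q. d * c (i, j) * mono j 1 \<tau>)" by (rule ext)
    thus ?thesis by (simp add: ga_act_sum) (simp add: ga_act_def sum_distrib_left mult.assoc)
  qed
  have "(\<Sum>i<?r. ga_act G (\<alpha> i) (xs ! i)) = d * (\<Sum>i\<in>I. c i * ga_act G (mono (snd i) 1) (xs ! fst i))"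
    unfolding act I_def sum_distrib_left by (subst sum.cartesian_product) (auto intro!: sum.cong simp: mult.assoc)
  also have "\<dots> = 0" using c(3) by simp
  finally have rel: "(\<Sum>i<?r. ga_act G (\<alpha> i) (xs ! i)) = 0" .
  define as bs where "as = map \<alpha> [0..<?r]" and "bs = map (\<lambda>_. (\<lambda>_::'a\<Rightarrow>'a. 0::'a)) [0..<?r]"
  have zA: "(\<lambda>_. 0) \<in> \<AA>" using order_sum[of "{}" "\<lambda>_. ga_one"] by simp
  have "\<exists>!as. length as = ?r \<and> set as \<subseteq> \<AA> \<and> 0 = (\<Sum>i<?r. ga_act G (as ! i) (xs ! i))"
    using bspec[OF free P_zero] .
  moreover have "length as = ?r \<and> set as \<subseteq> \<AA> \<and> 0 = (\<Sum>i<?r. ga_act G (as ! i) (xs ! i))"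
    using \<alpha>A rel by (auto simp: as_def)
  moreover have "length bs = ?r \<and> set bs \<subseteq> \<AA> \<and> 0 = (\<Sum>i<?r. ga_act G (bs ! i) (xs ! i))"
    using zA by (auto simp: bs_def ga_act_def)
  ultimately have "as = bs" by blast
  obtain i j where ij: "i < ?r" "j < q" "d * c (i, j) = 1" using d(4) by (auto simp: I_def)
  have "\<alpha> i = (\<lambda>_. 0)" using \<open>as = bs\<close> ij(1) by (auto simp: as_def bs_def map_eq_conv)
  hence "coord (\<alpha> i) j = 0" by (simp add: coord_def)
  moreover have "coord (\<alpha> i) j = 1" using ij by (simp add: \<alpha>_def coord_of_coords)
  ultimately show False by simp
qed

lemma free_iff: "is_free_over G \<AA> (P h) \<longleftrightarrow> card B = 1"
  using free_if_card_B_1 card_B_1_if_free by blast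

end

theorem theorem4p5:
  fixes K :: "'a::field set" and v :: "'a \<Rightarrow> int" and p n :: nat and h :: int
  assumes "prime p" and "CHAR('a) = p"
    and "is_subfield K" and "normalized_dval v"
    and "complete_wrt_dval v K" and "perfect_residue_field v K p"
    and "galois_of_degree K (p ^ n)"
    and "totally_ramified v K (p ^ n)"
    and "weakly_ramified v K"
  shows
    "([h = 1] (mod int (p ^ n)) \<longrightarrow>
        is_free_over (galois_group K) (assoc_order v K h) (ideal_pow v h) \<and>
        embedding_dim (galois_group K) (assoc_order v K h) = n + 1)
     \<and>
     (\<not> [h = 1] (mod int (p ^ n)) \<longrightarrow>
        (\<forall>h'::nat. 2 \<le> h' \<and> h' \<le> p ^ n \<and> [int h' = h] (mod int (p ^ n)) \<longrightarrow>
          (let m = h' - 1; k = max m (p ^ n - m) in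
            (is_free_over (galois_group K) (assoc_order v K h) (ideal_pow v h)
               \<longleftrightarrow> 2 * h' \<ge> 2 + p ^ n) \<and>
            (\<not> is_free_over (galois_group K) (assoc_order v K h) (ideal_pow v h) \<longrightarrow>
               int (min_num_gens (galois_group K) (assoc_order v K h) (ideal_pow v h))
                 = 2 + int (alpha_fn p n m) - int (beta_fn p n m)) \<and>
            int (embedding_dim (galois_group K) (assoc_order v K h))
              = int n + 2 + int (alpha_fn p n k) - int (gamma_fn p n k))))"
proof -
  interpret weak_extension v K p n
    using assms by unfold_locales auto
  obtain Y where Y: "Y \<noteq> 0" "v Y = - 1" "\<And>\<sigma>. \<sigma> \<in> galois_group K \<Longrightarrow> \<sigma> Y - Y \<in> K"
    using ex_scaffold_generator by blast
  show ?thesis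
  proof (intro conjI impI allI)
    assume "[h = 1] (mod int (p ^ n))"
    then obtain z where z: "h = 1 + int (p ^ n) * z"
      by (metis cong_iff_lin cong_sym)
    interpret ideal_scaffold v K p n Y h z 0
      using Y z q_pos by unfold_locales auto
    \<comment> \<open>For \<open>m = 0\<close> both thresholds are \<open>q\<close>, beyond all
      indices, so neither step function jumps.\<close>
    have k: "k = p ^ n" and t: "t = p ^ n" by (simp_all add: k_def t_def)
    show "is_free_over (galois_group K) (assoc_order v K h) (ideal_pow v h)"
      using unreachables_free[OF prime, of 0 n] q_pos by (simp add: free_iff B_def t k)
    show "embedding_dim (galois_group K) (assoc_order v K h) = n + 1"
      by (simp add: embedding_dim_eq k card_indecomposables_top[OF prime])
  next
    fix h' :: nat assume h': "2 \<le> h' \<and> h' \<le> p ^ n \<and> [int h' = h] (mod int (p ^ n))"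
    then obtain z where z: "h = int h' + int (p ^ n) * z"
      by (metis cong_iff_lin)
    define m where "m = h' - 1"
    have m: "0 < m" "m < p ^ n" "int h' = 1 + int m" using h' by (auto simp: m_def)
    interpret ideal_scaffold v K p n Y h z m
      using Y z m by unfold_locales auto
    have B: "B = unreachables p (p ^ n) (p ^ n - m) (max m (p ^ n - m))" by (simp add: B_def k_def t_def)
    have free: "is_free_over (galois_group K) (assoc_order v K h) (ideal_pow v h) \<longleftrightarrow> p ^ n \<le> 2 * m"
    proof
      assume "p ^ n \<le> 2 * m"
      thus "is_free_over (galois_group K) (assoc_order v K h) (ideal_pow v h)"
        using unreachables_free[OF prime m(2)] by (simp add: free_iff B)
    next
      assume "is_free_over (galois_group K) (assoc_order v K h) (ideal_pow v h)"
      hence "card B = 1" by (simp add: free_iff)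
      thus "p ^ n \<le> 2 * m" using card_unreachables_nonfree(2)[OF prime m(1)] B by (metis less_irrefl not_le)
    qed
    have "2 + p ^ n \<le> 2 * h' \<longleftrightarrow> p ^ n \<le> 2 * m" using h' by (auto simp: m_def)
    moreover have "int (min_num_gens (galois_group K) (assoc_order v K h) (ideal_pow v h))
        = 2 + int (alpha_fn p n m) - int (beta_fn p n m)"
      if "\<not> is_free_over (galois_group K) (assoc_order v K h) (ideal_pow v h)"
      using card_unreachables_nonfree(1)[OF prime m(1), of n] that free
      unfolding min_num_gens_eq B by linarith
    moreover have "int (embedding_dim (galois_group K) (assoc_order v K h))
        = int n + 2 + int (alpha_fn p n k) - int (gamma_fn p n k)"
    proof -
      have "k < p ^ n" using m by (auto simp: k_def t_def)
      thus ?thesis using card_indecomposables[OF prime k_bounds(1,5)] by (simp add: embedding_dim_eq)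
    qed
    ultimately show "let m = h' - 1; k = max m (p ^ n - m) in
            (is_free_over (galois_group K) (assoc_order v K h) (ideal_pow v h)
               \<longleftrightarrow> 2 * h' \<ge> 2 + p ^ n) \<and>
            (\<not> is_free_over (galois_group K) (assoc_order v K h) (ideal_pow v h) \<longrightarrow>
               int (min_num_gens (galois_group K) (assoc_order v K h) (ideal_pow v h))
                 = 2 + int (alpha_fn p n m) - int (beta_fn p n m)) \<and>
            int (embedding_dim (galois_group K) (assoc_order v K h))
              = int n + 2 + int (alpha_fn p n k) - int (gamma_fn p n k)"
      using free unfolding Let_def m_def[symmetric] k_def t_def by blast
  qed
qed

end
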